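(* Let $f$ be an inner function with $f(0)=0$ which is not a rotation and let $\{a_{n}\}_{n\ge 1}$ be a sequence of complex numbers. Then the following conditions are equivalent: (a) The series $\sum_{n=1}^{\infty} a_{n}f^{n}(\xi)$ converges at almost every point $\xi\in \partial\mathbb{D}$. (b) The set $\bigl\{\xi\in \partial\mathbb{D}:\sup_{N}\bigl|\sum_{n=1}^{N} a_{n}f^{n}(\xi)\bigr|<\infty\bigr\}$ has positive Lebesgue measure. (c) The complex numbers $\{a_{n}\}$ satisfy $\sum_{n=1}^{\infty} |a_{n}|^{2}<\infty$.
   Context: $\mathbb{D}$ is the open unit disc of the complex plane and $\partial\mathbb{D}$ the unit circle. An inner function is an analytic mapping $f:\mathbb{D}\to\mathbb{D}$ whose radial limits have modulus one at almost every point of $\partial\mathbb{D}$. A rotation is a map $z\mapsto \lambda z$ with $|\lambda|=1$. $f^{n}$ denotes the $n$-th iterate $f\circ\cdots\circ f$ ($n$ times, not the power), which is again an inner function; for $\xi\in\partial\mathbb{D}$, $f^{n}(\xi)=\lim_{r\to1^-}f^{n}(r\xi)$, defined for almost every $\xi$. "Almost every" refers to Lebesgue measure on $\partial\mathbb{D}$. *)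

theory Defs
  imports "HOL-Analysis.Analysis"
begin

text \<open>Lebesgue (arc length) measure on the unit circle. It lives on the circle itself, not on the
  plane, and it is completed, so every subset of a null set is measurable.\<close>

definition circle_measure :: "complex measure" where
  "circle_measure =
     completion (distr (restrict_space lborel {0..<2 * pi}) (restrict_space borel (sphere 0 1)) cis)"

definition has_radial_limit :: "(complex \<Rightarrow> complex) \<Rightarrow> complex \<Rightarrow> complex \<Rightarrow> bool" where
  "has_radial_limit f \<xi> l \<longleftrightarrow> ((\<lambda>r. f (complex_of_real r * \<xi>)) \<longlongrightarrow> l) (at_left 1)"

text \<open>Meaningful only where the radial limit exists; elsewhere the value is unspecified.\<close>

definition radial_limit :: "(complex \<Rightarrow> complex) \<Rightarrow> complex \<Rightarrow> complex" where
  "radial_limit f \<xi> = Lim (at_left 1) (\<lambda>r. f (complex_of_real r * \<xi>))"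

text \<open>Self-maps of the disc are represented by total functions on the plane; the values outside
  the open disc are irrelevant here, also for iterates.\<close>

definition inner_function :: "(complex \<Rightarrow> complex) \<Rightarrow> bool" where
  "inner_function f \<longleftrightarrow>
     f analytic_on ball 0 1 \<and> f ` ball 0 1 \<subseteq> ball 0 1 \<and>
     (AE \<xi> in circle_measure. \<exists>l. has_radial_limit f \<xi> l \<and> cmod l = 1)"

definition disc_rotation :: "(complex \<Rightarrow> complex) \<Rightarrow> bool" where
  "disc_rotation f \<longleftrightarrow> (\<exists>c. cmod c = 1 \<and> (\<forall>z\<in>ball 0 1. f z = c * z))"

lemma radial_limit_eq: "has_radial_limit f \<xi> l \<Longrightarrow> radial_limit f \<xi> = l"
  unfolding has_radial_limit_def radial_limit_def by (intro tendsto_Lim) auto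

lemma measurable_cis_circle:
  "cis \<in> measurable (restrict_space lborel {0..<2 * pi}) (restrict_space borel (sphere 0 1))"
proof -
  have "continuous_on UNIV cis"
    by (intro continuous_intros)
  hence "cis \<in> borel_measurable borel"
    by (rule borel_measurable_continuous_onI)
  thus ?thesis
    by (intro measurable_restrict_space2 measurable_restrict_space1) auto
qed

lemma space_circle_measure: "space circle_measure = sphere 0 1"
  by (simp add: circle_measure_def space_restrict_space)

lemma emeasure_circle_measure_sphere: "emeasure circle_measure (sphere 0 1) = ennreal (2 * pi)"
proof -
  let ?N = "restrict_space borel (sphere 0 1) :: complex measure"
  have S: "sphere 0 1 \<in> sets ?N"
    by (metis sets.top space_borel space_restrict_space2 space_restrict_space Int_UNIV_right)
  have "cis -` sphere 0 1 \<inter> space (restrict_space lborel {0..<2 * pi}) = {0..<2 * pi}"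
    by (auto simp: space_restrict_space)
  thus ?thesis using S
    by (simp add: circle_measure_def emeasure_distr[OF measurable_cis_circle S]
        emeasure_restrict_space)
qed

end

(* Let phi be the boundary function of f. It preserves normalized arc length and, by comparing
   moments, the boundary function of f^n is the n-th iterate of phi. Put beta = cnj (integral of
   phi * cnj z), which has modulus < 1 because f is not a rotation. The moments of phi also show that
   D = z - beta * phi is orthogonal to every bounded function of phi, so D o phi^n is a reverse
   martingale difference sequence. With c_(n+1) = beta c_n + a_(n+1), summation by parts gives
   sum_(n<N) a_n phi^n = sum_(n<N) c_n (D o phi^n) + beta c_(N-1) phi^N, where c is square summable
   iff a is.
   Square summability implies a.e. convergence by Kolmogorov's maximal inequality. Conversely, the
   set where the partial sums are bounded satisfies a zero-one law, because the coefficients of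
   powers of f^n tend to 0; if it has full measure, then comparing the L^2 norm of the partial sums
   from below with the L^4 norm from above bounds the sum of |c_n|^2.
   Existence of the radial limits is Fatou's theorem, obtained here from a weak-type maximal
   inequality for the Poisson integral (Vitali covering) applied to Taylor remainders. *)
theory Submission
  imports Defs "HOL-Probability.Probability" "HOL-Complex_Analysis.Complex_Analysis"
begin

section \<open>Normalized arc length on the circle\<close>

text \<open>Radial limits do not compose: \<open>f\<close> maps a radius to a curve that need not
  approach the circle radially, so the boundary function of f^n cannot be read off pointwise from
  phi. Nor are conditional expectations used. Both are replaced by one principle: a bounded K whose
  integrals against all powers of phi and of cnj phi vanish is orthogonal to every bounded Borel
  function of phi. It gives the composition law, the projection of z^k onto functions of phi (for k
  = 1 the orthogonality of D) and, with the identity in place of phi, the last step of the zero-one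
  law. The conjugate of beta is f'(0), so |beta| < 1 is the strict Schwarz lemma. Functions of
  phi^(n+1) are functions of phi^n, so the sums have to be built from the last term downwards. The
  maximal inequality thus controls tails; an initial sum is the full sum minus a tail, which costs a
  factor 2. The series on the circle starts with phi^0 = z, that of the theorem with f^1. Evaluating
  the former at phi(z) repairs the shift, since phi preserves null sets.\<close>

definition circ :: "complex measure" where
  "circ = distr (uniform_measure lborel {0..<2 * pi}) (restrict_space borel (sphere 0 1)) cis"

lemma measurable_cis [measurable]: "cis \<in> borel_measurable borel"
  by (intro borel_measurable_continuous_onI continuous_intros)

lemma measurable_cis_sphere [measurable]:
  "cis \<in> measurable borel (restrict_space borel (sphere 0 1))"
  by (intro measurable_restrict_space2 measurable_cis) auto

lemma space_circ [simp]: "space circ = sphere 0 1"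
  by (simp add: circ_def space_restrict_space)

lemma sets_circ [measurable_cong, simp]: "sets circ = sets (restrict_space borel (sphere 0 1))"
  by (simp add: circ_def)

lemma prob_space_uniform_interval: "prob_space (uniform_measure lborel {0..<2 * pi})"
  by (rule prob_space_uniform_measure) auto

interpretation circ: prob_space circ
  unfolding circ_def
  by (intro prob_space.prob_space_distr prob_space_uniform_interval) measurable

lemma prob_circ_sphere [simp]: "measure circ (sphere 0 1) = 1"
  using circ.prob_space by simp

lemma measurable_circ_id [measurable]: "(\<lambda>z. z) \<in> borel_measurable circ"
  by (simp add: measurable_restrict_space1 cong: measurable_cong_sets)

lemma borel_measurable_circ [measurable (raw)]:
  fixes g :: "complex \<Rightarrow> 'a::topological_space"
  shows "g \<in> borel_measurable borel \<Longrightarrow> g \<in> borel_measurable circ"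
  by (simp add: measurable_restrict_space1 cong: measurable_cong_sets)

lemma continuous_on_measurable_circ:
  fixes g :: "complex \<Rightarrow> 'a::topological_space"
  shows "continuous_on (sphere 0 1) g \<Longrightarrow> g \<in> borel_measurable circ"
  by (simp add: borel_measurable_continuous_on_restrict cong: measurable_cong_sets)

lemma circ_emeasure:
  assumes [measurable]: "A \<in> sets circ"
  shows "emeasure circ A = emeasure lborel {t \<in> {0..<2 * pi}. cis t \<in> A} / ennreal (2 * pi)"
proof -
  have "emeasure circ A = emeasure (uniform_measure lborel {0..<2 * pi}) (cis -` A)"
    unfolding circ_def
    by (subst emeasure_distr) (use assms in auto)
  also have "\<dots> = emeasure lborel ({0..<2 * pi} \<inter> cis -` A) / emeasure lborel {0..<2*pi}"
  proof (rule emeasure_uniform_measure)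
    have "cis -` A \<inter> space borel \<in> sets borel"
      by (rule measurable_sets[OF measurable_cis_sphere]) (use assms in simp)
    then show "cis -` A \<in> sets lborel" by simp
  qed simp
  also have "{0..<2 * pi} \<inter> cis -` A = {t \<in> {0..<2 * pi}. cis t \<in> A}" by auto
  finally show ?thesis by simp
qed

lemma circ_integrable_bounded:
  fixes g :: "complex \<Rightarrow> 'a::{banach, second_countable_topology}"
  assumes "g \<in> borel_measurable circ" "\<And>z. cmod z = 1 \<Longrightarrow> norm (g z) \<le> B"
  shows "integrable circ g"
  by (rule circ.integrable_const_bound[where B = B]) (use assms in auto)

text \<open>Both measures are multiples of the same image of Lebesgue measure, and completion does
  not change which properties hold almost everywhere. The work can be done with the Borel
  probability measure \<open>circ\<close>, and the result is carried back at the end.\<close>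

lemma AE_circle_measure_iff: "(AE z in circle_measure. P z) \<longleftrightarrow> (AE z in circ. P z)"
proof -
  let ?N = "distr (restrict_space lborel {0..<2 * pi}) (restrict_space borel (sphere 0 1)) cis :: complex measure"
  have null: "A \<in> null_sets ?N \<longleftrightarrow> A \<in> null_sets circ" for A
  proof (cases "A \<in> sets circ")
    case True
    have "emeasure ?N A = emeasure (restrict_space lborel {0..<2*pi}) (cis -` A \<inter> {0..<2*pi})"
      using True by (subst emeasure_distr[OF measurable_cis_circle]) (simp_all add: space_restrict_space)
    also have "\<dots> = emeasure lborel {t \<in> {0..<2 * pi}. cis t \<in> A}"
      by (subst emeasure_restrict_space) (auto intro!: arg_cong[where f = "emeasure lborel"])
    finally have "emeasure ?N A = emeasure lborel {t \<in> {0..<2 * pi}. cis t \<in> A}" .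
    moreover have "emeasure circ A = 0 \<longleftrightarrow> emeasure lborel {t \<in> {0..<2 * pi}. cis t \<in> A} = 0"
      by (simp add: circ_emeasure[OF True] ennreal_divide_eq_0_iff)
    ultimately show ?thesis using True by (simp add: null_sets_def)
  qed (auto simp: null_sets_def)
  have "(AE z in ?N. P z) \<longleftrightarrow> (AE z in circ. P z)"
    unfolding eventually_ae_filter using null by (simp add: space_restrict_space) blast
  then show ?thesis unfolding circle_measure_def AE_completion_iff .
qed

text \<open>Connects Bochner integrals over \<open>circ\<close> with the gauge integrals in which
  contour integration is phrased; the half-open and the closed period differ by one point.\<close>

lemma circ_integral_cis:
  fixes g :: "complex \<Rightarrow> 'a::euclidean_space"
  assumes "continuous_on (sphere 0 1) g"
  shows "(\<integral>z. g z \<partial>circ) = (1 / (2 * pi)) *\<^sub>R integral {0..2 * pi} (\<lambda>t. g (cis t))"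
proof -
  have m: "g \<in> borel_measurable (restrict_space borel (sphere 0 1))"
    by (rule borel_measurable_continuous_on_restrict[OF assms])
  have cont: "continuous_on {0..2*pi} (\<lambda>t. g (cis t))"
    by (intro continuous_on_compose2[OF assms] continuous_intros) auto
  have mg[measurable]: "(\<lambda>t. g (cis t)) \<in> borel_measurable borel"
    by (rule measurable_compose[OF measurable_cis_sphere m])
  have "(\<integral>z. g z \<partial>circ) = (\<integral>t. g (cis t) \<partial>uniform_measure lborel {0..<2*pi})"
    unfolding circ_def by (rule integral_distr) (use m in auto)
  also have "\<dots> = (\<integral>t. (indicator {0..<2*pi} t / (2*pi)) *\<^sub>R g (cis t) \<partial>lborel)"
  proof -
    have "uniform_measure lborel {0..<2*pi} = density lborel (\<lambda>t. ennreal (indicator {0..<2*pi} t / (2*pi)))"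
      unfolding uniform_measure_def
      by (intro density_cong) (auto simp: indicator_def divide_ennreal[symmetric])
    then show ?thesis
      by (simp add: integral_density)
  qed
  also have "\<dots> = (\<integral>t. (1/(2*pi)) *\<^sub>R (indicator {0..2*pi} t *\<^sub>R g (cis t)) \<partial>lborel)"
  proof (rule integral_cong_AE)
    have "AE t in lborel. t \<noteq> 2*pi" by (rule AE_lborel_singleton)
    then show "AE t in lborel. (indicator {0..<2*pi} t / (2*pi)) *\<^sub>R g (cis t) =
       (1/(2*pi)) *\<^sub>R (indicator {0..2*pi} t *\<^sub>R g (cis t))"
      by eventually_elim (auto simp: indicator_def)
  qed measurable
  also have "\<dots> = (1/(2*pi)) *\<^sub>R (LINT t:{0..2*pi}|lborel. g (cis t))"
    unfolding set_lebesgue_integral_def by (rule integral_scaleR_right)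
  also have "(LINT t:{0..2*pi}|lborel. g (cis t)) = integral {0..2*pi} (\<lambda>t. g (cis t))"
    by (rule set_borel_integral_eq_integral) (rule borel_integrable_atLeastAtMost'[OF cont])
  finally show ?thesis .
qed

text \<open>For u = cis t the differential du is i u dt, which puts the extra factor
  \<open>z\<close> into Cauchy's formula.\<close>

lemma circ_cauchy:
  assumes "continuous_on (cball 0 1) h" "h holomorphic_on ball 0 1" "cmod w < 1"
  shows "(\<integral>z. h z * z / (z - w) \<partial>circ) = h w"
proof -
  have "((\<lambda>u. h u/(u-w)) has_contour_integral (2 * of_real pi * \<i> * h w)) (circlepath 0 1)"
    by (rule Cauchy_integral_circlepath) (use assms in auto)
  then have "((\<lambda>t. h (cis t) / (cis t - w) * \<i> * cis t) has_integral (2 * of_real pi * \<i> * h w)) {0..2*pi}"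
    by (simp add: circlepath_def has_contour_integral_part_circlepath_iff)
  then have "((\<lambda>t. (-\<i>) * (h (cis t) / (cis t - w) * \<i> * cis t)) has_integral (-\<i>) * (2 * of_real pi * \<i> * h w)) {0..2*pi}"
    by (rule has_integral_mult_right)
  then have "((\<lambda>t. h (cis t) * cis t / (cis t - w)) has_integral (2 * of_real pi * h w)) {0..2*pi}"
    by (simp add: mult_ac)
  then have "integral {0..2*pi} (\<lambda>t. h (cis t) * cis t / (cis t - w)) = 2 * of_real pi * h w"
    by (rule integral_unique)
  moreover have "continuous_on (sphere 0 1) (\<lambda>z. h z * z / (z - w))"
    using assms by (intro continuous_intros continuous_on_subset[OF assms(1)]) auto
  ultimately show ?thesis
    by (subst circ_integral_cis) (simp_all add: scaleR_conv_of_real)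
qed

lemma circ_mean_value:
  assumes "continuous_on (cball 0 1) h" "h holomorphic_on ball 0 1"
  shows "(\<integral>z. h z \<partial>circ) = h 0"
proof -
  have "(\<integral>z. h z \<partial>circ) = (\<integral>z. h z * z / (z - 0) \<partial>circ)"
    by (rule Bochner_Integration.integral_cong) auto
  then show ?thesis using circ_cauchy[OF assms, of 0] by simp
qed

lemma cnj_mult_self_circ: "cmod z = 1 \<Longrightarrow> cnj z * z = 1" "cmod z = 1 \<Longrightarrow> z * cnj z = 1"
  by (simp_all add: complex_norm_square[symmetric] mult.commute[of "cnj z"])

text \<open>On the circle cnj z inverts z, so mixed moments reduce to powers of z, which are
  analytic, or to their conjugates.\<close>

lemma monomial_unimodular:
  assumes "cmod z = 1"
  shows "z ^ i * cnj z ^ j = (if j \<le> i then z ^ (i - j) else cnj z ^ (j - i))"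
proof (cases "j \<le> i")
  case True
  then obtain d where "i = d + j" by (metis le_add_diff_inverse2)
  then show ?thesis
    using cnj_mult_self_circ[OF assms] by (simp add: power_add power_mult_distrib[symmetric] mult.assoc)
next
  case False
  then obtain d where "j = i + d" by (metis le_add_diff_inverse nat_le_linear)
  then show ?thesis using False
    using cnj_mult_self_circ[OF assms]
    by (simp add: power_add power_mult_distrib[symmetric] mult.assoc[symmetric])
qed

lemma circ_moment: "(\<integral>z. z ^ i * cnj z ^ j \<partial>circ) = of_bool (i = j)"
proof -
  have pos: "(\<integral>z. z ^ k \<partial>circ) = of_bool (k = 0)" for k
    by (subst circ_mean_value) (auto intro!: continuous_intros holomorphic_intros)
  have neg: "(\<integral>z. cnj z ^ k \<partial>circ) = of_bool (k = 0)" for k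
    using pos[of k] by (simp flip: complex_cnj_power)
  have "(\<integral>z. z ^ i * cnj z ^ j \<partial>circ) = (\<integral>z. (if j \<le> i then z ^ (i - j) else cnj z ^ (j - i)) \<partial>circ)"
    by (rule Bochner_Integration.integral_cong) (auto simp: monomial_unimodular)
  also have "\<dots> = of_bool (i = j)"
    using pos neg by (cases "j \<le> i") auto
  finally show ?thesis .
qed

section \<open>Measures on the circle are determined by their moments\<close>

text \<open>The algebra generated by z and cnj z. Monomials are not reduced by z cnj z = 1, so
  closure under products is an identity of functions on the whole plane.\<close>

inductive trig_poly :: "(complex \<Rightarrow> complex) \<Rightarrow> bool" where
  monomial: "trig_poly (\<lambda>z. c * (z ^ i * cnj z ^ j))"
| add: "trig_poly f \<Longrightarrow> trig_poly g \<Longrightarrow> trig_poly (\<lambda>z. f z + g z)"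

lemma trig_poly_monomial_mult: "trig_poly g \<Longrightarrow> trig_poly (\<lambda>z. c * (z ^ i * cnj z ^ j) * g z)"
proof (induction rule: trig_poly.induct)
  case (monomial d k l)
  have "(\<lambda>z. c * (z ^ i * cnj z ^ j) * (d * (z ^ k * cnj z ^ l))) =
      (\<lambda>z. (c * d) * (z ^ (i + k) * cnj z ^ (j + l)))"
    by (simp add: power_add mult_ac)
  then show ?case by (metis trig_poly.monomial)
next
  case (add f g)
  then show ?case by (simp add: distrib_left trig_poly.add)
qed

lemma trig_poly_mult: "trig_poly f \<Longrightarrow> trig_poly g \<Longrightarrow> trig_poly (\<lambda>z. f z * g z)"
  by (induction rule: trig_poly.induct)
    (auto simp: distrib_right intro: trig_poly_monomial_mult trig_poly.add)

lemma trig_poly_const: "trig_poly (\<lambda>z. c)"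
  using trig_poly.monomial[of c 0 0] by simp

lemma trig_poly_Re_Im: "trig_poly (\<lambda>z. complex_of_real (Re z))" "trig_poly (\<lambda>z. complex_of_real (Im z))"
proof -
  have "trig_poly (\<lambda>z. (1/2) * (z ^ 1 * cnj z ^ 0) + (1/2) * (z ^ 0 * cnj z ^ 1))"
    by (intro trig_poly.intros)
  also have "(\<lambda>z. (1/2) * (z ^ 1 * cnj z ^ 0) + (1/2) * (z ^ 0 * cnj z ^ 1)) = (\<lambda>z. complex_of_real (Re z))"
    by (auto simp: complex_eq_iff)
  finally show "trig_poly (\<lambda>z. complex_of_real (Re z))" .
  have "trig_poly (\<lambda>z. (-\<i>/2) * (z ^ 1 * cnj z ^ 0) + (\<i>/2) * (z ^ 0 * cnj z ^ 1))"
    by (intro trig_poly.intros)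
  also have "(\<lambda>z. (-\<i>/2) * (z ^ 1 * cnj z ^ 0) + (\<i>/2) * (z ^ 0 * cnj z ^ 1)) = (\<lambda>z. complex_of_real (Im z))"
    by (auto simp: complex_eq_iff)
  finally show "trig_poly (\<lambda>z. complex_of_real (Im z))" .
qed

lemma trig_poly_continuous: "trig_poly f \<Longrightarrow> continuous_on A f"
  by (induction rule: trig_poly.induct) (auto intro!: continuous_intros)

text \<open>Stone-Weierstrass for the algebra of real functions whose complexification is a
  \<open>trig_poly\<close>; Re and Im belong to it and separate points.\<close>

lemma circle_weierstrass:
  fixes g :: "complex \<Rightarrow> real"
  assumes "continuous_on (sphere 0 1) g" "0 < e"
  shows "\<exists>p. trig_poly (\<lambda>z. complex_of_real (p z)) \<and> (\<forall>z\<in>sphere 0 1. \<bar>g z - p z\<bar> < e)"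
proof (rule Stone_Weierstrass_HOL[where P = "\<lambda>p. trig_poly (\<lambda>z. complex_of_real (p z))"])
  show "compact (sphere 0 1 :: complex set)" by simp
  show "continuous_on (sphere 0 1) p" if "trig_poly (\<lambda>z. complex_of_real (p z))" for p
    using continuous_on_Re[OF trig_poly_continuous[OF that, of "sphere 0 1"]] by simp
  fix x y :: complex assume "x \<in> sphere 0 1 \<and> y \<in> sphere 0 1 \<and> x \<noteq> y"
  then have "Re x \<noteq> Re y \<or> Im x \<noteq> Im y" by (simp add: complex_eq_iff)
  then show "\<exists>f. trig_poly (\<lambda>z. complex_of_real (f z)) \<and> f x \<noteq> f y"
    using trig_poly_Re_Im by blast
qed (use assms trig_poly.add trig_poly_mult trig_poly_const in auto)

lemma finite_measure_sphere_integrable: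
  fixes g :: "complex \<Rightarrow> 'a::euclidean_space"
  assumes M: "finite_measure M" "sets M = sets (restrict_space borel (sphere 0 1))"
    and g: "continuous_on (sphere 0 1) g"
  shows "integrable M g"
proof -
  have sp: "space M = sphere 0 1"
    using sets_eq_imp_space_eq[OF M(2)] by (simp add: space_restrict_space)
  have "bounded (g ` sphere 0 1)"
    by (rule compact_imp_bounded[OF compact_continuous_image[OF g]]) simp
  then obtain B where "\<And>z. z \<in> sphere 0 1 \<Longrightarrow> norm (g z) \<le> B"
    by (metis bounded_iff imageI)
  moreover have "g \<in> borel_measurable M"
    using borel_measurable_continuous_on_restrict[OF g] by (simp add: M(2) cong: measurable_cong_sets)
  ultimately show ?thesis
    by (intro finite_measure.integrable_const_bound[OF M(1), where B = B]) (auto simp: sp)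
qed

lemma trig_poly_integral_eq:
  assumes M: "finite_measure M" "sets M = sets (restrict_space borel (sphere 0 1))"
    and N: "finite_measure N" "sets N = sets (restrict_space borel (sphere 0 1))"
    and mom: "\<And>i j. (\<integral>z. z ^ i * cnj z ^ j \<partial>M) = (\<integral>z. z ^ i * cnj z ^ j \<partial>N)"
    and p: "trig_poly p"
  shows "(\<integral>z. p z \<partial>M) = (\<integral>z. p z \<partial>N)"
  using p
proof induction
  case (add f g)
  have "integrable M f" "integrable M g" "integrable N f" "integrable N g"
    by (intro finite_measure_sphere_integrable[OF M] finite_measure_sphere_integrable[OF N]
        trig_poly_continuous add.hyps)+
  then show ?case using add.IH by simp
qed (simp add: mom)

lemma continuous_integral_eq:
  fixes g :: "complex \<Rightarrow> real"
  assumes M: "finite_measure M" "sets M = sets (restrict_space borel (sphere 0 1))"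
    and N: "finite_measure N" "sets N = sets (restrict_space borel (sphere 0 1))"
    and mom: "\<And>i j. (\<integral>z. z ^ i * cnj z ^ j \<partial>M) = (\<integral>z. z ^ i * cnj z ^ j \<partial>N)"
    and g: "continuous_on (sphere 0 1) g"
  shows "(\<integral>z. g z \<partial>M) = (\<integral>z. g z \<partial>N)"
proof -
  define T where "T = measure M (space M) + measure N (space N)"
  have T: "T \<ge> 0" by (simp add: T_def)
  have approx: "norm ((\<integral>z. g z \<partial>L) - (\<integral>z. p z \<partial>L)) \<le> e * measure L (space L)"
    if L: "finite_measure L" "sets L = sets (restrict_space borel (sphere 0 1))"
      and p: "continuous_on (sphere 0 1) p" "\<forall>z\<in>sphere 0 1. \<bar>g z - p z\<bar> < e" for L p e
  proof -
    interpret finite_measure L by fact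
    have sp: "space L = sphere 0 1"
      using sets_eq_imp_space_eq[OF L(2)] by (simp add: space_restrict_space)
    have i: "integrable L g" "integrable L p"
      by (intro finite_measure_sphere_integrable[OF L] p g)+
    have "norm (\<integral>z. g z - p z \<partial>L) \<le> (\<integral>z. e \<partial>L)"
      using p(2) i by (intro Bochner_Integration.integral_norm_bound[THEN order_trans] integral_mono)
        (auto simp: sp less_imp_le)
    then show ?thesis using i by (simp add: mult.commute)
  qed
  have "\<bar>(\<integral>z. g z \<partial>M) - (\<integral>z. g z \<partial>N)\<bar> \<le> e" if "e > 0" for e :: real
  proof -
    define d where "d = e / (T + 1)"
    have d: "d > 0" using T that by (simp add: d_def)
    obtain p where p: "trig_poly (\<lambda>z. complex_of_real (p z))" "\<forall>z\<in>sphere 0 1. \<bar>g z - p z\<bar> < d"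
      using circle_weierstrass[OF g d] by blast
    have cp: "continuous_on (sphere 0 1) p"
      using continuous_on_Re[OF trig_poly_continuous[OF p(1), of "sphere 0 1"]] by simp
    have "complex_of_real (\<integral>z. p z \<partial>M) = complex_of_real (\<integral>z. p z \<partial>N)"
      using trig_poly_integral_eq[OF M N mom p(1)] by simp
    then have eq: "(\<integral>z. p z \<partial>M) = (\<integral>z. p z \<partial>N)" by (rule of_real_eq_iff[THEN iffD1])
    have "\<bar>(\<integral>z. g z \<partial>M) - (\<integral>z. g z \<partial>N)\<bar> \<le> d * T"
      using approx[OF M cp p(2)] approx[OF N cp p(2)] eq by (simp add: T_def distrib_left)
    also have "\<dots> \<le> e"
    proof -
      have "T * e \<le> (T + 1) * e" using that by (simp add: distrib_right)
      then show ?thesis using T by (simp add: d_def field_simps)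
    qed
    finally show ?thesis .
  qed
  from field_le_epsilon[of "\<bar>(\<integral>z. g z \<partial>M) - (\<integral>z. g z \<partial>N)\<bar>" 0] this show ?thesis by auto
qed

text \<open>The functions 1 - n dist(z, C), cut off at 0, tend to the indicator of the closed set C.
  Integrals of continuous functions therefore determine the measure of closed sets.\<close>

lemma closed_emeasure_limit:
  assumes L: "finite_measure L" "sets L = sets (restrict_space borel (sphere 0 1))"
    and C: "closed C" "C \<subseteq> sphere 0 1" "C \<noteq> {}"
  shows "(\<lambda>n. \<integral>z. max 0 (1 - real n * infdist z C) \<partial>L) \<longlonglongrightarrow> measure L C"
proof -
  interpret finite_measure L by fact
  have sp: "space L = sphere 0 1"
    using sets_eq_imp_space_eq[OF L(2)] by (simp add: space_restrict_space)
  have mC[measurable]: "C \<in> sets L"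
    unfolding L(2) using C by (auto simp: sets_restrict_space intro!: image_eqI[of _ _ C])
  have mm: "(\<lambda>z. max 0 (1 - real n * infdist z C)) \<in> borel_measurable L" for n
  proof -
    have "(\<lambda>z. max 0 (1 - real n * infdist z C)) \<in> borel_measurable (restrict_space borel (sphere 0 1))"
      by (intro borel_measurable_continuous_on_restrict continuous_intros)
    then show ?thesis by (simp add: L(2) cong: measurable_cong_sets)
  qed
  have "(\<lambda>n. \<integral>z. max 0 (1 - real n * infdist z C) \<partial>L) \<longlonglongrightarrow> (\<integral>z. indicator C z \<partial>L)"
  proof (rule integral_dominated_convergence[where w = "\<lambda>_. 1"])
    show "AE z in L. (\<lambda>n. max 0 (1 - real n * infdist z C)) \<longlonglongrightarrow> indicator C z"
    proof (rule AE_I2)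
      fix z assume "z \<in> space L"
      show "(\<lambda>n. max 0 (1 - real n * infdist z C)) \<longlonglongrightarrow> indicator C z"
      proof (cases "z \<in> C")
        case False
        then have pos: "infdist z C > 0"
          using C in_closed_iff_infdist_zero[of C z] infdist_nonneg[of z C] by force
        obtain m :: nat where m: "1 < real m * infdist z C"
          using reals_Archimedean3[OF pos] by blast
        have "eventually (\<lambda>n. max 0 (1 - real n * infdist z C) = 0) sequentially"
          using eventually_ge_at_top[of m]
        proof eventually_elim
          case (elim n)
          then have "real m * infdist z C \<le> real n * infdist z C" using pos by simp
          with m show ?case by simp
        qed
        then show ?thesis using False by (simp add: tendsto_eventually)
      qed simp
    qed
    show "AE z in L. norm (max 0 (1 - real n * infdist z C)) \<le> 1" for n
      by (auto intro!: AE_I2 mult_nonneg_nonneg simp: max_def infdist_nonneg)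
  qed (use mm in simp_all)
  then show ?thesis by simp
qed

text \<open>Equal moments give equal integrals of trigonometric polynomials, then of continuous
  functions by uniform approximation, then equal values on closed subsets of the circle; these are
  stable under intersection and generate the Borel sets.\<close>

lemma measure_eqI_moments:
  assumes M: "finite_measure M" "sets M = sets (restrict_space borel (sphere 0 1))"
    and N: "finite_measure N" "sets N = sets (restrict_space borel (sphere 0 1))"
    and mom: "\<And>i j. (\<integral>z. z ^ i * cnj z ^ j \<partial>M) = (\<integral>z. z ^ i * cnj z ^ j \<partial>N)"
  shows "M = N"
proof -
  let ?S = "sphere 0 1 :: complex set" and ?E = "(\<inter>) (sphere 0 1) ` {C :: complex set. closed C}"
  have sig: "sets (restrict_space borel ?S) = sigma_sets ?S ?E"
    unfolding sets_restrict_space borel_eq_closed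
    using sigma_sets_Int[of ?S UNIV "{C. closed C}"] by (auto simp: sigma_sets.Basic)
  show ?thesis
  proof (rule measure_eqI_generator_eq[where \<Omega> = ?S and E = ?E and A = "\<lambda>_. ?S"])
    show "Int_stable ?E"
    proof (rule Int_stableI)
      fix a b assume "a \<in> ?E" "b \<in> ?E"
      then obtain A B where "closed A" "closed B" "a = ?S \<inter> A" "b = ?S \<inter> B" by blast
      then have "a \<inter> b = ?S \<inter> (A \<inter> B)" "closed (A \<inter> B)" by auto
      then show "a \<inter> b \<in> ?E" by blast
    qed
    show "?E \<subseteq> Pow ?S" by auto
    show "sets M = sigma_sets ?S ?E" "sets N = sigma_sets ?S ?E" using M N sig by auto
    show "range (\<lambda>_. ?S) \<subseteq> ?E" by (auto intro!: image_eqI[of _ _ UNIV])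
    show "(\<Union>i. ?S) = ?S" by simp
    show "emeasure M ?S \<noteq> \<infinity>" by (simp add: finite_measure.emeasure_finite[OF M(1)])
    fix X assume "X \<in> ?E"
    then obtain C where "closed C" "X = ?S \<inter> C" by blast
    then have X: "closed X" "X \<subseteq> ?S" by auto
    show "emeasure M X = emeasure N X"
    proof (cases "X = {}")
      case False
      have eq: "(\<integral>z. max 0 (1 - real n * infdist z X) \<partial>M) = (\<integral>z. max 0 (1 - real n * infdist z X) \<partial>N)" for n
        by (rule continuous_integral_eq[OF M N mom]) (auto intro!: continuous_intros)
      have "measure M X = measure N X"
        using closed_emeasure_limit[OF M X False] closed_emeasure_limit[OF N X False]
        unfolding eq by (rule LIMSEQ_unique)
      then show ?thesis
        using M(1) N(1) by (simp add: finite_measure.emeasure_eq_measure)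
    qed simp
  qed
qed

section \<open>Orthogonality from vanishing moments\<close>

lemma (in prob_space) orthogonal_real_moments:
  fixes K :: "'a \<Rightarrow> real" and G :: "'a \<Rightarrow> complex" and h :: "complex \<Rightarrow> complex"
  assumes K[measurable]: "K \<in> borel_measurable M" and Kb: "\<And>x. x \<in> space M \<Longrightarrow> \<bar>K x\<bar> \<le> B"
    and G[measurable]: "G \<in> measurable M circ"
    and mom: "\<And>i j. (\<integral>x. of_real (K x) * (G x ^ i * cnj (G x) ^ j) \<partial>M) = 0"
    and h[measurable]: "h \<in> borel_measurable circ" and hb: "\<And>z. cmod z = 1 \<Longrightarrow> cmod (h z) \<le> C"
  shows "(\<integral>x. of_real (K x) * h (G x) \<partial>M) = 0"
proof -
  have Gn: "cmod (G x) = 1" if "x \<in> space M" for x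
    using measurable_space[OF G that] by simp
  \<comment> \<open>Adding B makes K a nonnegative density. Since the moments of K vanish, the
    densities K + B and B have images under G with equal moments, hence equal images; their
    difference is the claim.\<close>
  define M1 where "M1 = distr (density M (\<lambda>x. ennreal (K x + B))) circ G"
  define M2 where "M2 = distr (density M (\<lambda>x. ennreal B)) circ G"
  have Kp: "K x + B \<ge> 0" if "x \<in> space M" for x using Kb[OF that] by simp
  obtain x0 where "x0 \<in> space M" using not_empty by blast
  then have B: "B \<ge> 0" using Kb[of x0] by simp
  have int1: "(\<integral>z. g z \<partial>M1) = (\<integral>x. (K x + B) *\<^sub>R g (G x) \<partial>M)"
    if [measurable]: "g \<in> borel_measurable circ" for g :: "complex \<Rightarrow> complex"
    unfolding M1_def using Kp by (subst integral_distr) (auto simp: integral_density intro!: AE_I2)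
  have int2: "(\<integral>z. g z \<partial>M2) = (\<integral>x. B *\<^sub>R g (G x) \<partial>M)"
    if [measurable]: "g \<in> borel_measurable circ" for g :: "complex \<Rightarrow> complex"
    unfolding M2_def using B by (subst integral_distr) (auto simp: integral_density intro!: AE_I2)
  have bdd: "integrable M (\<lambda>x. of_real (K x) * g (G x))" "integrable M (\<lambda>x. B *\<^sub>R g (G x))"
    if [measurable]: "g \<in> borel_measurable circ" and gb: "\<And>z. cmod z = 1 \<Longrightarrow> cmod (g z) \<le> C'" for g C'
  proof -
    show "integrable M (\<lambda>x. of_real (K x) * g (G x))"
      using Kb gb Gn B
      by (intro integrable_const_bound[where B = "B * C'"] AE_I2) (auto simp: norm_mult intro!: mult_mono)
    show "integrable M (\<lambda>x. B *\<^sub>R g (G x))"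
      using Kb gb Gn B
      by (intro integrable_const_bound[where B = "B * C'"] AE_I2) (auto simp: norm_mult intro!: mult_mono)
  qed
  have split: "(\<integral>z. g z \<partial>M1) - (\<integral>z. g z \<partial>M2) = (\<integral>x. of_real (K x) * g (G x) \<partial>M)"
    if g: "g \<in> borel_measurable circ" and gb: "\<And>z. cmod z = 1 \<Longrightarrow> cmod (g z) \<le> C'" for g C'
    unfolding int1[OF g] int2[OF g] scaleR_add_left
    using bdd[OF g gb] by (simp add: scaleR_conv_of_real)
  have fin: "finite_measure M1" "finite_measure M2"
  proof -
    have "integrable M (\<lambda>x. K x + B)"
      by (intro Bochner_Integration.integrable_add integrable_const_bound[where B = B] AE_I2) (use Kb B in auto)
    then have "(\<integral>\<^sup>+ x. ennreal (K x + B) \<partial>M) < \<infinity>"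
      using Kp by (subst nn_integral_eq_integral) (auto intro!: AE_I2)
    then have "finite_measure (density M (\<lambda>x. ennreal (K x + B)))"
      by (intro finite_measureI) (auto simp: emeasure_density top_unique cong: nn_integral_cong)
    then show "finite_measure M1" unfolding M1_def
      by (intro finite_measure.finite_measure_distr) auto
    have "finite_measure (density M (\<lambda>x. ennreal B))"
      by (intro finite_measureI) (auto simp: emeasure_density nn_integral_cmult emeasure_space_1 cong: nn_integral_cong)
    then show "finite_measure M2" unfolding M2_def
      by (intro finite_measure.finite_measure_distr) auto
  qed
  have "M1 = M2"
  proof (rule measure_eqI_moments[OF fin(1) _ fin(2)])
    fix i j
    have [measurable]: "(\<lambda>z. z ^ i * cnj z ^ j) \<in> borel_measurable circ"
      by (intro continuous_on_measurable_circ continuous_intros)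
    show "(\<integral>z. z ^ i * cnj z ^ j \<partial>M1) = (\<integral>z. z ^ i * cnj z ^ j \<partial>M2)"
      using split[of "\<lambda>z. z ^ i * cnj z ^ j" 1] mom[of i j]
      by (simp add: norm_mult norm_power)
  qed (simp_all add: M1_def M2_def)
  then show ?thesis using split[OF h hb] by simp
qed

text \<open>States that \<open>K\<close> has conditional expectation 0 given \<open>G\<close>,
  tested against bounded functions. Pure powers suffice because \<open>G\<close> is unimodular, and
  the real case is applied to Re K and Im K separately.\<close>

lemma (in prob_space) orthogonal_moments:
  fixes K :: "'a \<Rightarrow> complex" and G :: "'a \<Rightarrow> complex" and h :: "complex \<Rightarrow> complex"
  assumes K[measurable]: "K \<in> borel_measurable M" and Kb: "\<And>x. x \<in> space M \<Longrightarrow> cmod (K x) \<le> B"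
    and G[measurable]: "G \<in> measurable M circ"
    and pos: "\<And>j. (\<integral>x. K x * G x ^ j \<partial>M) = 0" and neg: "\<And>j. (\<integral>x. K x * cnj (G x) ^ j \<partial>M) = 0"
    and h[measurable]: "h \<in> borel_measurable circ" and hb: "\<And>z. cmod z = 1 \<Longrightarrow> cmod (h z) \<le> C"
  shows "(\<integral>x. K x * h (G x) \<partial>M) = 0"
proof -
  have Gn: "cmod (G x) = 1" if "x \<in> space M" for x
    using measurable_space[OF G that] by simp
  obtain x0 where "x0 \<in> space M" using not_empty by blast
  then have B: "B \<ge> 0" using Kb[of x0] norm_ge_zero order_trans by blast
  have mono[measurable]: "(\<lambda>z. z ^ i * cnj z ^ j) \<in> borel_measurable circ" for i j
    by (intro continuous_on_measurable_circ continuous_intros)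
  have int: "integrable M (\<lambda>x. L x * g (G x))"
    if [measurable]: "L \<in> borel_measurable M" "g \<in> borel_measurable circ"
      and "\<And>x. x \<in> space M \<Longrightarrow> cmod (L x) \<le> B" "\<And>z. cmod z = 1 \<Longrightarrow> cmod (g z) \<le> C'" for g C' and L :: "'a \<Rightarrow> complex"
    using that Gn B
    by (intro integrable_const_bound[where B = "B * C'"] AE_I2) (auto simp: norm_mult intro!: mult_mono)
  have mom: "(\<integral>x. K x * (G x ^ i * cnj (G x) ^ j) \<partial>M) = 0" for i j
  proof -
    have "(\<integral>x. K x * (G x ^ i * cnj (G x) ^ j) \<partial>M) =
        (\<integral>x. (if j \<le> i then K x * G x ^ (i - j) else K x * cnj (G x) ^ (j - i)) \<partial>M)"
      by (rule Bochner_Integration.integral_cong) (auto simp: monomial_unimodular Gn)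
    then show ?thesis using pos neg by (cases "j \<le> i") auto
  qed
  have cmom: "(\<integral>x. cnj (K x) * (G x ^ i * cnj (G x) ^ j) \<partial>M) = 0" for i j
  proof -
    have "(\<integral>x. cnj (K x) * (G x ^ i * cnj (G x) ^ j) \<partial>M) = cnj (\<integral>x. K x * (G x ^ j * cnj (G x) ^ i) \<partial>M)"
      unfolding Bochner_Integration.integral_cnj[symmetric] by (simp add: mult_ac)
    then show ?thesis using mom by simp
  qed
  have Kc: "cmod (cnj (K x)) \<le> B" if "x \<in> space M" for x using Kb[OF that] by simp
  have mc[measurable]: "(\<lambda>x. cnj (K x)) \<in> borel_measurable M"
    by (intro measurable_compose[OF K] borel_measurable_continuous_onI continuous_intros)
  have gb: "cmod (z ^ i * cnj z ^ j) \<le> 1" if "cmod z = 1" for z i j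
    using that by (simp add: norm_mult norm_power)
  note i1 = int[OF K mono Kb gb] and i2 = int[OF mc mono Kc gb]
  \<comment> \<open>u = 1 and u = -i select Re K and Im K, since Re(-iK) = Im K. The moments of
    Re(uK) vanish because those of K and of cnj K do.\<close>
  have part: "(\<integral>x. of_real (Re (u * K x)) * h (G x) \<partial>M) = 0" if u: "cmod u = 1" for u
  proof (rule orthogonal_real_moments[where K = "\<lambda>x. Re (u * K x)" and G = G and h = h and B = B and C = C])
    show "\<bar>Re (u * K x)\<bar> \<le> B" if "x \<in> space M" for x
      using Kb[OF that] abs_Re_le_cmod[of "u * K x"] u by (simp add: norm_mult)
    fix i j
    have "(\<integral>x. complex_of_real (Re (u * K x)) * (G x ^ i * cnj (G x) ^ j) \<partial>M) =
      (\<integral>x. (u / 2) * (K x * (G x ^ i * cnj (G x) ^ j)) + (cnj u / 2) * (cnj (K x) * (G x ^ i * cnj (G x) ^ j)) \<partial>M)"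
    proof (rule Bochner_Integration.integral_cong, goal_cases)
      case (2 x)
      have e: "complex_of_real (Re (u * K x)) = (u * K x + cnj u * cnj (K x)) / 2" by (simp add: complex_eq_iff)
      show ?case unfolding e by (simp add: algebra_simps add_divide_distrib)
    qed simp
    also have "\<dots> = 0" using mom cmom i1 i2 by simp
    finally show "(\<integral>x. complex_of_real (Re (u * K x)) * (G x ^ i * cnj (G x) ^ j) \<partial>M) = 0" .
  qed (use hb in auto)
  have b: "\<bar>Re (K x)\<bar> \<le> B" "\<bar>Im (K x)\<bar> \<le> B" if "x \<in> space M" for x
    using Kb[OF that] abs_Re_le_cmod[of "K x"] abs_Im_le_cmod[of "K x"] by linarith+
  have "(\<integral>x. of_real (Re (K x)) * h (G x) \<partial>M) = 0" "(\<integral>x. of_real (Im (K x)) * h (G x) \<partial>M) = 0"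
    using part[of 1] part[of "-\<i>"] by simp_all
  moreover have "integrable M (\<lambda>x. of_real (Re (K x)) * h (G x))" "integrable M (\<lambda>x. of_real (Im (K x)) * h (G x))"
    by (rule int[OF _ h _ hb]; use b in simp)+
  moreover have "(\<integral>x. K x * h (G x) \<partial>M) =
      (\<integral>x. of_real (Re (K x)) * h (G x) + \<i> * (of_real (Im (K x)) * h (G x)) \<partial>M)"
    by (rule Bochner_Integration.integral_cong) (auto simp: complex_eq_iff algebra_simps)
  ultimately show ?thesis by simp
qed

section \<open>The radial maximal inequality\<close>

text \<open>With y = x/2, the function y cos y - sin y decreases from 0, so sin x = 2 sin y cos y is
  at least 2 y cos^2 y, and cos^2 y is at least 1/2 up to pi/4.\<close>

lemma sin_ge_half:
  assumes "0 \<le> x" "x \<le> pi / 2"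
  shows "x / 2 \<le> sin x"
proof -
  define y where "y = x / 2"
  have y: "0 \<le> y" "y \<le> pi / 4" using assms by (auto simp: y_def)
  have "0 * cos 0 - sin 0 \<ge> y * cos y - sin y"
  proof (rule DERIV_nonpos_imp_nonincreasing[OF y(1)])
    fix t assume t: "0 \<le> t" "t \<le> y"
    have "((\<lambda>t. t * cos t - sin t) has_real_derivative (- (t * sin t))) (at t)"
      by (auto intro!: derivative_eq_intros)
    moreover have "0 \<le> t * sin t"
      using t y by (intro mult_nonneg_nonneg sin_ge_zero) auto
    ultimately show "\<exists>d. ((\<lambda>t. t * cos t - sin t) has_real_derivative d) (at t) \<and> d \<le> 0" by force
  qed
  then have s: "y * cos y \<le> sin y" by simp
  have c: "sqrt 2 / 2 \<le> cos y"
    using cos_monotone_0_pi_le[of y "pi/4"] y pi_gt_zero by (simp add: cos_45)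
  have c0: "0 \<le> cos y" by (rule order_trans[OF _ c]) simp
  have "1 / 2 = (sqrt 2 / 2) * (sqrt 2 / 2)" by simp
  also have "\<dots> \<le> cos y * cos y" by (intro mult_mono c c0) auto
  finally have "2 * y * (1/2) \<le> 2 * y * (cos y * cos y)" using y by (intro mult_left_mono) auto
  also have "\<dots> = 2 * (y * cos y) * cos y" by simp
  also have "\<dots> \<le> 2 * sin y * cos y" using s c0 by (intro mult_right_mono) auto
  also have "\<dots> = sin x" using sin_double[of y] by (simp add: y_def)
  finally show ?thesis by (simp add: y_def)
qed

lemma cis_dist_one_ge:
  assumes "\<bar>s\<bar> \<le> pi"
  shows "\<bar>s\<bar> / 2 \<le> cmod (cis s - 1)"
proof -
  have "\<bar>s\<bar> / 4 \<le> sin (\<bar>s\<bar> / 2)" using sin_ge_half[of "\<bar>s\<bar>/2"] assms by simp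
  also have "\<dots> \<le> \<bar>sin (s / 2)\<bar>" by (simp add: abs_if split: if_splits)
  finally show ?thesis
    using dist_exp_i_1[of s] by (simp add: cis_conv_exp)
qed

text \<open>For the second bound: the chord from cis s to 1 is at least |s|/2, and replacing 1 by r
  costs 1 - r, which is at most the distance itself. So twice the distance is at least
  |s|/2.\<close>

lemma cis_dist_ge:
  assumes "\<bar>s\<bar> \<le> pi" "0 \<le> r" "r < 1"
  shows "1 - r \<le> cmod (cis s - of_real r)" "\<bar>s\<bar> / 4 \<le> cmod (cis s - of_real r)"
proof -
  show *: "1 - r \<le> cmod (cis s - of_real r)"
    using norm_triangle_ineq2[of "cis s" "of_real r"] assms by simp
  have "cmod (cis s - 1) \<le> cmod (cis s - of_real r) + cmod (of_real r - 1)"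
    by (metis diff_add_cancel add_diff_eq norm_triangle_ineq)
  also have "cmod (complex_of_real r - 1) = 1 - r"
    using assms by (metis abs_minus_commute abs_of_pos diff_gt_0_iff_gt norm_of_real of_real_1 of_real_diff)
  finally show "\<bar>s\<bar> / 4 \<le> cmod (cis s - of_real r)"
    using * cis_dist_one_ge[OF assms(1)] by simp
qed

text \<open>Cauchy's formula is applied to h(z) (1 - |w|^2) / (1 - cnj w z), whose value at w is
  h(w). On the circle 1 - cnj w z = z cnj(z - w), which turns the Cauchy kernel into the Poisson
  kernel.\<close>

lemma circ_poisson:
  assumes h: "continuous_on (cball 0 1) h" "h holomorphic_on ball 0 1" and w: "cmod w < 1"
  shows "(\<integral>z. h z * of_real ((1 - (cmod w)\<^sup>2) / (cmod (z - w))\<^sup>2) \<partial>circ) = h w"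
proof -
  have nz: "1 - cnj w * z \<noteq> 0" if "cmod z \<le> 1" for z
  proof
    assume "1 - cnj w * z = 0"
    then have "cmod (cnj w * z) = 1" by simp
    moreover have "cmod w * cmod z \<le> cmod w * 1" using that by (intro mult_left_mono) auto
    ultimately show False using w by (simp add: norm_mult)
  qed
  have ww: "1 - cnj w * w \<noteq> 0" using nz[of w] w by simp
  define g where "g z = h z * of_real (1 - (cmod w)\<^sup>2) / (1 - cnj w * z)" for z
  have "(\<integral>z. g z * z / (z - w) \<partial>circ) = g w"
    unfolding g_def using nz by (intro circ_cauchy continuous_intros holomorphic_intros h w) auto
  also have "g w = h w"
  proof -
    have "complex_of_real (1 - (cmod w)\<^sup>2) = 1 - cnj w * w"
      by (simp add: complex_norm_square mult.commute del: of_real_power)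
    then show ?thesis using ww by (simp add: g_def)
  qed
  also have "(\<integral>z. g z * z / (z - w) \<partial>circ) = (\<integral>z. h z * of_real ((1 - (cmod w)\<^sup>2) / (cmod (z - w))\<^sup>2) \<partial>circ)"
  proof (rule Bochner_Integration.integral_cong)
    fix z assume "z \<in> space circ"
    then have z: "cmod z = 1" by simp
    have "z - w \<noteq> 0" using z w by auto
    have "1 - cnj w * z = z * cnj (z - w)"
      using cnj_mult_self_circ[OF z] by (simp add: algebra_simps)
    then have "(1 - cnj w * z) * (z - w) = z * of_real ((cmod (z - w))\<^sup>2)"
      by (simp only: complex_norm_square) (simp add: mult_ac)
    moreover have "z \<noteq> 0" using z by auto
    ultimately have "z / ((1 - cnj w * z) * (z - w)) = 1 / of_real ((cmod (z - w))\<^sup>2)"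
      by simp
    moreover have "g z * z / (z - w) = h z * of_real (1 - (cmod w)\<^sup>2) * (z / ((1 - cnj w * z) * (z - w)))"
      by (simp add: g_def)
    ultimately show "g z * z / (z - w) = h z * of_real ((1 - (cmod w)\<^sup>2) / (cmod (z - w))\<^sup>2)"
      by simp
  qed simp
  finally show ?thesis by simp
qed

lemma interval_integrable:
  fixes u :: "real \<Rightarrow> real"
  assumes "continuous_on UNIV u"
  shows "integrable lborel (\<lambda>t. indicator {a..b} t * u t)"
  using borel_integrable_atLeastAtMost'[of a b u] continuous_on_subset[OF assms]
  by (simp add: set_integrable_def)

text \<open>A single term dominates, that of the least j with |s| \<le> 2^j 4 (1 - r). The numerator
  is at most 2 (1 - r); the distance is at least 1 - r if j = 0 and otherwise at least 2^(j-1) (1 -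
  r) by the |s|/4 bound, which is where the 4 in the radii comes from.\<close>

lemma poisson_kernel_dyadic:
  assumes "\<bar>s\<bar> \<le> pi" "0 \<le> r" "r < 1" "pi \<le> 2 ^ J * 4 * (1 - r)"
  shows "(1 - r\<^sup>2) / (cmod (cis s - of_real r))\<^sup>2 \<le>
    (\<Sum>j\<le>J. 8 / ((1 - r) * 4 ^ j) * indicator {- (2 ^ j * 4 * (1 - r)) .. 2 ^ j * 4 * (1 - r)} s)"
proof -
  define \<delta> where "\<delta> = 1 - r"
  have d: "0 < \<delta>" "\<delta> \<le> 1" using assms by (auto simp: \<delta>_def)
  define P where "P = (1 - r\<^sup>2) / (cmod (cis s - of_real r))\<^sup>2"
  have num: "1 - r\<^sup>2 \<le> 2 * \<delta>" "0 \<le> 1 - r\<^sup>2"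
  proof -
    have "1 - r\<^sup>2 = (1 + r) * \<delta>" by (simp add: \<delta>_def power2_eq_square algebra_simps)
    moreover have "(1 + r) * \<delta> \<le> 2 * \<delta>" using d assms by (intro mult_right_mono) auto
    ultimately show "1 - r\<^sup>2 \<le> 2 * \<delta>" "0 \<le> 1 - r\<^sup>2" using d assms by auto
  qed
  have bound: "P \<le> 2 * \<delta> / x\<^sup>2" if "0 < x" "x \<le> cmod (cis s - of_real r)" for x
    unfolding P_def using num d that by (intro frac_le power_mono) auto
  define j where "j = (LEAST j. \<bar>s\<bar> \<le> 2 ^ j * 4 * \<delta>)"
  have J: "\<bar>s\<bar> \<le> 2 ^ J * 4 * \<delta>" using assms by (simp add: \<delta>_def)
  have jJ: "j \<le> J" unfolding j_def by (rule Least_le) (rule J)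
  have js: "\<bar>s\<bar> \<le> 2 ^ j * 4 * \<delta>" unfolding j_def by (rule LeastI) (rule J)
  have "P \<le> 8 / (\<delta> * 4 ^ j)"
  proof (cases j)
    case 0
    have "P \<le> 2 * \<delta> / \<delta>\<^sup>2" using cis_dist_ge(1)[OF assms(1-3)] d by (intro bound) (auto simp: \<delta>_def)
    also have "\<dots> = 2 / \<delta>" by (simp add: power2_eq_square)
    also have "\<dots> \<le> 8 / \<delta>" using d by (intro divide_right_mono) auto
    finally show ?thesis using 0 by simp
  next
    case (Suc i)
    then have "\<not> \<bar>s\<bar> \<le> 2 ^ i * 4 * \<delta>" using not_less_Least[of i "\<lambda>j. \<bar>s\<bar> \<le> 2 ^ j * 4 * \<delta>"] by (simp add: j_def)
    then have "2 ^ i * \<delta> \<le> cmod (cis s - of_real r)" using cis_dist_ge(2)[OF assms(1-3)] by linarith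
    then have "P \<le> 2 * \<delta> / (2 ^ i * \<delta>)\<^sup>2" using d by (intro bound) auto
    also have "(2 ^ i * \<delta>)\<^sup>2 = 4 ^ i * \<delta> * \<delta>"
      by (simp add: power_mult_distrib power2_eq_square flip: power_mult_distrib[of 2 2])
    also have "2 * \<delta> / (4 ^ i * \<delta> * \<delta>) = 8 / (\<delta> * 4 ^ j)" using d Suc by simp
    finally show ?thesis .
  qed
  also have "\<dots> = 8 / (\<delta> * 4 ^ j) * indicator {- (2 ^ j * 4 * \<delta>) .. 2 ^ j * 4 * \<delta>} s"
    using js by (auto simp: indicator_def)
  also have "\<dots> \<le> (\<Sum>j\<le>J. 8 / (\<delta> * 4 ^ j) * indicator {- (2 ^ j * 4 * \<delta>) .. 2 ^ j * 4 * \<delta>} s)"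
    using jJ d by (intro member_le_sum) auto
  finally show ?thesis unfolding P_def \<delta>_def .
qed

text \<open>With the least admissible \<open>J\<close> the largest interval reaches at least pi to
  each side, while its radius stays within 2 pi, the range of radii of the maximal function
  below.\<close>

lemma dyadic_scale_exists:
  fixes \<delta> :: real
  assumes "0 < \<delta>" "\<delta> \<le> 1"
  obtains J :: nat where "pi \<le> 2 ^ J * 4 * \<delta>" "2 ^ J * 4 * \<delta> \<le> 2 * pi"
proof -
  obtain n where n: "pi / (4 * \<delta>) < 2 ^ n" using real_arch_pow[of 2] by auto
  then have "pi \<le> 2 ^ n * 4 * \<delta>" using assms by (simp add: field_simps)
  define J where "J = (LEAST j. pi \<le> 2 ^ j * 4 * \<delta>)"
  have "pi \<le> 2 ^ J * 4 * \<delta>" unfolding J_def by (rule LeastI) fact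
  moreover have "2 ^ J * 4 * \<delta> \<le> 2 * pi"
  proof (cases J)
    case 0
    then show ?thesis using assms pi_ge_two by simp
  next
    case (Suc i)
    then have "\<not> pi \<le> 2 ^ i * 4 * \<delta>" using not_less_Least[of i "\<lambda>j. pi \<le> 2 ^ j * 4 * \<delta>"] by (simp add: J_def)
    then show ?thesis using Suc by (simp only: Suc power_Suc)
  qed
  ultimately show ?thesis using that by blast
qed

text \<open>Inside the disc |k|^2 is at most the Poisson integral of its boundary values, and the
  dyadic majorant turns this into averages over intervals centred at \<theta>. The j-th contributes
  at most 64 \<alpha> / 2^j, all together at most 128 \<alpha>; dividing by 2 pi leaves at most 64
  \<alpha>.\<close>

lemma poisson_maximal_pointwise:
  assumes k: "continuous_on (cball 0 1) k" "k holomorphic_on ball 0 1" and r: "0 \<le> r" "r < 1"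
    and \<alpha>: "\<And>s. 0 < s \<Longrightarrow> s \<le> 2 * pi \<Longrightarrow>
      (\<integral>t. indicator {\<theta> - s..\<theta> + s} t * (cmod (k (cis t)))\<^sup>2 \<partial>lborel) \<le> 2 * \<alpha> * s"
  shows "(cmod (k (of_real r * cis \<theta>)))\<^sup>2 \<le> 64 * \<alpha>"
proof -
  have \<alpha>0: "0 \<le> \<alpha>"
  proof -
    have "0 \<le> (\<integral>t. indicator {\<theta> - 1..\<theta> + 1} t * (cmod (k (cis t)))\<^sup>2 \<partial>lborel)"
      by (intro Bochner_Integration.integral_nonneg) simp
    also have "\<dots> \<le> 2 * \<alpha> * 1" by (rule \<alpha>) (use pi_ge_two in auto)
    finally show ?thesis by simp
  qed
  define u where "u t = (cmod (k (cis t)))\<^sup>2" for t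
  have u: "continuous_on UNIV u" unfolding u_def
    by (intro continuous_intros continuous_on_compose2[OF k(1)]) auto
  have u0: "u t \<ge> 0" for t by (simp add: u_def)
  define \<delta> where "\<delta> = 1 - r"
  have d: "0 < \<delta>" "\<delta> \<le> 1" using r by (auto simp: \<delta>_def)
  obtain J where J: "pi \<le> 2 ^ J * 4 * \<delta>" "2 ^ J * 4 * \<delta> \<le> 2 * pi"
    using dyadic_scale_exists[OF d] .
  define s where "s j = 2 ^ j * 4 * \<delta>" for j :: nat
  have s: "0 < s j" "s j \<le> 2 * pi" if "j \<le> J" for j
  proof -
    have "(2::real) ^ j \<le> 2 ^ J" using that by simp
    then have "2 ^ j * 4 * \<delta> \<le> 2 ^ J * 4 * \<delta>" using d by simp
    then show "s j \<le> 2 * pi" using J unfolding s_def by linarith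
  qed (use d in \<open>simp add: s_def\<close>)
  define P where "P t = (1 - r\<^sup>2) / (cmod (cis t - of_real r))\<^sup>2" for t
  have Pnz: "cmod (cis t - of_real r) \<noteq> 0" for t
  proof
    assume "cmod (cis t - of_real r) = 0"
    then have "cmod (cis t) = cmod (of_real r)" by simp
    then show False using r by simp
  qed
  have contP: "continuous_on UNIV (\<lambda>t. P (t - \<theta>))" unfolding P_def
    using Pnz by (intro continuous_intros) auto
  \<comment> \<open>Squaring makes |h| a value of |k|^2. The rotation by -cis \<theta> moves the
    point to -r, so on {0..2 pi} the kernel peaks at the midpoint pi, and a translation by \<theta>
    - pi gives an interval centred at \<theta>.\<close>
  define h where "h z = (k (- cis \<theta> * z))\<^sup>2" for z
  have rot: "- cis \<theta> * z \<in> cball 0 1" if "z \<in> cball 0 1" for z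
    using that by (simp add: norm_mult)
  have ch: "continuous_on (cball 0 1) h" unfolding h_def
    by (intro continuous_intros continuous_on_compose2[OF k(1)]) (use rot in auto)
  have "(k o (\<lambda>z. - cis \<theta> * z)) holomorphic_on ball 0 1"
    by (intro holomorphic_on_compose_gen[OF _ k(2)] holomorphic_intros) (auto simp: norm_mult)
  then have hh: "h holomorphic_on ball 0 1" unfolding h_def o_def by (intro holomorphic_intros)
  have "(cmod (k (of_real r * cis \<theta>)))\<^sup>2 = cmod (h (- of_real r))"
    by (simp add: h_def norm_power mult.commute)
  also have "h (- of_real r) = (\<integral>z. h z * of_real ((1 - (cmod (- of_real r))\<^sup>2) / (cmod (z - (- of_real r)))\<^sup>2) \<partial>circ)"
    using circ_poisson[OF ch hh, of "- of_real r"] r by simp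
  also have "cmod \<dots> \<le> (\<integral>z. cmod (h z * of_real ((1 - (cmod (- of_real r))\<^sup>2) / (cmod (z - (- of_real r)))\<^sup>2)) \<partial>circ)"
    by (rule Bochner_Integration.integral_norm_bound)
  also have "\<dots> = (\<integral>z. cmod (h z) * ((1 - r\<^sup>2) / (cmod (z + of_real r))\<^sup>2) \<partial>circ)"
  proof (rule Bochner_Integration.integral_cong)
    fix z
    have "0 \<le> (1 - r\<^sup>2) / (cmod (z + of_real r))\<^sup>2"
      using r by (intro divide_nonneg_nonneg) (auto simp: power_le_one)
    then show "cmod (h z * of_real ((1 - (cmod (- of_real r))\<^sup>2) / (cmod (z - (- of_real r)))\<^sup>2))
        = cmod (h z) * ((1 - r\<^sup>2) / (cmod (z + of_real r))\<^sup>2)"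
      using r by (simp only: norm_mult norm_of_real norm_minus_cancel diff_minus_eq_add abs_of_nonneg power2_abs)
  qed simp
  also have "\<dots> = (1 / (2 * pi)) * integral {0..2 * pi} (\<lambda>t. cmod (h (cis t)) * ((1 - r\<^sup>2) / (cmod (cis t + of_real r))\<^sup>2))"
  proof -
    have nz: "z + of_real r \<noteq> 0" if "cmod z = 1" for z
    proof
      assume "z + of_real r = 0"
      then have "z = - of_real r" by (simp add: eq_neg_iff_add_eq_0)
      then show False using that r by simp
    qed
    have "continuous_on (sphere 0 1) (\<lambda>z. cmod (h z) * ((1 - r\<^sup>2) / (cmod (z + of_real r))\<^sup>2))"
      using nz by (intro continuous_intros continuous_on_subset[OF ch]) auto
    from circ_integral_cis[OF this] show ?thesis by (simp only: real_scaleR_def)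
  qed
  also have "integral {0..2 * pi} (\<lambda>t. cmod (h (cis t)) * ((1 - r\<^sup>2) / (cmod (cis t + of_real r))\<^sup>2))
      = integral {0..2 * pi} (\<lambda>t. u (t + (\<theta> - pi)) * P (t - pi))"
  proof (rule integral_cong)
    fix t :: real
    have "cis (t - pi) = - cis t" by (simp add: cis_divide[symmetric])
    then have "P (t - pi) = (1 - r\<^sup>2) / (cmod (- (cis t + of_real r)))\<^sup>2" by (simp add: P_def)
    moreover have "cis (t + (\<theta> - pi)) = - cis \<theta> * cis t"
      by (simp add: cis_mult[symmetric] cis_divide[symmetric])
    ultimately show "cmod (h (cis t)) * ((1 - r\<^sup>2) / (cmod (cis t + of_real r))\<^sup>2) = u (t + (\<theta> - pi)) * P (t - pi)"
      by (simp only: norm_minus_cancel) (simp add: h_def u_def norm_power)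
  qed
  also have "\<dots> = integral {\<theta> - pi..\<theta> + pi} (\<lambda>t. u t * P (t - \<theta>))"
  proof -
    have "(\<lambda>t. u t * P (t - \<theta>)) \<circ> (+) (\<theta> - pi) = (\<lambda>t. u (t + (\<theta> - pi)) * P (t - pi))"
      by (auto simp: fun_eq_iff algebra_simps)
    moreover have "0 + (\<theta> - pi) = \<theta> - pi" "2 * pi + (\<theta> - pi) = \<theta> + pi" by auto
    ultimately show ?thesis
      using integral_shift_Icc_real[where f = "\<lambda>t. u t * P (t - \<theta>)" and c = "\<theta> - pi" and a = 0 and b = "2 * pi"]
      by (simp only:)
  qed
  also have "\<dots> = (\<integral>t. indicator {\<theta> - pi..\<theta> + pi} t * (u t * P (t - \<theta>)) \<partial>lborel)"
  proof -
    have c: "continuous_on UNIV (\<lambda>t. u t * P (t - \<theta>))"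
      by (intro continuous_on_mult u contP)
    show ?thesis
      using set_borel_integral_eq_integral(2)[OF borel_integrable_atLeastAtMost'[OF continuous_on_subset[OF c]]]
      by (simp add: set_lebesgue_integral_def)
  qed
  also have "\<dots> \<le> (\<integral>t. (\<Sum>j\<le>J. 8 / (\<delta> * 4 ^ j) * (indicator {\<theta> - s j..\<theta> + s j} t * u t)) \<partial>lborel)"
  proof (rule integral_mono)
    have c: "continuous_on UNIV (\<lambda>t. u t * P (t - \<theta>))"
      by (intro continuous_on_mult u contP)
    show "integrable lborel (\<lambda>t. indicator {\<theta> - pi..\<theta> + pi} t * (u t * P (t - \<theta>)))"
      by (rule interval_integrable[OF c])
    show "integrable lborel (\<lambda>t. \<Sum>j\<le>J. 8 / (\<delta> * 4 ^ j) * (indicator {\<theta> - s j..\<theta> + s j} t * u t))"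
      by (intro Bochner_Integration.integrable_sum integrable_mult_right interval_integrable u)
    fix t :: real
    have nn: "0 \<le> (\<Sum>j\<le>J. 8 / (\<delta> * 4 ^ j) * (indicator {\<theta> - s j..\<theta> + s j} t * u t))"
      using d u0 by (intro sum_nonneg) auto
    show "indicator {\<theta> - pi..\<theta> + pi} t * (u t * P (t - \<theta>)) \<le>
        (\<Sum>j\<le>J. 8 / (\<delta> * 4 ^ j) * (indicator {\<theta> - s j..\<theta> + s j} t * u t))"
    proof (cases "t \<in> {\<theta> - pi..\<theta> + pi}")
      case True
      then have "\<bar>t - \<theta>\<bar> \<le> pi" by auto
      from poisson_kernel_dyadic[OF this r, of J] J
      have "P (t - \<theta>) \<le> (\<Sum>j\<le>J. 8 / (\<delta> * 4 ^ j) * indicator {- s j..s j} (t - \<theta>))"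
        by (simp add: P_def \<delta>_def s_def)
      also have "\<dots> = (\<Sum>j\<le>J. 8 / (\<delta> * 4 ^ j) * indicator {\<theta> - s j..\<theta> + s j} t)"
        by (intro sum.cong) (auto simp: indicator_def)
      finally have "u t * P (t - \<theta>) \<le> u t * \<dots>" by (intro mult_left_mono u0)
      then show ?thesis using True by (simp add: sum_distrib_left mult_ac)
    qed (use nn in simp)
  qed
  also have "\<dots> = (\<Sum>j\<le>J. 8 / (\<delta> * 4 ^ j) * (\<integral>t. indicator {\<theta> - s j..\<theta> + s j} t * u t \<partial>lborel))"
    by (subst Bochner_Integration.integral_sum) (auto intro!: integrable_mult_right interval_integrable u)
  also have "\<dots> \<le> (\<Sum>j\<le>J. 8 / (\<delta> * 4 ^ j) * (2 * \<alpha> * s j))"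
    using d s \<alpha> by (intro sum_mono mult_left_mono) (auto simp: u_def)
  also have "\<dots> = (\<Sum>j\<le>J. 64 * \<alpha> * (1 / 2) ^ j)"
  proof (rule sum.cong)
    fix j :: nat
    have "(4::real) ^ j = 2 ^ j * 2 ^ j" by (simp flip: power_mult_distrib)
    then show "8 / (\<delta> * 4 ^ j) * (2 * \<alpha> * s j) = 64 * \<alpha> * (1 / 2) ^ j"
      using d by (simp add: s_def field_simps)
  qed simp
  also have "\<dots> = 64 * \<alpha> * (\<Sum>j\<le>J. (1 / 2) ^ j)" by (simp add: sum_distrib_left)
  also have "\<dots> \<le> 64 * \<alpha> * 2"
  proof (rule mult_left_mono)
    show "(\<Sum>j\<le>J. (1 / 2) ^ j) \<le> (2::real)"
      by (subst sum_gp0) (simp add: field_simps)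
    show "0 \<le> 64 * \<alpha>" using \<alpha>0 by simp
  qed
  finally have le: "(cmod (k (of_real r * cis \<theta>)))\<^sup>2 \<le> 1 / (2 * pi) * (64 * \<alpha> * 2)"
    using pi_gt_zero by (simp add: mult_left_mono divide_right_mono)
  have "64 * \<alpha> / pi \<le> 64 * \<alpha> / 1"
    using \<alpha>0 pi_ge_two by (intro divide_left_mono) auto
  with le show ?thesis by simp
qed

text \<open>Weak-type bound of Hardy and Littlewood. A selected ball of radius s has a 5-fold
  enlargement of length 10 s, less than 5 / \<alpha> times the integral of u over the ball. The
  selected balls are disjoint and, with centres in {0..2 pi} and radii up to 2 pi, stay inside three
  periods.\<close>

lemma vitali_maximal:
  fixes u :: "real \<Rightarrow> real"
  assumes u: "continuous_on UNIV u" "\<And>t. 0 \<le> u t" and \<alpha>: "0 < \<alpha>" and A: "A \<subseteq> {0..2 * pi}"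
    and s: "\<And>\<theta>. \<theta> \<in> A \<Longrightarrow> \<exists>s>0. s \<le> 2 * pi \<and> 2 * \<alpha> * s < (\<integral>t. indicator {\<theta> - s..\<theta> + s} t * u t \<partial>lborel)"
  shows "emeasure lborel A \<le> ennreal (5 / \<alpha> * (\<integral>t. indicator {- (2 * pi)..4 * pi} t * u t \<partial>lborel))"
proof -
  define \<nu> where "\<nu> = density lborel (\<lambda>t. ennreal (u t))"
  have mu[measurable]: "u \<in> borel_measurable borel" by (rule borel_measurable_continuous_onI[OF u(1)])
  have \<nu>: "emeasure \<nu> {a..b} = ennreal (\<integral>t. indicator {a..b} t * u t \<partial>lborel)" for a b
  proof -
    have "emeasure \<nu> {a..b} = (\<integral>\<^sup>+t. ennreal (indicator {a..b} t * u t) \<partial>lborel)"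
      unfolding \<nu>_def by (subst emeasure_density) (auto intro!: nn_integral_cong simp: indicator_def)
    also have "\<dots> = ennreal (\<integral>t. indicator {a..b} t * u t \<partial>lborel)"
      using u by (intro nn_integral_eq_integral interval_integrable) auto
    finally show ?thesis .
  qed
  obtain s where s: "\<And>\<theta>. \<theta> \<in> A \<Longrightarrow> 0 < s \<theta> \<and> s \<theta> \<le> 2 * pi \<and>
      2 * \<alpha> * s \<theta> < (\<integral>t. indicator {\<theta> - s \<theta>..\<theta> + s \<theta>} t * u t \<partial>lborel)"
    using s by metis
  have "A \<subseteq> (\<Union>\<theta>\<in>A. cball \<theta> (s \<theta>))" using s by force
  then obtain C where C: "countable C" "C \<subseteq> A"
     "pairwise (\<lambda>i j. disjnt (cball i (s i)) (cball j (s j))) C"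
     "A \<subseteq> (\<Union>i\<in>C. cball i (5 * s i))"
    by (rule Vitali_covering_lemma_cballs[where K = A and a = "\<lambda>\<theta>. \<theta>" and r = s and B = "2 * pi"]) (use s in auto)
  \<comment> \<open>Indexes the countable family \<open>C\<close> by natural numbers, with empty
    sets at the remaining indices, so that finite and infinite \<open>C\<close> are covered by the
    same series.\<close>
  define N where "N = to_nat_on C ` C"
  define g where "g = from_nat_into C"
  have g: "g n \<in> C" if "n \<in> N" for n
    using that C(1) by (auto simp: N_def g_def)
  have g': "\<exists>n\<in>N. g n = x" if "x \<in> C" for x
    using that C(1) by (auto simp: N_def g_def)
  have ginj: "n = m" if "n \<in> N" "m \<in> N" "g n = g m" for n m
    using that C(1) by (auto simp: N_def g_def)
  define F where "F n = (if n \<in> N then cball (g n) (5 * s (g n)) else {})" for n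
  define E where "E n = (if n \<in> N then cball (g n) (s (g n)) else {})" for n
  have FE: "emeasure lborel (F n) \<le> ennreal (5 / \<alpha>) * emeasure \<nu> (E n)" for n
  proof (cases "n \<in> N")
    case True
    let ?x = "g n"
    have x: "?x \<in> A" using g[OF True] C by blast
    have "emeasure lborel (F n) = ennreal (10 * s ?x)"
      using True s[OF x] by (simp add: F_def cball_eq_atLeastAtMost)
    also have "\<dots> \<le> ennreal (5 / \<alpha> * (\<integral>t. indicator {?x - s ?x..?x + s ?x} t * u t \<partial>lborel))"
      using s[OF x] \<alpha> by (intro ennreal_leI) (simp add: field_simps)
    also have "\<dots> = ennreal (5 / \<alpha>) * ennreal (\<integral>t. indicator {?x - s ?x..?x + s ?x} t * u t \<partial>lborel)"
      by (rule ennreal_mult') (use \<alpha> in simp)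
    also have "\<dots> = ennreal (5 / \<alpha>) * emeasure \<nu> (E n)"
      using True by (simp add: E_def cball_eq_atLeastAtMost \<nu>)
    finally show ?thesis .
  qed (simp add: F_def)
  have "disjoint_family E"
    unfolding disjoint_family_on_def
  proof (intro ballI impI)
    fix m n :: nat assume "m \<noteq> n"
    show "E m \<inter> E n = {}"
    proof (cases "m \<in> N \<and> n \<in> N")
      case True
      then have "g m \<noteq> g n" using ginj \<open>m \<noteq> n\<close> by blast
      then have "disjnt (cball (g m) (s (g m))) (cball (g n) (s (g n)))"
        using pairwiseD[OF C(3)] g True by blast
      then show ?thesis using True by (simp add: E_def disjnt_def)
    qed (auto simp: E_def)
  qed
  have Em: "range E \<subseteq> sets \<nu>" by (auto simp: E_def \<nu>_def)
  have Esub: "(\<Union>n. E n) \<subseteq> {- (2 * pi)..4 * pi}"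
  proof
    fix t assume "t \<in> (\<Union>n. E n)"
    then obtain n where n: "n \<in> N" "t \<in> cball (g n) (s (g n))" by (auto simp: E_def split: if_splits)
    then have "g n \<in> A" using g C by blast
    then show "t \<in> {- (2 * pi)..4 * pi}" using s[of "g n"] A n(2) by (auto simp: cball_eq_atLeastAtMost)
  qed
  have "A \<subseteq> (\<Union>n. F n)"
  proof
    fix x assume "x \<in> A"
    then obtain c where c: "c \<in> C" "x \<in> cball c (5 * s c)" using C(4) by blast
    then obtain n where "n \<in> N" "g n = c" using g' by blast
    then show "x \<in> (\<Union>n. F n)" using c by (auto simp: F_def)
  qed
  then have "emeasure lborel A \<le> emeasure lborel (\<Union>n. F n)"
    by (intro emeasure_mono) (auto simp: F_def)
  also have "\<dots> \<le> (\<Sum>n. emeasure lborel (F n))"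
    by (rule emeasure_subadditive_countably) (auto simp: F_def)
  also have "\<dots> \<le> (\<Sum>n. ennreal (5 / \<alpha>) * emeasure \<nu> (E n))"
    by (intro suminf_le FE) auto
  also have "\<dots> = ennreal (5 / \<alpha>) * emeasure \<nu> (\<Union>n. E n)"
    using suminf_emeasure[OF Em \<open>disjoint_family E\<close>] by simp
  also have "\<dots> \<le> ennreal (5 / \<alpha>) * emeasure \<nu> {- (2 * pi)..4 * pi}"
    by (intro mult_left_mono emeasure_mono Esub) (auto simp: \<nu>_def)
  also have "\<dots> = ennreal (5 / \<alpha> * (\<integral>t. indicator {- (2 * pi)..4 * pi} t * u t \<partial>lborel))"
    unfolding \<nu> by (rule ennreal_mult'[symmetric]) (use \<alpha> in simp)
  finally show ?thesis .
qed

text \<open>Each of the three periods contributes 2 pi times the mean over the circle.\<close>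

lemma integral_three_periods:
  fixes k :: "complex \<Rightarrow> complex"
  assumes "continuous_on (sphere 0 1) k"
  shows "(\<integral>t. indicator {- (2 * pi)..4 * pi} t * (cmod (k (cis t)))\<^sup>2 \<partial>lborel) = 6 * pi * (\<integral>z. (cmod (k z))\<^sup>2 \<partial>circ)"
proof -
  define u where "u t = (cmod (k (cis t)))\<^sup>2" for t
  have u: "continuous_on UNIV u" unfolding u_def
    by (intro continuous_intros continuous_on_compose2[OF assms]) auto
  have per: "u (t + 2 * pi) = u t" for t by (simp add: u_def cis_mult[symmetric])
  have int: "u integrable_on {a..b}" for a b
    by (rule integrable_continuous_interval[OF continuous_on_subset[OF u]]) auto
  have shift: "integral {a + 2 * pi..b + 2 * pi} u = integral {a..b} u" for a b
  proof -
    have "u \<circ> (+) (2 * pi) = u" using per by (auto simp: fun_eq_iff add.commute)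
    then show ?thesis using integral_shift_Icc_real[where f = u and c = "2 * pi" and a = a and b = b] by simp
  qed
  have "(\<integral>t. indicator {- (2 * pi)..4 * pi} t * (cmod (k (cis t)))\<^sup>2 \<partial>lborel) = integral {- (2 * pi)..4 * pi} u"
    using set_borel_integral_eq_integral(2)[OF borel_integrable_atLeastAtMost'[OF continuous_on_subset[OF u]]]
    by (simp add: set_lebesgue_integral_def u_def)
  also have "\<dots> = integral {- (2 * pi)..0} u + integral {0..4 * pi} u"
    by (rule Henstock_Kurzweil_Integration.integral_combine[symmetric]) (use int in auto)
  also have "integral {0..4 * pi} u = integral {0..2 * pi} u + integral {2 * pi..4 * pi} u"
    by (rule Henstock_Kurzweil_Integration.integral_combine[symmetric]) (use int in auto)
  also have "integral {2 * pi..4 * pi} u = integral {0..2 * pi} u"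
    using shift[of 0 "2 * pi"] by simp
  also have "integral {- (2 * pi)..0} u = integral {0..2 * pi} u"
    using shift[of "- (2 * pi)" 0] by simp
  also have "integral {0..2 * pi} u = 2 * pi * (\<integral>z. (cmod (k z))\<^sup>2 \<partial>circ)"
    by (subst circ_integral_cis) (auto intro!: continuous_intros assms simp: u_def[abs_def])
  finally show ?thesis by simp
qed

text \<open>The union runs over uncountably many radii, but every member is relatively open in the
  circle, hence so is the union.\<close>

lemma radial_sup_set_measurable:
  assumes "\<And>r. r \<in> R \<Longrightarrow> continuous_on (sphere 0 1) (\<lambda>z. k (of_real r * z))"
  shows "{z \<in> sphere 0 1. \<exists>r\<in>R. \<mu> < cmod (k (of_real r * z))} \<in> sets circ"
proof -
  have "openin (top_of_set (sphere 0 1)) {z \<in> sphere 0 1. \<mu> < cmod (k (of_real r * z))}" if "r \<in> R" for r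
  proof -
    have "openin (top_of_set (sphere 0 1)) (sphere 0 1 \<inter> (\<lambda>z. cmod (k (of_real r * z))) -` {\<mu><..})"
      by (intro continuous_openin_preimage_gen continuous_intros assms that)
    moreover have "sphere 0 1 \<inter> (\<lambda>z. cmod (k (of_real r * z))) -` {\<mu><..} = {z \<in> sphere 0 1. \<mu> < cmod (k (of_real r * z))}"
      by auto
    ultimately show ?thesis by simp
  qed
  then have "openin (top_of_set (sphere 0 1)) (\<Union>r\<in>R. {z \<in> sphere 0 1. \<mu> < cmod (k (of_real r * z))})"
    by blast
  then obtain T where T: "open T" "(\<Union>r\<in>R. {z \<in> sphere 0 1. \<mu> < cmod (k (of_real r * z))}) = sphere 0 1 \<inter> T"
    by (auto simp: openin_open)
  have "(\<Union>r\<in>R. {z \<in> sphere 0 1. \<mu> < cmod (k (of_real r * z))}) = {z \<in> sphere 0 1. \<exists>r\<in>R. \<mu> < cmod (k (of_real r * z))}"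
    by auto
  moreover have "sphere 0 1 \<inter> T \<in> sets circ"
    using T(1) by (auto simp: sets_restrict_space)
  ultimately show ?thesis using T(2) by simp
qed

text \<open>Where the maximal function exceeds \<mu>, the pointwise bound with \<alpha> = \<mu>^2/64
  must fail on some interval. The constant is 5 times 64 from the covering, times 6 pi / (2 pi) = 3
  for the three periods.\<close>

lemma radial_maximal_closed:
  assumes k: "continuous_on (cball 0 1) k" "k holomorphic_on ball 0 1" and "0 < \<mu>"
  shows "measure circ {z \<in> sphere 0 1. \<exists>r\<in>{0..<1}. \<mu> < cmod (k (of_real r * z))}
    \<le> 960 / \<mu>\<^sup>2 * (\<integral>z. (cmod (k z))\<^sup>2 \<partial>circ)"
proof -
  define B where "B = {z \<in> sphere 0 1. \<exists>r\<in>{0..<1}. \<mu> < cmod (k (of_real r * z))}"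
  have B: "B \<in> sets circ" unfolding B_def
    by (intro radial_sup_set_measurable continuous_on_compose2[OF k(1)] continuous_intros) (auto simp: norm_mult)
  define A where "A = {t \<in> {0..<2 * pi}. cis t \<in> B}"
  define I where "I = (\<integral>z. (cmod (k z))\<^sup>2 \<partial>circ)"
  have I: "I \<ge> 0" unfolding I_def by (intro Bochner_Integration.integral_nonneg) simp
  have "emeasure lborel A \<le> ennreal (5 / (\<mu>\<^sup>2 / 64) * (\<integral>t. indicator {- (2 * pi)..4 * pi} t * (cmod (k (cis t)))\<^sup>2 \<partial>lborel))"
  proof (rule vitali_maximal)
    show "continuous_on UNIV (\<lambda>t. (cmod (k (cis t)))\<^sup>2)"
      by (intro continuous_intros continuous_on_compose2[OF k(1)]) auto
    show "A \<subseteq> {0..2 * pi}" by (auto simp: A_def)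
    show "0 < \<mu>\<^sup>2 / 64" using assms by simp
    fix \<theta> assume "\<theta> \<in> A"
    then obtain r where r: "0 \<le> r" "r < 1" "\<mu> < cmod (k (of_real r * cis \<theta>))" by (auto simp: A_def B_def)
    show "\<exists>s>0. s \<le> 2 * pi \<and> 2 * (\<mu>\<^sup>2 / 64) * s < (\<integral>t. indicator {\<theta> - s..\<theta> + s} t * (cmod (k (cis t)))\<^sup>2 \<partial>lborel)"
    proof (rule ccontr)
      assume "\<not> ?thesis"
      then have "(cmod (k (of_real r * cis \<theta>)))\<^sup>2 \<le> 64 * (\<mu>\<^sup>2 / 64)"
        by (intro poisson_maximal_pointwise[OF k r(1,2)]) force
      moreover have "\<mu>\<^sup>2 < (cmod (k (of_real r * cis \<theta>)))\<^sup>2"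
        using r(3) assms(3) by (intro power_strict_mono) auto
      ultimately show False by simp
    qed
  qed simp
  also have "\<dots> = ennreal (960 / \<mu>\<^sup>2 * I * (2 * pi))"
    by (subst integral_three_periods) (auto intro: continuous_on_subset[OF k(1)] simp: I_def)
  finally have A: "emeasure lborel A \<le> ennreal (960 / \<mu>\<^sup>2 * I * (2 * pi))" .
  have "emeasure circ B = emeasure lborel A / ennreal (2 * pi)"
    using circ_emeasure[OF B] by (simp add: A_def)
  also have "\<dots> \<le> ennreal (960 / \<mu>\<^sup>2 * I * (2 * pi)) / ennreal (2 * pi)"
    by (rule divide_right_mono_ennreal[OF A])
  also have "\<dots> = ennreal (960 / \<mu>\<^sup>2 * I)"
    using I by (subst divide_ennreal) auto
  finally show ?thesis
    using I unfolding B_def[symmetric] I_def[symmetric] circ.emeasure_eq_measure by simp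
qed

text \<open>The dilations k(\<rho> z) extend continuously to the closed disc and see the values of k
  up to radius \<rho>. The corresponding sets increase to the full one as \<rho> tends to 1, so the
  bound survives.\<close>

lemma radial_maximal:
  assumes k: "k holomorphic_on ball 0 1" and "0 < \<mu>"
    and \<tau>: "\<And>\<rho>. 0 < \<rho> \<Longrightarrow> \<rho> < 1 \<Longrightarrow> (\<integral>z. (cmod (k (of_real \<rho> * z)))\<^sup>2 \<partial>circ) \<le> \<tau>"
  shows "{z \<in> sphere 0 1. \<exists>r\<in>{0..<1}. \<mu> < cmod (k (of_real r * z))} \<in> sets circ"
    and "measure circ {z \<in> sphere 0 1. \<exists>r\<in>{0..<1}. \<mu> < cmod (k (of_real r * z))} \<le> 960 / \<mu>\<^sup>2 * \<tau>"
proof -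
  have ck: "continuous_on (ball 0 1) k" by (rule holomorphic_on_imp_continuous_on[OF k])
  show m: "{z \<in> sphere 0 1. \<exists>r\<in>{0..<1}. \<mu> < cmod (k (of_real r * z))} \<in> sets circ"
    by (intro radial_sup_set_measurable continuous_on_compose2[OF ck] continuous_intros) (auto simp: norm_mult)
  define \<rho> where "\<rho> n = 1 - 1 / real (n + 2)" for n
  have \<rho>: "0 < \<rho> n" "\<rho> n < 1" for n by (auto simp: \<rho>_def field_simps)
  have \<rho>mono: "\<rho> n \<le> \<rho> m" if "n \<le> m" for n m using that by (auto simp: \<rho>_def field_simps)
  define B where "B n = {z \<in> sphere 0 1. \<exists>r\<in>{0..<\<rho> n}. \<mu> < cmod (k (of_real r * z))}" for n
  have Bm: "B n \<in> sets circ" for n unfolding B_def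
    by (intro radial_sup_set_measurable continuous_on_compose2[OF ck] continuous_intros)
      (use \<rho>[of n] in \<open>auto simp: norm_mult\<close>)
  have Bn: "measure circ (B n) \<le> 960 / \<mu>\<^sup>2 * \<tau>" for n
  proof -
    define kn where "kn z = k (of_real (\<rho> n) * z)" for z
    have in_ball: "of_real (\<rho> n) * z \<in> ball 0 1" if "z \<in> cball 0 1" for z :: complex
    proof -
      have "\<rho> n * cmod z \<le> \<rho> n * 1" using that \<rho>[of n] by (intro mult_left_mono) auto
      then have "\<rho> n * cmod z < 1" using \<rho>[of n] by linarith
      then show ?thesis using \<rho>[of n] by (simp add: norm_mult)
    qed
    have c: "continuous_on (cball 0 1) kn" unfolding kn_def
      by (intro continuous_on_compose2[OF ck] continuous_intros) (use in_ball in auto)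
    have "(k o (\<lambda>z. of_real (\<rho> n) * z)) holomorphic_on ball 0 1"
      by (intro holomorphic_on_compose_gen[OF _ k] holomorphic_intros) (use in_ball in auto)
    then have h: "kn holomorphic_on ball 0 1" by (simp add: kn_def[abs_def] o_def)
    have "B n = {z \<in> sphere 0 1. \<exists>r\<in>{0..<1}. \<mu> < cmod (kn (of_real r * z))}"
    proof (intro set_eqI iffI)
      fix z assume "z \<in> B n"
      then obtain r where r: "z \<in> sphere 0 1" "0 \<le> r" "r < \<rho> n" "\<mu> < cmod (k (of_real r * z))" by (auto simp: B_def)
      have "kn (of_real (r / \<rho> n) * z) = k (of_real r * z)"
        using \<rho>[of n] by (simp add: kn_def field_simps)
      moreover have "r / \<rho> n \<in> {0..<1}" using r \<rho>[of n] by auto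
      ultimately show "z \<in> {z \<in> sphere 0 1. \<exists>r\<in>{0..<1}. \<mu> < cmod (kn (of_real r * z))}"
        using r by (metis (mono_tags, lifting) mem_Collect_eq)
    next
      fix z assume "z \<in> {z \<in> sphere 0 1. \<exists>r\<in>{0..<1}. \<mu> < cmod (kn (of_real r * z))}"
      then obtain r where r: "z \<in> sphere 0 1" "0 \<le> r" "r < 1" "\<mu> < cmod (kn (of_real r * z))" by auto
      have "\<rho> n * r \<in> {0..<\<rho> n}" using r \<rho>[of n] by auto
      moreover have "kn (of_real r * z) = k (of_real (\<rho> n * r) * z)" by (simp add: kn_def mult.assoc)
      ultimately show "z \<in> B n" using r unfolding B_def by (metis (mono_tags, lifting) mem_Collect_eq)
    qed
    then have "measure circ (B n) \<le> 960 / \<mu>\<^sup>2 * (\<integral>z. (cmod (kn z))\<^sup>2 \<partial>circ)"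
      using radial_maximal_closed[OF c h \<open>0 < \<mu>\<close>] by simp
    also have "\<dots> \<le> 960 / \<mu>\<^sup>2 * \<tau>"
      using \<tau>[OF \<rho>[of n]] by (intro mult_left_mono) (auto simp: kn_def)
    finally show ?thesis .
  qed
  have Bmono: "incseq B"
  proof (intro monoI subsetI)
    fix m n z assume "m \<le> n" "z \<in> B m"
    then show "z \<in> B n" unfolding B_def
      using \<rho>mono[of m n] by (auto intro!: bexI less_le_trans[of _ "\<rho> m" "\<rho> n"])
  qed
  have "(\<lambda>n. measure circ (B n)) \<longlonglongrightarrow> measure circ (\<Union>n. B n)"
    by (rule circ.finite_Lim_measure_incseq)
      (use Bm in \<open>auto intro!: Bmono\<close>)
  then have "measure circ (\<Union>n. B n) \<le> 960 / \<mu>\<^sup>2 * \<tau>"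
    by (rule LIMSEQ_le_const2) (use Bn in auto)
  also have "(\<Union>n. B n) = {z \<in> sphere 0 1. \<exists>r\<in>{0..<1}. \<mu> < cmod (k (of_real r * z))}"
  proof (intro set_eqI iffI)
    fix z assume "z \<in> (\<Union>n. B n)"
    then obtain n r where "z \<in> sphere 0 1" "0 \<le> r" "r < \<rho> n" "\<mu> < cmod (k (of_real r * z))" by (auto simp: B_def)
    then show "z \<in> {z \<in> sphere 0 1. \<exists>r\<in>{0..<1}. \<mu> < cmod (k (of_real r * z))}"
      using \<rho>[of n] by (auto intro!: bexI[of _ r])
  next
    fix z assume "z \<in> {z \<in> sphere 0 1. \<exists>r\<in>{0..<1}. \<mu> < cmod (k (of_real r * z))}"
    then obtain r where r: "z \<in> sphere 0 1" "0 \<le> r" "r < 1" "\<mu> < cmod (k (of_real r * z))" by auto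
    obtain n :: nat where "1 / (1 - r) < real n" using reals_Archimedean2 by blast
    then have "1 < (1 - r) * (real n + 2)" using r by (simp add: field_simps)
    then have "r < \<rho> n" by (simp add: \<rho>_def field_simps)
    then have "z \<in> B n" using r unfolding B_def by (auto intro!: bexI[of _ r])
    then show "z \<in> (\<Union>n. B n)" by blast
  qed
  finally show "measure circ {z \<in> sphere 0 1. \<exists>r\<in>{0..<1}. \<mu> < cmod (k (of_real r * z))} \<le> 960 / \<mu>\<^sup>2 * \<tau>" .
qed

section \<open>Fatou's theorem\<close>

lemma (in prob_space) null_sets_INT_tendsto:
  assumes Z: "\<And>n. Z n \<in> sets M" "\<And>n. prob (Z n) \<le> C * \<tau> n" and \<tau>: "\<tau> \<longlonglongrightarrow> 0"
  shows "(\<Inter>n::nat. Z n) \<in> null_sets M"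
proof -
  have "prob (\<Inter>n. Z n) \<le> C * \<tau> n" for n
    by (rule order_trans[OF finite_measure_mono Z(2)]) (use Z in auto)
  moreover have "(\<lambda>n. C * \<tau> n) \<longlonglongrightarrow> C * 0"
    by (intro tendsto_intros \<tau>)
  ultimately have "prob (\<Inter>n. Z n) \<le> C * 0"
    by (intro LIMSEQ_le_const[where X = "\<lambda>n. C * \<tau> n"]) blast+
  then have "prob (\<Inter>n. Z n) = 0" using measure_nonneg[of M] by (simp add: antisym)
  moreover have "(\<Inter>n. Z n) \<in> sets M" using Z by (intro sets.countable_INT) auto
  ultimately show ?thesis by (simp add: emeasure_eq_measure null_setsI)
qed

lemma parseval_finite:
  fixes d :: "nat \<Rightarrow> complex"
  assumes "finite K"
  shows "(\<integral>z. (cmod (\<Sum>k\<in>K. d k * z ^ k))\<^sup>2 \<partial>circ) = (\<Sum>k\<in>K. (cmod (d k))\<^sup>2)"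
proof -
  have int: "integrable circ (\<lambda>z. d i * cnj (d j) * (z ^ i * cnj z ^ j))" for i j
    by (rule circ_integrable_bounded[where B = "cmod (d i) * cmod (d j)"])
      (auto intro!: continuous_on_measurable_circ continuous_intros simp: norm_mult norm_power)
  have "complex_of_real (\<integral>z. (cmod (\<Sum>k\<in>K. d k * z ^ k))\<^sup>2 \<partial>circ) =
      (\<integral>z. complex_of_real ((cmod (\<Sum>k\<in>K. d k * z ^ k))\<^sup>2) \<partial>circ)"
    by (rule integral_complex_of_real[symmetric])
  also have "\<dots> = (\<integral>z. (\<Sum>i\<in>K. \<Sum>j\<in>K. d i * cnj (d j) * (z ^ i * cnj z ^ j)) \<partial>circ)"
    by (rule Bochner_Integration.integral_cong)
      (simp_all only: complex_norm_square cnj_sum sum_product complex_cnj_mult complex_cnj_power mult_ac)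
  also have "\<dots> = (\<Sum>i\<in>K. \<Sum>j\<in>K. d i * cnj (d j) * of_bool (i = j))"
    using int by (simp add: Bochner_Integration.integral_sum Bochner_Integration.integrable_sum circ_moment)
  also have "\<dots> = (\<Sum>i\<in>K. d i * cnj (d i))"
    using assms by (intro sum.cong refl) (simp add: sum.delta' of_bool_def if_distrib cong: if_cong)
  also have "\<dots> = complex_of_real (\<Sum>k\<in>K. (cmod (d k))\<^sup>2)"
    by (simp only: complex_norm_square of_real_sum)
  finally show ?thesis by (simp only: of_real_eq_iff)
qed

text \<open>Parseval's identity on the circle of radius \<rho>. Absolute convergence there dominates
  all partial sums by one constant, so the limit passes under the integral.\<close>

lemma taylor_remainder_L2:
  assumes sums: "\<And>w. cmod w < 1 \<Longrightarrow> (\<lambda>n. c n * w ^ n) sums g w" and \<rho>: "0 < \<rho>" "\<rho> < 1"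
  shows "(\<lambda>M. \<Sum>k\<in>{N..<M}. (cmod (c k))\<^sup>2 * \<rho> ^ (2 * k)) \<longlonglongrightarrow>
    (\<integral>z. (cmod (g (of_real \<rho> * z) - (\<Sum>k<N. c k * (of_real \<rho> * z) ^ k)))\<^sup>2 \<partial>circ)"
proof -
  \<comment> \<open>Any radius strictly between \<rho> and 1: convergence at \<sigma> gives absolute
    convergence at \<rho>.\<close>
  define \<sigma> where "\<sigma> = (1 + \<rho>) / 2"
  have \<sigma>: "\<rho> < \<sigma>" "\<sigma> < 1" using \<rho> by (auto simp: \<sigma>_def)
  have "summable (\<lambda>n. c n * of_real \<sigma> ^ n)"
    using sums[of "of_real \<sigma>"] \<sigma> \<rho> by (auto simp: sums_iff)
  then have abs: "summable (\<lambda>n. cmod (c n * of_real \<rho> ^ n))"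
    by (rule powser_insidea) (use \<sigma> \<rho> in auto)
  define S where "S = (\<Sum>n. cmod (c n * of_real \<rho> ^ n))"
  have bound: "cmod (\<Sum>k\<in>{N..<M}. c k * (of_real \<rho> * z) ^ k) \<le> S" if "cmod z = 1" for M z
  proof -
    have "cmod (\<Sum>k\<in>{N..<M}. c k * (of_real \<rho> * z) ^ k) \<le> (\<Sum>k\<in>{N..<M}. cmod (c k * of_real \<rho> ^ k))"
      using that by (intro sum_norm_le) (simp add: norm_mult norm_power power_mult_distrib)
    also have "\<dots> \<le> S" unfolding S_def by (intro sum_le_suminf abs) auto
    finally show ?thesis .
  qed
  have lim: "(\<lambda>M. \<Sum>k\<in>{N..<M}. c k * (of_real \<rho> * z) ^ k) \<longlonglongrightarrow> g (of_real \<rho> * z) - (\<Sum>k<N. c k * (of_real \<rho> * z) ^ k)"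
    if "cmod z = 1" for z
  proof -
    have "(\<lambda>n. c n * (of_real \<rho> * z) ^ n) sums g (of_real \<rho> * z)"
      using that \<rho> by (intro sums) (simp add: norm_mult)
    then have "(\<lambda>M. \<Sum>k<M. c k * (of_real \<rho> * z) ^ k) \<longlonglongrightarrow> g (of_real \<rho> * z)"
      by (simp add: sums_def)
    then have "(\<lambda>M. (\<Sum>k<M. c k * (of_real \<rho> * z) ^ k) - (\<Sum>k<N. c k * (of_real \<rho> * z) ^ k)) \<longlonglongrightarrow>
        g (of_real \<rho> * z) - (\<Sum>k<N. c k * (of_real \<rho> * z) ^ k)"
      by (intro tendsto_intros)
    then show ?thesis
    proof (rule Lim_transform_eventually)
      show "\<forall>\<^sub>F M in sequentially. (\<Sum>k<M. c k * (of_real \<rho> * z) ^ k) - (\<Sum>k<N. c k * (of_real \<rho> * z) ^ k) =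
          (\<Sum>k\<in>{N..<M}. c k * (of_real \<rho> * z) ^ k)"
        using eventually_ge_at_top[of N]
      proof eventually_elim
        case (elim M)
        then show ?case by (simp add: lessThan_atLeast0 sum_diff_nat_ivl)
      qed
    qed
  qed
  have S0: "0 \<le> S" unfolding S_def by (intro suminf_nonneg abs) auto
  have meas: "(\<lambda>z. \<Sum>k\<in>{N..<M}. c k * (of_real \<rho> * z) ^ k) \<in> borel_measurable circ" for M
    by (intro continuous_on_measurable_circ continuous_intros)
  have glim: "(\<lambda>z. g (of_real \<rho> * z) - (\<Sum>k<N. c k * (of_real \<rho> * z) ^ k)) \<in> borel_measurable circ"
    by (rule borel_measurable_LIMSEQ_metric[OF meas]) (use lim in auto)
  have "(\<lambda>M. \<integral>z. (cmod (\<Sum>k\<in>{N..<M}. c k * (of_real \<rho> * z) ^ k))\<^sup>2 \<partial>circ) \<longlonglongrightarrow>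
    (\<integral>z. (cmod (g (of_real \<rho> * z) - (\<Sum>k<N. c k * (of_real \<rho> * z) ^ k)))\<^sup>2 \<partial>circ)"
  proof (rule integral_dominated_convergence[where w = "\<lambda>_. S\<^sup>2"])
    show "AE z in circ. (\<lambda>M. (cmod (\<Sum>k\<in>{N..<M}. c k * (of_real \<rho> * z) ^ k))\<^sup>2) \<longlonglongrightarrow>
      (cmod (g (of_real \<rho> * z) - (\<Sum>k<N. c k * (of_real \<rho> * z) ^ k)))\<^sup>2"
      by (intro AE_I2 tendsto_intros lim) auto
    show "AE z in circ. norm ((cmod (\<Sum>k\<in>{N..<M}. c k * (of_real \<rho> * z) ^ k))\<^sup>2) \<le> S\<^sup>2" for M
      by (intro AE_I2) (auto intro!: power_mono bound)
  qed (use meas glim in measurable)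
  moreover have "(\<integral>z. (cmod (\<Sum>k\<in>{N..<M}. c k * (of_real \<rho> * z) ^ k))\<^sup>2 \<partial>circ) = (\<Sum>k\<in>{N..<M}. (cmod (c k))\<^sup>2 * \<rho> ^ (2 * k))" for M
  proof -
    have "(\<integral>z. (cmod (\<Sum>k\<in>{N..<M}. c k * (of_real \<rho> * z) ^ k))\<^sup>2 \<partial>circ) =
      (\<integral>z. (cmod (\<Sum>k\<in>{N..<M}. (c k * of_real (\<rho> ^ k)) * z ^ k))\<^sup>2 \<partial>circ)"
      by (simp add: power_mult_distrib mult.assoc)
    also have "\<dots> = (\<Sum>k\<in>{N..<M}. (cmod (c k * of_real (\<rho> ^ k)))\<^sup>2)"
      by (rule parseval_finite) simp
    also have "\<dots> = (\<Sum>k\<in>{N..<M}. (cmod (c k))\<^sup>2 * \<rho> ^ (2 * k))"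
      by (intro sum.cong refl)
        (simp only: norm_mult norm_of_real power_mult_distrib power2_abs power_mult[symmetric] mult.commute[of _ 2])
    finally show ?thesis .
  qed
  ultimately show ?thesis by simp
qed

text \<open>On radius \<rho> Parseval bounds every finite sum with weights \<rho>^(2k) by B^2; for a
  fixed finite sum the weights then tend to 1.\<close>

lemma bounded_taylor_square_summable:
  assumes sums: "\<And>w. cmod w < 1 \<Longrightarrow> (\<lambda>n. c n * w ^ n) sums g w"
    and B: "\<And>w. cmod w < 1 \<Longrightarrow> cmod (g w) \<le> B"
  shows "summable (\<lambda>k. (cmod (c k))\<^sup>2)"
proof (rule bounded_imp_summable[where B = "B\<^sup>2"])
  have B0: "B \<ge> 0" using B[of 0] norm_ge_zero order_trans by (metis norm_zero zero_less_one)
  have *: "(\<Sum>k<M. (cmod (c k))\<^sup>2 * \<rho> ^ (2 * k)) \<le> B\<^sup>2" if \<rho>: "0 < \<rho>" "\<rho> < 1" for M \<rho>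
  proof -
    define I where "I = (\<integral>z. (cmod (g (of_real \<rho> * z)))\<^sup>2 \<partial>circ)"
    have L: "(\<lambda>M. \<Sum>k<M. (cmod (c k))\<^sup>2 * \<rho> ^ (2 * k)) \<longlonglongrightarrow> I"
      using taylor_remainder_L2[OF sums \<rho>, of 0] by (simp add: I_def lessThan_atLeast0)
    have "(\<Sum>k<M. (cmod (c k))\<^sup>2 * \<rho> ^ (2 * k)) \<le> I"
    proof (rule LIMSEQ_le_const[OF L], intro exI allI impI)
      fix n assume "M \<le> n"
      then show "(\<Sum>k<M. (cmod (c k))\<^sup>2 * \<rho> ^ (2 * k)) \<le> (\<Sum>k<n. (cmod (c k))\<^sup>2 * \<rho> ^ (2 * k))"
        using \<rho> by (intro sum_mono2) auto
    qed
    also have "I \<le> B\<^sup>2"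
    \<comment> \<open>In the non-integrable case the Bochner integral has the default value 0, which
      also satisfies the bound.\<close>
    proof (cases "integrable circ (\<lambda>z. (cmod (g (of_real \<rho> * z)))\<^sup>2)")
      case True
      have "I \<le> (\<integral>z. B\<^sup>2 \<partial>circ)" unfolding I_def
        using \<rho> by (intro integral_mono True) (auto intro!: power_mono B simp: norm_mult)
      then show ?thesis by simp
    qed (simp add: I_def not_integrable_integral_eq)
    finally show ?thesis .
  qed
  have bd: "(\<Sum>k<M. (cmod (c k))\<^sup>2) \<le> B\<^sup>2" for M
  proof -
    have "((\<lambda>\<rho>. \<Sum>k<M. (cmod (c k))\<^sup>2 * \<rho> ^ (2 * k)) \<longlongrightarrow> (\<Sum>k<M. (cmod (c k))\<^sup>2 * 1 ^ (2 * k))) (at_left 1)"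
      by (intro tendsto_intros)
    moreover have "\<forall>\<^sub>F \<rho> in at_left 1. (\<Sum>k<M. (cmod (c k))\<^sup>2 * \<rho> ^ (2 * k)) \<le> B\<^sup>2"
      using eventually_at_left_real[of 0 "1::real"] by (auto elim!: eventually_mono intro: *)
    ultimately have "(\<Sum>k<M. (cmod (c k))\<^sup>2 * 1 ^ (2 * k)) \<le> B\<^sup>2"
      by (rule tendsto_upperbound) auto
    then show ?thesis by simp
  qed
  show "(\<Sum>k\<le>n. (cmod (c k))\<^sup>2) \<le> B\<^sup>2" for n using bd[of "Suc n"] by (simp add: lessThan_Suc_atMost)
qed simp

text \<open>Along the radius g lies within any tolerance of a function that is continuous up to the
  end point. Its oscillation near the end therefore tends to 0, and completeness supplies the
  limit.\<close>

lemma radial_limit_criterion: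
  assumes "\<And>e. 0 < e \<Longrightarrow> \<exists>p. continuous_on UNIV p \<and> (\<forall>r\<in>{0..<1}. cmod (g (of_real r * z) - p (of_real r * z)) \<le> e)"
  shows "\<exists>l. has_radial_limit g z l"
proof -
  have osc: "\<exists>d>0. \<forall>r s. r \<in> {1-d<..<1} \<longrightarrow> s \<in> {1-d<..<1} \<longrightarrow> cmod (g (of_real r * z) - g (of_real s * z)) < e"
    if e: "0 < e" for e
  proof -
    obtain p where p: "continuous_on UNIV p" "\<And>r. r \<in> {0..<1} \<Longrightarrow> cmod (g (of_real r * z) - p (of_real r * z)) \<le> e / 5"
      using assms[of "e/5"] e by auto
    have "continuous_on UNIV (\<lambda>r::real. p (of_real r * z))"
      by (intro continuous_on_compose2[OF p(1)] continuous_intros) auto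
    then have "isCont (\<lambda>r::real. p (of_real r * z)) 1" by (simp add: continuous_on_eq_continuous_at)
    then obtain d where d: "d > 0" "\<And>r. \<bar>r - 1\<bar> < d \<Longrightarrow> cmod (p (of_real r * z) - p (of_real 1 * z)) < e / 5"
      unfolding continuous_at_eps_delta dist_norm real_norm_def using e by (metis divide_pos_pos zero_less_numeral)
    show ?thesis
    proof (intro exI[of _ "min d 1"] conjI allI impI)
      show "min d 1 > 0" using d by simp
      fix r s assume rs: "r \<in> {1 - min d 1<..<1}" "s \<in> {1 - min d 1<..<1}"
      have "cmod (g (of_real r * z) - g (of_real s * z)) \<le>
        cmod (g (of_real r * z) - p (of_real r * z)) + cmod (p (of_real r * z) - p (of_real 1 * z)) +
        cmod (g (of_real s * z) - p (of_real s * z)) + cmod (p (of_real s * z) - p (of_real 1 * z))"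
        by norm
      also have "\<dots> < e / 5 + e / 5 + e / 5 + e / 5 + e / 5"
        using p(2)[of r] p(2)[of s] d(2)[of r] d(2)[of s] rs e by (auto simp: min_def split: if_splits)
      finally show "cmod (g (of_real r * z) - g (of_real s * z)) < e" by simp
    qed
  qed
  define \<rho> where "\<rho> n = 1 - 1 / real (n + 2)" for n
  have \<rho>lim: "\<rho> \<longlonglongrightarrow> 1" unfolding \<rho>_def by real_asymp
  have \<rho>1: "\<rho> n < 1" for n by (simp add: \<rho>_def)
  have ev: "\<forall>\<^sub>F n in sequentially. \<rho> n \<in> {1-d<..<1}" if "d > 0" for d
    using order_tendstoD(1)[OF \<rho>lim, of "1 - d"] that \<rho>1 by (auto elim!: eventually_mono)
  have "Cauchy (\<lambda>n. g (of_real (\<rho> n) * z))"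
  proof (rule metric_CauchyI)
    fix e :: real assume "0 < e"
    from osc[OF this] obtain d where d: "d > 0" "\<And>r s. r \<in> {1-d<..<1} \<Longrightarrow> s \<in> {1-d<..<1} \<Longrightarrow> cmod (g (of_real r * z) - g (of_real s * z)) < e"
      by blast
    obtain M where "\<And>n. n \<ge> M \<Longrightarrow> \<rho> n \<in> {1-d<..<1}"
      using ev[OF d(1)] by (auto simp: eventually_sequentially)
    then show "\<exists>M. \<forall>m\<ge>M. \<forall>n\<ge>M. dist (g (of_real (\<rho> m) * z)) (g (of_real (\<rho> n) * z)) < e"
      unfolding dist_norm using d(2) by blast
  qed
  then obtain l where l: "(\<lambda>n. g (of_real (\<rho> n) * z)) \<longlonglongrightarrow> l"
    using Cauchy_convergent convergent_def by blast
  have "((\<lambda>r. g (of_real r * z)) \<longlongrightarrow> l) (at_left 1)"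
  proof (rule tendstoI)
    fix e :: real assume e: "0 < e"
    obtain d where d: "d > 0" "\<And>r s. r \<in> {1-d<..<1} \<Longrightarrow> s \<in> {1-d<..<1} \<Longrightarrow> cmod (g (of_real r * z) - g (of_real s * z)) < e/2"
      using osc[of "e/2"] e by (metis half_gt_zero)
    have "cmod (g (of_real r * z) - l) \<le> e/2" if r: "r \<in> {1-d<..<1}" for r
    proof (rule tendsto_upperbound)
      show "(\<lambda>n. cmod (g (of_real r * z) - g (of_real (\<rho> n) * z))) \<longlonglongrightarrow> cmod (g (of_real r * z) - l)"
        by (intro tendsto_intros l)
      show "\<forall>\<^sub>F n in sequentially. cmod (g (of_real r * z) - g (of_real (\<rho> n) * z)) \<le> e/2"
        using ev[OF d(1)] by eventually_elim (use d(2) r in \<open>auto intro: less_imp_le\<close>)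
    qed simp
    moreover have "\<forall>\<^sub>F r in at_left 1. r \<in> {1-d<..<1}"
      using d(1) by (intro eventually_at_left_real) simp
    ultimately show "\<forall>\<^sub>F r in at_left 1. dist (g (of_real r * z)) l < e"
      using e by (auto elim!: eventually_mono simp: dist_norm) (smt (verit) field_sum_of_halves)
  qed
  then show ?thesis unfolding has_radial_limit_def by blast
qed

text \<open>For fixed m the set where the N-th Taylor remainder exceeds 1/(m+1) somewhere on the
  radius has measure tending to 0 with N, so the intersection of these sets over N is null. At every
  other point some Taylor polynomial approximates g along the whole radius.\<close>

theorem fatou:
  assumes g: "g holomorphic_on ball 0 1" and B: "\<And>w. cmod w < 1 \<Longrightarrow> cmod (g w) \<le> B"
  shows "AE z in circ. \<exists>l. has_radial_limit g z l"
proof -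
  define c where "c n = (deriv ^^ n) g 0 / fact n" for n
  have sums: "(\<lambda>n. c n * w ^ n) sums g w" if "cmod w < 1" for w
    using holomorphic_power_series[OF g, of w] that by (simp add: c_def)
  have sm: "summable (\<lambda>k. (cmod (c k))\<^sup>2)"
    by (rule bounded_taylor_square_summable[OF sums B])
  define \<tau> where "\<tau> N = (\<Sum>k. (cmod (c (k + N)))\<^sup>2)" for N
  have \<tau>: "\<tau> \<longlonglongrightarrow> 0" unfolding \<tau>_def by (rule suminf_exist_split2[OF sm])
  define k where "k N z = g z - (\<Sum>k<N. c k * z ^ k)" for N z
  have kh: "k N holomorphic_on ball 0 1" for N
    unfolding k_def by (intro holomorphic_intros g)
  have k\<tau>: "(\<integral>z. (cmod (k N (of_real \<rho> * z)))\<^sup>2 \<partial>circ) \<le> \<tau> N" if \<rho>: "0 < \<rho>" "\<rho> < 1" for N \<rho>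
  proof (rule LIMSEQ_le_const2[OF taylor_remainder_L2[OF sums \<rho>, of N, folded k_def]], simp, intro exI allI impI)
    fix M assume "N \<le> M"
    have "(\<Sum>k = N..<M. (cmod (c k))\<^sup>2 * \<rho> ^ (2 * k)) \<le> (\<Sum>k = N..<M. (cmod (c k))\<^sup>2)"
      using \<rho> by (intro sum_mono mult_left_le) (auto simp: power_le_one)
    also have "\<dots> = (\<Sum>k<M - N. (cmod (c (k + N)))\<^sup>2)"
      using \<open>N \<le> M\<close> sum.shift_bounds_nat_ivl[of "\<lambda>k. (cmod (c k))\<^sup>2" 0 N "M - N"] by (simp add: lessThan_atLeast0)
    also have "\<dots> \<le> \<tau> N" unfolding \<tau>_def
      by (intro sum_le_suminf summable_ignore_initial_segment sm) auto
    finally show "(\<Sum>k = N..<M. (cmod (c k))\<^sup>2 * \<rho> ^ (2 * k)) \<le> \<tau> N" .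
  qed
  define Z where "Z m N = {z \<in> sphere 0 1. \<exists>r\<in>{0..<1}. 1 / real (Suc m) < cmod (k N (of_real r * z))}" for m N
  have Zm: "Z m N \<in> sets circ" and Zb: "measure circ (Z m N) \<le> 960 / (1 / real (Suc m))\<^sup>2 * \<tau> N" for m N
    unfolding Z_def by (rule radial_maximal[OF kh _ k\<tau>]; simp)+
  have null: "(\<Inter>N. Z m N) \<in> null_sets circ" for m
    by (rule circ.null_sets_INT_tendsto[OF Zm Zb \<tau>])
  have "AE z in circ. \<forall>m. z \<notin> (\<Inter>N. Z m N)"
    unfolding AE_all_countable by (intro allI AE_not_in null)
  then show ?thesis
  proof (rule AE_mp, intro AE_I2 impI)
    fix z assume z: "z \<in> space circ" "\<forall>m. z \<notin> (\<Inter>N. Z m N)"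
    show "\<exists>l. has_radial_limit g z l"
    proof (rule radial_limit_criterion)
      fix e :: real assume "0 < e"
      then obtain m where m: "1 / real (Suc m) < e" using nat_approx_posE by blast
      from z obtain N where "z \<notin> Z m N" by blast
      then have "\<forall>r\<in>{0..<1}. cmod (k N (of_real r * z)) \<le> 1 / real (Suc m)" using z(1) by (auto simp: Z_def not_less)
      then have "\<forall>r\<in>{0..<1}. cmod (g (of_real r * z) - (\<Sum>k<N. c k * (of_real r * z) ^ k)) \<le> e"
        using m by (auto simp: k_def intro: order_trans less_imp_le)
      moreover have "continuous_on UNIV (\<lambda>z. \<Sum>k<N. c k * z ^ k)" by (intro continuous_intros)
      ultimately show "\<exists>p. continuous_on UNIV p \<and> (\<forall>r\<in>{0..<1}. cmod (g (of_real r * z) - p (of_real r * z)) \<le> e)"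
        by (intro exI[of _ "\<lambda>z. \<Sum>k<N. c k * z ^ k"]) auto
    qed
  qed
qed

section \<open>Boundary functions\<close>

definition bounded_disc :: "(complex \<Rightarrow> complex) \<Rightarrow> real \<Rightarrow> bool" where
  "bounded_disc g B \<longleftrightarrow> g holomorphic_on ball 0 1 \<and> (\<forall>w. cmod w < 1 \<longrightarrow> cmod (g w) \<le> B)"

definition radii :: "nat \<Rightarrow> real" where
  "radii n = 1 - 1 / real (n + 2)"

text \<open>Using one fixed sequence of radii makes measurability immediate, as for any limit of a
  sequence. The value agrees with the radial limit wherever that exists, which by Fatou's theorem is
  almost everywhere for bounded g.\<close>

definition bdry :: "(complex \<Rightarrow> complex) \<Rightarrow> complex \<Rightarrow> complex" where
  "bdry g z = lim (\<lambda>n. g (of_real (radii n) * z))"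

lemma radii: "0 < radii n" "radii n < 1"
  by (auto simp: radii_def field_simps)

lemma radii_nonneg: "0 \<le> radii n"
  using radii(1)[of n] by simp

lemma radii_lim: "radii \<longlonglongrightarrow> 1"
  unfolding radii_def by real_asymp

lemma radii_at_left: "filterlim radii (at_left 1) sequentially"
  unfolding filterlim_at using radii radii_lim by (auto simp: less_imp_neq)

lemma bdry_eqI: "(\<lambda>n. g (of_real (radii n) * z)) \<longlonglongrightarrow> l \<Longrightarrow> bdry g z = l"
  unfolding bdry_def by (rule limI)

lemma bdry_radial_limit:
  assumes "has_radial_limit g z l"
  shows "(\<lambda>n. g (of_real (radii n) * z)) \<longlonglongrightarrow> l" "bdry g z = l"
proof -
  show "(\<lambda>n. g (of_real (radii n) * z)) \<longlonglongrightarrow> l"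
    using filterlim_compose[OF assms[unfolded has_radial_limit_def] radii_at_left] .
  then show "bdry g z = l" by (rule bdry_eqI)
qed

lemma in_ball_dilate: "cmod z \<le> 1 \<Longrightarrow> 0 \<le> r \<Longrightarrow> r < 1 \<Longrightarrow> cmod (of_real r * z) < 1"
  using mult_left_mono[of "cmod z" 1 r] by (simp add: norm_mult)

lemma bounded_disc_dilate:
  assumes g: "bounded_disc g B" and r: "0 \<le> r" "r < 1"
  shows "continuous_on (cball 0 1) (\<lambda>z. g (of_real r * z))" "(\<lambda>z. g (of_real r * z)) holomorphic_on ball 0 1"
    and "(\<lambda>z. g (of_real r * z)) \<in> borel_measurable circ"
    and "cmod z \<le> 1 \<Longrightarrow> cmod (g (of_real r * z)) \<le> B"
proof -
  have h: "g holomorphic_on ball 0 1" and B: "\<And>w. cmod w < 1 \<Longrightarrow> cmod (g w) \<le> B"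
    using g by (auto simp: bounded_disc_def)
  show c: "continuous_on (cball 0 1) (\<lambda>z. g (of_real r * z))"
    by (intro continuous_on_compose2[OF holomorphic_on_imp_continuous_on[OF h]] continuous_intros)
      (use in_ball_dilate r in auto)
  have "(g o (\<lambda>z. of_real r * z)) holomorphic_on ball 0 1"
    by (intro holomorphic_on_compose_gen[OF _ h] holomorphic_intros) (use in_ball_dilate r in auto)
  then show "(\<lambda>z. g (of_real r * z)) holomorphic_on ball 0 1" by (simp add: o_def)
  show "(\<lambda>z. g (of_real r * z)) \<in> borel_measurable circ"
    by (rule continuous_on_measurable_circ[OF continuous_on_subset[OF c]]) auto
  show "cmod (g (of_real r * z)) \<le> B" if "cmod z \<le> 1"
    by (rule B) (rule in_ball_dilate[OF that r])
qed

lemma bdry_measurable: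
  assumes "bounded_disc g B"
  shows "bdry g \<in> borel_measurable circ"
  unfolding bdry_def
  by (rule borel_measurable_lim_metric) (use bounded_disc_dilate(3)[OF assms] radii in \<open>auto intro: less_imp_le\<close>)

lemma bdry_AE:
  assumes "bounded_disc g B"
  shows "AE z in circ. (\<lambda>n. g (of_real (radii n) * z)) \<longlonglongrightarrow> bdry g z \<and> cmod (bdry g z) \<le> B"
proof -
  have h: "g holomorphic_on ball 0 1" and B: "\<And>w. cmod w < 1 \<Longrightarrow> cmod (g w) \<le> B"
    using assms by (auto simp: bounded_disc_def)
  have "AE z in circ. \<exists>l. has_radial_limit g z l" by (rule fatou[OF h B])
  then show ?thesis
    using AE_space
  proof eventually_elim
    case (elim z)
    then obtain l where l: "has_radial_limit g z l" by blast
    have "cmod l \<le> B"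
      by (rule tendsto_upperbound[OF tendsto_norm[OF bdry_radial_limit(1)[OF l]]])
        (use elim radii radii_nonneg in \<open>auto intro!: always_eventually bounded_disc_dilate(4)[OF assms]\<close>)
    then show ?case using bdry_radial_limit[OF l] by simp
  qed
qed

lemma bounded_disc_mult:
  assumes "bounded_disc g B" "bounded_disc h C"
  shows "bounded_disc (\<lambda>z. g z * h z) (B * C)"
  using assms order_trans[OF norm_ge_zero]
  by (fastforce simp: bounded_disc_def norm_mult intro!: holomorphic_intros mult_mono)

lemma bounded_disc_power:
  assumes "bounded_disc g B"
  shows "bounded_disc (\<lambda>z. g z ^ j) (B ^ j)"
  using assms by (auto simp: bounded_disc_def norm_power intro!: holomorphic_intros power_mono)

lemma bounded_disc_ident_power: "bounded_disc (\<lambda>z. z ^ j) 1"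
  by (auto simp: bounded_disc_def norm_power power_le_one intro!: holomorphic_intros)

lemma bdry_mult_AE:
  assumes "bounded_disc g B" "bounded_disc h C"
  shows "AE z in circ. bdry (\<lambda>z. g z * h z) z = bdry g z * bdry h z"
  using bdry_AE[OF assms(1)] bdry_AE[OF assms(2)]
  by eventually_elim (auto intro!: bdry_eqI tendsto_intros)

lemma bdry_power_AE:
  assumes "bounded_disc g B"
  shows "AE z in circ. bdry (\<lambda>z. g z ^ j) z = bdry g z ^ j"
  using bdry_AE[OF assms] by eventually_elim (auto intro!: bdry_eqI tendsto_intros)

lemma bdry_ident_power: "bdry (\<lambda>z. z ^ j) z = z ^ j"
proof (rule bdry_eqI)
  have "(\<lambda>n. complex_of_real (radii n)) \<longlonglongrightarrow> of_real 1"
    by (intro tendsto_of_real radii_lim)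
  then have "(\<lambda>n. (of_real (radii n) * z) ^ j) \<longlonglongrightarrow> (of_real 1 * z) ^ j"
    by (intro tendsto_intros radii_lim)
  then show "(\<lambda>n. (of_real (radii n) * z) ^ j) \<longlonglongrightarrow> z ^ j" by simp
qed

section \<open>Fourier coefficients of boundary functions\<close>

lemma bdry_integral:
  assumes "bounded_disc g B"
  shows "(\<integral>z. bdry g z \<partial>circ) = g 0"
proof -
  have "(\<lambda>n. \<integral>z. g (of_real (radii n) * z) \<partial>circ) \<longlonglongrightarrow> (\<integral>z. bdry g z \<partial>circ)"
    by (rule integral_dominated_convergence[where w = "\<lambda>_. B"])
      (use bdry_measurable[OF assms] bounded_disc_dilate(3,4)[OF assms] bdry_AE[OF assms] radii radii_nonneg
        in \<open>auto intro!: AE_I2\<close>)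
  moreover have "(\<integral>z. g (of_real (radii n) * z) \<partial>circ) = g 0" for n
    using circ_mean_value[OF bounded_disc_dilate(1,2)[OF assms]] radii[of n] by simp
  ultimately show ?thesis by (simp add: LIMSEQ_const_iff)
qed

lemma bdry_bounded_integrable:
  assumes "bounded_disc g B" "h \<in> borel_measurable circ" "\<And>z. cmod z = 1 \<Longrightarrow> cmod (h z) \<le> C"
  shows "integrable circ (\<lambda>z. bdry g z * h z)"
proof (rule circ.integrable_const_bound[where B = "B * C"])
  have B: "0 \<le> B" using assms(1) order_trans[OF norm_ge_zero] unfolding bounded_disc_def by (metis norm_zero zero_less_one)
  show "AE z in circ. norm (bdry g z * h z) \<le> B * C"
    using bdry_AE[OF assms(1)] AE_space
    by eventually_elim (use assms(3) B in \<open>auto simp: norm_mult intro!: mult_mono\<close>)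
qed (use bdry_measurable[OF assms(1)] assms(2) in measurable)

text \<open>The mean value property of g(z) z^j: boundary functions have no coefficients of negative
  index. The convention 0^0 = 1 covers j = 0.\<close>

lemma bdry_integral_power:
  assumes "bounded_disc g B"
  shows "(\<integral>z. bdry g z * z ^ j \<partial>circ) = g 0 * 0 ^ j"
proof -
  note m = bounded_disc_mult[OF assms bounded_disc_ident_power[of j]]
  have "(\<integral>z. bdry g z * z ^ j \<partial>circ) = (\<integral>z. bdry (\<lambda>z. g z * z ^ j) z \<partial>circ)"
  proof (rule integral_cong_AE)
    show "AE z in circ. bdry g z * z ^ j = bdry (\<lambda>z. g z * z ^ j) z"
      using bdry_mult_AE[OF assms bounded_disc_ident_power[of j]] by eventually_elim (simp add: bdry_ident_power)
  qed (use bdry_measurable[OF assms] bdry_measurable[OF m] in measurable)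
  then show ?thesis using bdry_integral[OF m] by simp
qed

text \<open>Backward shift of the Taylor series, the step of the inductions on coefficients below.
  The quotient is bounded on |z| \<le> 1/2 by compactness; elsewhere |g(z) - g(0)| \<le> 2B is
  divided by more than 1/2, giving 4B.\<close>

lemma bounded_disc_divide:
  assumes "bounded_disc g B"
  obtains q C where "bounded_disc q C" "\<And>z. cmod z < 1 \<Longrightarrow> g z = g 0 + z * q z"
proof -
  have h: "g holomorphic_on ball 0 1" and B: "\<And>w. cmod w < 1 \<Longrightarrow> cmod (g w) \<le> B"
    using assms by (auto simp: bounded_disc_def)
  have "(\<lambda>z. g z - g 0) holomorphic_on ball 0 1" by (intro holomorphic_intros h)
  then obtain q where q: "q holomorphic_on ball 0 1" "\<And>z. cmod z < 1 \<Longrightarrow> g z - g 0 = z * q z"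
    by (rule Schwarz3) auto
  have "continuous_on (cball 0 (1/2)) q"
    by (rule continuous_on_subset[OF holomorphic_on_imp_continuous_on[OF q(1)]]) auto
  then have "bounded (q ` cball 0 (1/2))"
    by (intro compact_imp_bounded compact_continuous_image) auto
  then obtain C where C: "\<And>z. cmod z \<le> 1/2 \<Longrightarrow> cmod (q z) \<le> C"
    by (metis bounded_iff imageI mem_cball_0)
  have "cmod (q w) \<le> max C (4 * B)" if w: "cmod w < 1" for w
  proof (cases "cmod w \<le> 1/2")
    case False
    have "cmod w * cmod (q w) = cmod (g w - g 0)" using q(2)[OF w] by (simp add: norm_mult)
    also have "\<dots> \<le> 2 * B" using norm_triangle_ineq4[of "g w" "g 0"] B[OF w] B[of 0] by simp
    finally have "cmod w * cmod (q w) \<le> 2 * B" .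
    moreover have "(1/2) * cmod (q w) \<le> cmod w * cmod (q w)" using False by (intro mult_right_mono) auto
    ultimately show ?thesis by simp
  qed (use C in \<open>auto intro: le_max_iff_disj[THEN iffD2]\<close>)
  then have "bounded_disc q (max C (4 * B))" using q by (simp add: bounded_disc_def)
  moreover have "g z = g 0 + z * q z" if "cmod z < 1" for z using q(2)[OF that] by (simp add: algebra_simps)
  ultimately show ?thesis using that by blast
qed

lemma bdry_divide_AE:
  assumes q: "bounded_disc q C" "\<And>z. cmod z < 1 \<Longrightarrow> g z = c + z * q z"
  shows "AE z in circ. bdry g z = c + z * bdry q z"
  using bdry_AE[OF q(1)] AE_space
proof eventually_elim
  case (elim z)
  have "(\<lambda>n. complex_of_real (radii n)) \<longlonglongrightarrow> of_real 1"
    by (intro tendsto_of_real radii_lim)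
  then have "(\<lambda>n. c + (of_real (radii n) * z) * q (of_real (radii n) * z)) \<longlonglongrightarrow> c + (of_real 1 * z) * bdry q z"
    by (intro tendsto_intros radii_lim) (use elim in auto)
  moreover have "c + (of_real (radii n) * z) * q (of_real (radii n) * z) = g (of_real (radii n) * z)" for n
    using q(2)[OF in_ball_dilate, of z "radii n"] elim radii[of n] by simp
  ultimately have "(\<lambda>n. g (of_real (radii n) * z)) \<longlonglongrightarrow> c + z * bdry q z" by simp
  then show ?case by (rule bdry_eqI)
qed

lemma circ_cnj_power_measurable [measurable]:
  "(\<lambda>z. cnj z ^ k) \<in> borel_measurable circ" "(\<lambda>z. z ^ k) \<in> borel_measurable circ"
  by (intro continuous_on_measurable_circ continuous_intros)+

lemma circ_cnj_moment: "(\<integral>z. cnj z ^ k \<partial>circ) = of_bool (k = 0)" "(\<integral>z. z ^ k \<partial>circ) = of_bool (k = 0)"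
  using circ_moment[of 0 k] circ_moment[of k 0] by auto

text \<open>On the circle one factor cnj z cancels the factor z in front of q, and the constant c
  has no coefficient of positive index.\<close>

lemma bdry_coeff_shift:
  assumes g: "bounded_disc g B" and q: "bounded_disc q C" "\<And>z. cmod z < 1 \<Longrightarrow> g z = c + z * q z"
  shows "(\<integral>z. bdry g z * cnj z ^ Suc k \<partial>circ) = (\<integral>z. bdry q z * cnj z ^ k \<partial>circ)"
proof -
  have bdry_AE_q: "AE z in circ. bdry g z = c + z * bdry q z" by (rule bdry_divide_AE[OF q])
  have "(\<integral>z. bdry g z * cnj z ^ Suc k \<partial>circ) = (\<integral>z. c * cnj z ^ Suc k + bdry q z * cnj z ^ k \<partial>circ)"
  proof (rule integral_cong_AE)
    show "AE z in circ. bdry g z * cnj z ^ Suc k = c * cnj z ^ Suc k + bdry q z * cnj z ^ k"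
      using bdry_AE_q AE_space
    proof eventually_elim
      case (elim z)
      then have "z * cnj z ^ Suc k = cnj z ^ k" using cnj_mult_self_circ(2)[of z] by (simp add: mult.assoc[symmetric])
      then have "z * bdry q z * cnj z ^ Suc k = bdry q z * cnj z ^ k" by (metis mult.assoc mult.commute)
      then show ?case using elim by (simp only: distrib_right)
    qed
  qed (use bdry_measurable[OF g] bdry_measurable[OF q(1)] in measurable)
  also have "\<dots> = (\<integral>z. c * cnj z ^ Suc k \<partial>circ) + (\<integral>z. bdry q z * cnj z ^ k \<partial>circ)"
  proof (rule Bochner_Integration.integral_add)
    show "integrable circ (\<lambda>z. c * cnj z ^ Suc k)"
      by (rule circ_integrable_bounded[where B = "cmod c"]) (auto simp: norm_mult norm_power simp del: power_Suc)
    show "integrable circ (\<lambda>z. bdry q z * cnj z ^ k)"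
      by (rule bdry_bounded_integrable[OF q(1), where C = 1]) (auto simp: norm_power)
  qed
  also have "(\<integral>z. c * cnj z ^ Suc k \<partial>circ) = 0"
    using circ_cnj_moment(1)[of "Suc k"] by (simp del: power_Suc)
  finally show ?thesis by simp
qed

text \<open>Relates coefficients on an inner circle to those on the boundary, so that pointwise
  convergence inside the disc yields convergence of boundary coefficients. Each backward shift in
  the induction releases one factor s.\<close>

lemma bdry_coeff_interior:
  assumes "bounded_disc g B" "0 \<le> s" "s < 1"
  shows "(\<integral>z. g (of_real s * z) * cnj z ^ k \<partial>circ) = of_real s ^ k * (\<integral>z. bdry g z * cnj z ^ k \<partial>circ)"
  using assms(1)
proof (induction k arbitrary: g B)
  case 0
  then show ?case
    using bdry_integral[OF 0] circ_mean_value[OF bounded_disc_dilate(1,2)[OF 0 assms(2,3)]] by simp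
next
  case (Suc k)
  obtain q C where q: "bounded_disc q C" "\<And>z. cmod z < 1 \<Longrightarrow> g z = g 0 + z * q z"
    using bounded_disc_divide[OF Suc.prems] by blast
  have "(\<integral>z. g (of_real s * z) * cnj z ^ Suc k \<partial>circ) =
      (\<integral>z. g 0 * cnj z ^ Suc k + of_real s * (q (of_real s * z) * cnj z ^ k) \<partial>circ)"
  proof (rule Bochner_Integration.integral_cong)
    fix z assume "z \<in> space circ"
    then have z: "cmod z = 1" by simp
    then have "z * cnj z ^ Suc k = cnj z ^ k" using cnj_mult_self_circ(2)[of z] by (simp add: mult.assoc[symmetric])
    then have "of_real s * z * q (of_real s * z) * cnj z ^ Suc k = of_real s * (q (of_real s * z) * cnj z ^ k)"
      by (metis mult.assoc mult.commute)
    moreover have "g (of_real s * z) = g 0 + of_real s * z * q (of_real s * z)"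
      using q(2)[OF in_ball_dilate, of z s] z assms by simp
    ultimately show "g (of_real s * z) * cnj z ^ Suc k = g 0 * cnj z ^ Suc k + of_real s * (q (of_real s * z) * cnj z ^ k)"
      by (simp only: distrib_right)
  qed simp
  also have "\<dots> = (\<integral>z. g 0 * cnj z ^ Suc k \<partial>circ) + (\<integral>z. of_real s * (q (of_real s * z) * cnj z ^ k) \<partial>circ)"
  proof (rule Bochner_Integration.integral_add)
    show "integrable circ (\<lambda>z. g 0 * cnj z ^ Suc k)"
      by (rule circ_integrable_bounded[where B = "cmod (g 0)"]) (auto simp: norm_mult norm_power simp del: power_Suc)
    have [measurable]: "(\<lambda>z. q (of_real s * z)) \<in> borel_measurable circ"
      by (rule bounded_disc_dilate(3)[OF q(1) assms(2,3)])
    have "integrable circ (\<lambda>z. q (of_real s * z) * cnj z ^ k)"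
      by (rule circ_integrable_bounded[where B = C])
        (use bounded_disc_dilate(4)[OF q(1) assms(2,3)] in \<open>auto simp: norm_mult norm_power\<close>)
    then show "integrable circ (\<lambda>z. of_real s * (q (of_real s * z) * cnj z ^ k))" by simp
  qed
  also have "(\<integral>z. g 0 * cnj z ^ Suc k \<partial>circ) = 0"
    using circ_cnj_moment(1)[of "Suc k"] by (simp del: power_Suc)
  also have "0 + (\<integral>z. of_real s * (q (of_real s * z) * cnj z ^ k) \<partial>circ) = of_real s ^ Suc k * (\<integral>z. bdry q z * cnj z ^ k \<partial>circ)"
    using Suc.IH[OF q(1)] by simp
  also have "(\<integral>z. bdry q z * cnj z ^ k \<partial>circ) = (\<integral>z. bdry g z * cnj z ^ Suc k \<partial>circ)"
    using bdry_coeff_shift[OF Suc.prems q] by simp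
  finally show ?case .
qed

section \<open>Inner functions fixing the origin\<close>

definition disc_inner :: "(complex \<Rightarrow> complex) \<Rightarrow> bool" where
  "disc_inner g \<longleftrightarrow> g holomorphic_on ball 0 1 \<and> g ` ball 0 1 \<subseteq> ball 0 1 \<and> (AE z in circ. cmod (bdry g z) = 1)"

text \<open>The boundary function as an everywhere defined self-map of the circle: on the null set
  where the modulus is not 1 it takes the default value 1. Only such a map can be iterated
  pointwise.\<close>

definition bd :: "(complex \<Rightarrow> complex) \<Rightarrow> complex \<Rightarrow> complex" where
  "bd g z = (if cmod (bdry g z) = 1 then bdry g z else 1)"

lemma norm_bd [simp]: "cmod (bd g z) = 1"
  by (simp add: bd_def)

lemma disc_inner_bounded: "disc_inner g \<Longrightarrow> bounded_disc g 1"
  by (force simp: disc_inner_def bounded_disc_def)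

lemma disc_inner_norm_less: "disc_inner g \<Longrightarrow> cmod z < 1 \<Longrightarrow> cmod (g z) < 1"
  by (force simp: disc_inner_def)

lemma bd_AE: "disc_inner g \<Longrightarrow> AE z in circ. bd g z = bdry g z"
  by (auto simp: disc_inner_def bd_def elim!: AE_mp)

lemma bd_borel: "disc_inner g \<Longrightarrow> bd g \<in> borel_measurable circ"
  unfolding bd_def using bdry_measurable[OF disc_inner_bounded, of g] by measurable

lemma bd_measurable: "disc_inner g \<Longrightarrow> bd g \<in> measurable circ circ"
  using measurable_restrict_space2[OF _ bd_borel, of g "sphere 0 1"]
  by (auto cong: measurable_cong_sets)

lemma bd_power_integral:
  assumes g: "disc_inner g"
  shows "(\<integral>z. bd g z ^ j \<partial>circ) = g 0 ^ j"
proof -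
  note b = disc_inner_bounded[OF g]
  have "(\<integral>z. bd g z ^ j \<partial>circ) = (\<integral>z. bdry (\<lambda>z. g z ^ j) z \<partial>circ)"
  proof (rule integral_cong_AE)
    show "AE z in circ. bd g z ^ j = bdry (\<lambda>z. g z ^ j) z"
      using bd_AE[OF g] bdry_power_AE[OF b, of j] by eventually_elim simp
  qed (use bd_borel[OF g] bdry_measurable[OF bounded_disc_power[OF b]] in measurable)
  then show ?thesis using bdry_integral[OF bounded_disc_power[OF b]] by simp
qed

text \<open>Loewner's lemma. The moments of the image measure are means of powers of
  \<open>bd g\<close> or their conjugates, that is powers of g(0) = 0, just as for arc length
  itself.\<close>

lemma bd_distr:
  assumes g: "disc_inner g" "g 0 = 0"
  shows "distr circ circ (bd g) = circ"
proof (rule measure_eqI_moments)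
  have m[measurable]: "bd g \<in> measurable circ circ" by (rule bd_measurable[OF g(1)])
  interpret D: prob_space "distr circ circ (bd g)" by (rule circ.prob_space_distr[OF m])
  show "finite_measure (distr circ circ (bd g))" by unfold_locales
  show "finite_measure circ" by unfold_locales
  fix i j
  have [measurable]: "(\<lambda>z. z ^ i * cnj z ^ j) \<in> borel_measurable circ"
    by (intro continuous_on_measurable_circ continuous_intros)
  have "(\<integral>z. z ^ i * cnj z ^ j \<partial>distr circ circ (bd g)) = (\<integral>z. bd g z ^ i * cnj (bd g z) ^ j \<partial>circ)"
    by (rule integral_distr) measurable
  also have "\<dots> = (\<integral>z. (if j \<le> i then bd g z ^ (i - j) else cnj (bd g z ^ (j - i))) \<partial>circ)"
    by (simp add: monomial_unimodular cong: if_cong)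
  also have "\<dots> = of_bool (i = j)"
  proof (cases "j \<le> i")
    case False
    then have "(\<integral>z. cnj (bd g z ^ (j - i)) \<partial>circ) = cnj ((g 0) ^ (j - i))"
      using bd_power_integral[OF g(1), of "j - i"] by (simp del: complex_cnj_power)
    then show ?thesis using False g(2) by (auto simp: zero_power)
  qed (use bd_power_integral[OF g(1)] g(2) in \<open>auto simp: zero_power\<close>)
  finally show "(\<integral>z. z ^ i * cnj z ^ j \<partial>distr circ circ (bd g)) = (\<integral>z. z ^ i * cnj z ^ j \<partial>circ)"
    by (simp add: circ_moment)
qed auto

lemma bd_integral:
  fixes h :: "complex \<Rightarrow> 'a::{banach, second_countable_topology}"
  assumes "disc_inner g" "g 0 = 0" "h \<in> borel_measurable circ"
  shows "(\<integral>z. h (bd g z) \<partial>circ) = (\<integral>z. h z \<partial>circ)"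
  using integral_distr[OF bd_measurable[OF assms(1)], of h] assms by (simp add: bd_distr)

lemma bd_AE_compose:
  assumes "disc_inner g" "g 0 = 0" "AE z in circ. P z"
  shows "AE z in circ. P (bd g z)"
  by (rule AE_distrD[OF bd_measurable[OF assms(1)]]) (use assms in \<open>simp only: bd_distr\<close>)

section \<open>Boundary functions of compositions and iterates\<close>

lemma bounded_disc_compose:
  assumes "bounded_disc g B" "disc_inner f"
  shows "bounded_disc (\<lambda>z. g (f z)) B"
proof -
  have "(g \<circ> f) holomorphic_on ball 0 1"
    using assms by (intro holomorphic_on_compose_gen[of f "ball 0 1" g "ball 0 1"]) (auto simp: bounded_disc_def disc_inner_def)
  then show ?thesis using assms disc_inner_norm_less[OF assms(2)]
    by (auto simp: bounded_disc_def o_def)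
qed

lemma compose_moment_pos:
  assumes g: "bounded_disc g B" and f: "disc_inner f" "f 0 = 0"
  shows "(\<integral>z. bdry (\<lambda>z. g (f z)) z * bd f z ^ j \<partial>circ) = (\<integral>z. bdry g z * z ^ j \<partial>circ)"
proof -
  note gf = bounded_disc_compose[OF g f(1)] and fj = bounded_disc_power[OF disc_inner_bounded[OF f(1)], of j]
  note m = bounded_disc_mult[OF gf fj]
  have "(\<integral>z. bdry (\<lambda>z. g (f z)) z * bd f z ^ j \<partial>circ) = (\<integral>z. bdry (\<lambda>z. g (f z) * f z ^ j) z \<partial>circ)"
  proof (rule integral_cong_AE)
    show "AE z in circ. bdry (\<lambda>z. g (f z)) z * bd f z ^ j = bdry (\<lambda>z. g (f z) * f z ^ j) z"
      using bdry_mult_AE[OF gf fj] bdry_power_AE[OF disc_inner_bounded[OF f(1)], of j] bd_AE[OF f(1)]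
      by eventually_elim simp
  qed (use bd_borel[OF f(1)] bdry_measurable[OF gf] bdry_measurable[OF m] in measurable)
  also have "\<dots> = g (f 0) * f 0 ^ j" by (rule bdry_integral[OF m])
  finally show ?thesis using f(2) bdry_integral_power[OF g] by simp
qed

text \<open>The radial limit on the right is that of the composite q(f), because f(r z) need not
  approach its boundary value radially and \<open>bdry q (bd f z)\<close> is not yet
  available.\<close>

lemma bdry_compose_divide_AE:
  assumes f: "disc_inner f" and q: "bounded_disc q C" "\<And>z. cmod z < 1 \<Longrightarrow> g z = c + z * q z"
  shows "AE z in circ. bdry (\<lambda>z. g (f z)) z = c + bd f z * bdry (\<lambda>z. q (f z)) z"
  using bdry_AE[OF disc_inner_bounded[OF f]] bdry_AE[OF bounded_disc_compose[OF q(1) f]] bd_AE[OF f] AE_space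
proof eventually_elim
  case (elim z)
  have "(\<lambda>n. c + f (of_real (radii n) * z) * q (f (of_real (radii n) * z))) \<longlonglongrightarrow> c + bdry f z * bdry (\<lambda>z. q (f z)) z"
    by (intro tendsto_intros) (use elim in auto)
  moreover have "c + f (of_real (radii n) * z) * q (f (of_real (radii n) * z)) = g (f (of_real (radii n) * z))" for n
    using q(2)[OF disc_inner_norm_less[OF f in_ball_dilate], of z "radii n"] elim radii[of n] by simp
  ultimately show ?case using elim by (intro bdry_eqI) simp
qed

text \<open>Induction by the backward shift of g: g(f) = g(0) + f q(f), and on the circle the factor
  f cancels one conjugate factor. The constant drops out because \<open>bd f\<close> preserves arc
  length.\<close>

lemma compose_moment_neg:
  assumes g: "bounded_disc g B" and f: "disc_inner f" "f 0 = 0"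
  shows "(\<integral>z. bdry (\<lambda>z. g (f z)) z * cnj (bd f z) ^ j \<partial>circ) = (\<integral>z. bdry g z * cnj z ^ j \<partial>circ)"
  using g
proof (induction j arbitrary: g B)
  case 0
  then show ?case using bdry_integral[OF 0] bdry_integral[OF bounded_disc_compose[OF 0 f(1)]] f(2) by simp
next
  case (Suc j)
  obtain q C where q: "bounded_disc q C" "\<And>z. cmod z < 1 \<Longrightarrow> g z = g 0 + z * q z"
    using bounded_disc_divide[OF Suc.prems] by blast
  note qf = bounded_disc_compose[OF q(1) f(1)] and gf = bounded_disc_compose[OF Suc.prems f(1)]
  have [measurable]: "bd f \<in> measurable circ circ" by (rule bd_measurable[OF f(1)])
  have cm[measurable]: "(\<lambda>z. cnj (bd f z) ^ k) \<in> borel_measurable circ" for k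
    by (rule measurable_compose[OF _ circ_cnj_power_measurable(1)]) measurable
  have "(\<integral>z. bdry (\<lambda>z. g (f z)) z * cnj (bd f z) ^ Suc j \<partial>circ) =
      (\<integral>z. g 0 * cnj (bd f z) ^ Suc j + bdry (\<lambda>z. q (f z)) z * cnj (bd f z) ^ j \<partial>circ)"
  proof (rule integral_cong_AE)
    have "AE z in circ. bdry (\<lambda>z. g (f z)) z = g 0 + bd f z * bdry (\<lambda>z. q (f z)) z"
      by (rule bdry_compose_divide_AE[OF f(1) q])
    then show "AE z in circ. bdry (\<lambda>z. g (f z)) z * cnj (bd f z) ^ Suc j = g 0 * cnj (bd f z) ^ Suc j + bdry (\<lambda>z. q (f z)) z * cnj (bd f z) ^ j"
    proof eventually_elim
      case (elim z)
      have "bd f z * cnj (bd f z) ^ Suc j = cnj (bd f z) ^ j"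
        using cnj_mult_self_circ(2)[of "bd f z"] by (simp add: mult.assoc[symmetric])
      then have "bd f z * bdry (\<lambda>z. q (f z)) z * cnj (bd f z) ^ Suc j = bdry (\<lambda>z. q (f z)) z * cnj (bd f z) ^ j"
        by (metis mult.assoc mult.commute)
      then show ?case using elim by (simp only: distrib_right)
    qed
  qed (use bdry_measurable[OF qf] bdry_measurable[OF gf] cm in measurable)
  also have "\<dots> = (\<integral>z. g 0 * cnj (bd f z) ^ Suc j \<partial>circ) + (\<integral>z. bdry (\<lambda>z. q (f z)) z * cnj (bd f z) ^ j \<partial>circ)"
  proof (rule Bochner_Integration.integral_add)
    show "integrable circ (\<lambda>z. g 0 * cnj (bd f z) ^ Suc j)"
      by (rule circ_integrable_bounded[where B = "cmod (g 0)"]) (use cm[of "Suc j"] in \<open>auto simp: norm_mult norm_power simp del: power_Suc\<close>)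
    show "integrable circ (\<lambda>z. bdry (\<lambda>z. q (f z)) z * cnj (bd f z) ^ j)"
      by (rule bdry_bounded_integrable[OF qf, where C = 1]) (auto simp: norm_power)
  qed
  also have "(\<integral>z. g 0 * cnj (bd f z) ^ Suc j \<partial>circ) = g 0 * (\<integral>z. cnj z ^ Suc j \<partial>circ)"
    using bd_integral[OF f circ_cnj_power_measurable(1)[of "Suc j"]] by (simp del: power_Suc)
  also have "\<dots> = 0"
    using circ_cnj_moment(1)[of "Suc j"] by (simp del: power_Suc)
  also have "0 + (\<integral>z. bdry (\<lambda>z. q (f z)) z * cnj (bd f z) ^ j \<partial>circ) = (\<integral>z. bdry q z * cnj z ^ j \<partial>circ)"
    using Suc.IH[OF q(1)] by simp
  also have "\<dots> = (\<integral>z. bdry g z * cnj z ^ Suc j \<partial>circ)"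
    using bdry_coeff_shift[OF Suc.prems q] by simp
  finally show ?case .
qed

text \<open>Let G be \<open>bd g\<close> after \<open>bd f\<close>. The boundary function Y of g(f)
  has the same moments as G against powers of \<open>bd f\<close>, so Y - G is orthogonal to every
  bounded function of \<open>bd f\<close>, in particular to G itself. Then the integral of Y cnj G
  is 1, and |Y| \<le> 1 = |G| forces Y = G almost everywhere.\<close>

lemma bdry_compose_AE:
  assumes f: "disc_inner f" "f 0 = 0" and g: "disc_inner g"
  shows "AE z in circ. bdry (\<lambda>z. g (f z)) z = bd g (bd f z)"
proof -
  note bg = disc_inner_bounded[OF g]
  note gf = bounded_disc_compose[OF bg f(1)]
  \<comment> \<open>\<open>bdry\<close> is bounded by 1 only almost everywhere, while the
    orthogonality principle asks for a bound at every point; the truncation changes a null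
    set.\<close>
  define Y where "Y z = (if cmod (bdry (\<lambda>z. g (f z)) z) \<le> 1 then bdry (\<lambda>z. g (f z)) z else 0)" for z
  have Yb: "cmod (Y z) \<le> 1" for z by (simp add: Y_def)
  have Ym[measurable]: "Y \<in> borel_measurable circ" unfolding Y_def using bdry_measurable[OF gf] by measurable
  have YAE: "AE z in circ. bdry (\<lambda>z. g (f z)) z = Y z"
    using bdry_AE[OF gf] by eventually_elim (simp add: Y_def)
  have fm[measurable]: "bd f \<in> measurable circ circ" by (rule bd_measurable[OF f(1)])
  have gm[measurable]: "bd g \<in> borel_measurable circ" by (rule bd_borel[OF g])
  have gfm[measurable]: "(\<lambda>z. bd g (bd f z)) \<in> borel_measurable circ" by (rule measurable_compose[OF fm gm])
  have orth: "(\<integral>z. (Y z - bd g (bd f z)) * p (bd f z) \<partial>circ) = 0"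
    if p[measurable]: "p \<in> borel_measurable circ" and pb: "\<And>z. cmod z = 1 \<Longrightarrow> cmod (p z) \<le> 1"
      and eq: "(\<integral>z. bdry (\<lambda>z. g (f z)) z * p (bd f z) \<partial>circ) = (\<integral>z. bdry g z * p z \<partial>circ)" for p
  proof -
    have pf[measurable]: "(\<lambda>z. p (bd f z)) \<in> borel_measurable circ" by (rule measurable_compose[OF fm p])
    have i1: "integrable circ (\<lambda>z. Y z * p (bd f z))"
      using pb Yb by (intro circ_integrable_bounded[where B = 1]) (auto simp: norm_mult intro!: mult_le_one)
    have i2: "integrable circ (\<lambda>z. bd g (bd f z) * p (bd f z))"
      using pb by (intro circ_integrable_bounded[where B = 1]) (auto simp: norm_mult)
    have "(\<integral>z. (Y z - bd g (bd f z)) * p (bd f z) \<partial>circ) =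
        (\<integral>z. Y z * p (bd f z) \<partial>circ) - (\<integral>z. bd g (bd f z) * p (bd f z) \<partial>circ)"
      unfolding left_diff_distrib by (rule Bochner_Integration.integral_diff[OF i1 i2])
    also have "(\<integral>z. bd g (bd f z) * p (bd f z) \<partial>circ) = (\<integral>z. bd g z * p z \<partial>circ)"
      by (rule bd_integral[OF f, of "\<lambda>z. bd g z * p z"]) measurable
    also have "\<dots> = (\<integral>z. bdry g z * p z \<partial>circ)"
      by (rule integral_cong_AE) (use bd_AE[OF g] bdry_measurable[OF bg] in \<open>auto elim!: AE_mp\<close>)
    also have "(\<integral>z. Y z * p (bd f z) \<partial>circ) = (\<integral>z. bdry (\<lambda>z. g (f z)) z * p (bd f z) \<partial>circ)"
      by (rule integral_cong_AE) (use YAE bdry_measurable[OF gf] in \<open>auto elim!: AE_mp\<close>)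
    finally show ?thesis using eq by simp
  qed
  have "(\<integral>z. (Y z - bd g (bd f z)) * cnj (bd g (bd f z)) \<partial>circ) = 0"
  proof (rule circ.orthogonal_moments[where G = "bd f" and h = "\<lambda>w. cnj (bd g w)" and B = 2 and C = 1])
    show "cmod (Y z - bd g (bd f z)) \<le> 2" for z
      using norm_triangle_ineq4[of "Y z" "bd g (bd f z)"] Yb[of z] by simp
    show "(\<integral>z. (Y z - bd g (bd f z)) * bd f z ^ j \<partial>circ) = 0" for j
      by (rule orth) (auto simp: norm_power compose_moment_pos[OF bg f])
    show "(\<integral>z. (Y z - bd g (bd f z)) * cnj (bd f z) ^ j \<partial>circ) = 0" for j
      by (rule orth) (auto simp: norm_power compose_moment_neg[OF bg f])
    show "(\<lambda>w. cnj (bd g w)) \<in> borel_measurable circ"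
      by (intro measurable_compose[OF gm] borel_measurable_continuous_onI continuous_intros)
  qed (auto simp: fm)
  also have "(\<lambda>z. (Y z - bd g (bd f z)) * cnj (bd g (bd f z))) = (\<lambda>z. Y z * cnj (bd g (bd f z)) - 1)"
    by (simp add: left_diff_distrib cnj_mult_self_circ)
  finally have zero: "(\<integral>z. Y z * cnj (bd g (bd f z)) - 1 \<partial>circ) = 0" .
  \<comment> \<open>Nonnegative with integral 0, hence 0 almost everywhere; then |Y - G|^2 = |Y|^2 +
    1 - 2 Re(Y cnj G) \<le> 0.\<close>
  define R where "R z = 1 - Re (Y z * cnj (bd g (bd f z)))" for z
  have cm[measurable]: "(\<lambda>z. cnj (bd g (bd f z))) \<in> borel_measurable circ"
    by (intro measurable_compose[OF gfm] borel_measurable_continuous_onI continuous_intros)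
  have nle: "cmod (Y z * cnj (bd g (bd f z))) \<le> 1" for z using Yb[of z] by (simp add: norm_mult)
  have int: "integrable circ (\<lambda>z. Y z * cnj (bd g (bd f z)))"
    using nle by (intro circ_integrable_bounded[where B = 1]) auto
  have R0: "0 \<le> R z" for z using nle[of z] complex_Re_le_cmod[of "Y z * cnj (bd g (bd f z))"] by (simp add: R_def)
  have "(\<integral>z. R z \<partial>circ) = 1 - Re (\<integral>z. Y z * cnj (bd g (bd f z)) \<partial>circ)"
  proof -
    have "integrable circ (\<lambda>z. Re (Y z * cnj (bd g (bd f z))))" by (rule integrable_Re[OF int])
    then have "(\<integral>z. R z \<partial>circ) = 1 - (\<integral>z. Re (Y z * cnj (bd g (bd f z))) \<partial>circ)"
      unfolding R_def by (subst Bochner_Integration.integral_diff) auto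
    then show ?thesis using int by (simp only: integral_Re)
  qed
  also have "\<dots> = 0" using zero int by simp
  finally have "(\<integral>z. R z \<partial>circ) = 0" .
  moreover have "integrable circ R"
    unfolding R_def by (intro Bochner_Integration.integrable_diff integrable_Re[OF int]) simp
  ultimately have "AE z in circ. R z = 0" using R0 by (subst (asm) integral_nonneg_eq_0_iff_AE) auto
  with YAE show ?thesis
  proof eventually_elim
    case (elim z)
    let ?G = "bd g (bd f z)"
    have "(cmod (Y z - ?G))\<^sup>2 = (cmod (Y z))\<^sup>2 + (cmod ?G)\<^sup>2 - 2 * Re (Y z * cnj ?G)"
      unfolding cmod_power2 by (simp add: power2_eq_square algebra_simps)
    also have "\<dots> \<le> 0" using elim Yb[of z] by (simp add: R_def power_le_one)
    finally show ?case using elim by simp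
  qed
qed

lemma disc_inner_compose:
  assumes f: "disc_inner f" "f 0 = 0" and g: "disc_inner g"
  shows "disc_inner (\<lambda>z. g (f z))" "AE z in circ. bd (\<lambda>z. g (f z)) z = bd g (bd f z)"
proof -
  show *: "disc_inner (\<lambda>z. g (f z))"
    unfolding disc_inner_def
  proof (intro conjI)
    show "(\<lambda>z. g (f z)) holomorphic_on ball 0 1"
      using bounded_disc_compose[OF disc_inner_bounded[OF g] f(1)] by (simp add: bounded_disc_def)
    show "(\<lambda>z. g (f z)) ` ball 0 1 \<subseteq> ball 0 1"
      using disc_inner_norm_less[OF g disc_inner_norm_less[OF f(1)]] by auto
    show "AE z in circ. cmod (bdry (\<lambda>z. g (f z)) z) = 1"
      using bdry_compose_AE[OF f g] by eventually_elim simp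
  qed
  show "AE z in circ. bd (\<lambda>z. g (f z)) z = bd g (bd f z)"
    using bd_AE[OF *] bdry_compose_AE[OF f g] by eventually_elim simp
qed

lemma disc_inner_id: "disc_inner (\<lambda>z. z)" "cmod z = 1 \<Longrightarrow> bd (\<lambda>z. z) z = z"
proof -
  have b: "bdry (\<lambda>z. z) z = z" for z using bdry_ident_power[of 1 z] by simp
  show "disc_inner (\<lambda>z. z)" by (auto simp: disc_inner_def b intro: AE_I2)
  show "cmod z = 1 \<Longrightarrow> bd (\<lambda>z. z) z = z" by (simp add: bd_def b)
qed

text \<open>The innermost factor is split off, so that the almost everywhere identity of the
  induction hypothesis is only pulled back along \<open>bd f\<close>, which preserves null
  sets.\<close>

lemma disc_inner_funpow:
  assumes f: "disc_inner f" "f 0 = 0"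
  shows "disc_inner (f ^^ n) \<and> (f ^^ n) 0 = 0 \<and> (AE z in circ. bd (f ^^ n) z = (bd f ^^ n) z)"
proof (induction n)
  case 0
  have "AE z in circ. bd (\<lambda>z. z) z = z" by (rule AE_I2) (simp add: disc_inner_id(2))
  then show ?case using disc_inner_id(1) by (simp add: id_def)
next
  case (Suc n)
  then have IH: "disc_inner (f ^^ n)" "(f ^^ n) 0 = 0" "AE z in circ. bd (f ^^ n) z = (bd f ^^ n) z" by auto
  have e: "f ^^ Suc n = (\<lambda>z. (f ^^ n) (f z))" by (simp add: funpow_Suc_right fun_eq_iff del: funpow.simps)
  have e': "(bd f ^^ Suc n) z = (bd f ^^ n) (bd f z)" for z by (simp add: funpow_Suc_right del: funpow.simps)
  have "AE z in circ. bd (f ^^ Suc n) z = (bd f ^^ Suc n) z"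
    using disc_inner_compose(2)[OF f IH(1)] bd_AE_compose[OF f IH(3)]
    unfolding e[symmetric] by eventually_elim (simp only: e')
  moreover have "disc_inner (f ^^ Suc n)" using disc_inner_compose(1)[OF f IH(1)] by (simp only: e)
  moreover have "(f ^^ Suc n) 0 = 0" using IH(2) f(2) by (simp add: e del: funpow.simps)
  ultimately show ?case by blast
qed

section \<open>Mixing and the zero-one law\<close>

text \<open>Equality at any point of Schwarz's lemma, or for the derivative at 0, would make f a
  rotation.\<close>

lemma schwarz_factor:
  assumes f: "disc_inner f" "f 0 = 0" "\<not> disc_rotation f"
  obtains q where "q holomorphic_on ball 0 1" "\<And>z. cmod z < 1 \<Longrightarrow> f z = z * q z" "\<And>z. cmod z < 1 \<Longrightarrow> cmod (q z) < 1"
proof -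
  have hol: "f holomorphic_on ball 0 1" using f(1) by (simp add: disc_inner_def)
  have less: "\<And>z. cmod z < 1 \<Longrightarrow> cmod (f z) < 1" by (rule disc_inner_norm_less[OF f(1)])
  have w: "cmod 0 < 1" by simp
  obtain q where q: "q holomorphic_on ball 0 1" "\<And>z. cmod z < 1 \<Longrightarrow> f z = z * q z" "deriv f 0 = q 0"
    by (rule Schwarz3[OF hol f(2)]) auto
  have norot: "\<not> ((\<exists>z. norm z < 1 \<and> z \<noteq> 0 \<and> norm (f z) = norm z) \<or> norm (deriv f 0) = 1)"
  proof
    assume "(\<exists>z. norm z < 1 \<and> z \<noteq> 0 \<and> norm (f z) = norm z) \<or> norm (deriv f 0) = 1"
    from Schwarz_Lemma(3)[OF hol f(2) less w this] f(3) show False by (auto simp: disc_rotation_def)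
  qed
  have "cmod (q z) < 1" if z: "cmod z < 1" for z
  proof (cases "z = 0")
    case True
    then show ?thesis using Schwarz_Lemma(2)[OF hol f(2) less w] norot q(3) by force
  next
    case False
    have "cmod (f z) \<noteq> cmod z" using norot z False by blast
    with Schwarz_Lemma(1)[OF hol f(2) less z] have "cmod (f z) < cmod z" by simp
    then show ?thesis using q(2)[OF z] False by (simp add: norm_mult)
  qed
  with q(1,2) show ?thesis using that by blast
qed

text \<open>The orbit stays in the closed disc of radius |w|. On it |q| has a maximum \<rho> < 1 by
  compactness, so every step contracts by the factor \<rho>.\<close>

lemma iterates_tendsto_zero:
  assumes f: "disc_inner f" "f 0 = 0" "\<not> disc_rotation f" and w: "cmod w < 1"
  shows "(\<lambda>n. (f ^^ n) w) \<longlonglongrightarrow> 0"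
proof -
  obtain q where q: "q holomorphic_on ball 0 1" "\<And>z. cmod z < 1 \<Longrightarrow> f z = z * q z"
    and q1: "\<And>z. cmod z < 1 \<Longrightarrow> cmod (q z) < 1"
    using schwarz_factor[OF f] by blast
  have "continuous_on (cball 0 (cmod w)) (\<lambda>z. cmod (q z))"
    using w by (intro continuous_on_norm continuous_on_subset[OF holomorphic_on_imp_continuous_on[OF q(1)]]) auto
  moreover have "compact (cball 0 (cmod w) :: complex set)" "cball 0 (cmod w) \<noteq> ({} :: complex set)" by auto
  ultimately obtain x where x: "x \<in> cball 0 (cmod w)" "\<And>z. z \<in> cball 0 (cmod w) \<Longrightarrow> cmod (q z) \<le> cmod (q x)"
    using continuous_attains_sup[of "cball 0 (cmod w)" "\<lambda>z. cmod (q z)"] by metis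
  define \<rho> where "\<rho> = cmod (q x)"
  have \<rho>: "0 \<le> \<rho>" "\<rho> < 1" using q1[of x] x(1) w by (auto simp: \<rho>_def)
  have b: "cmod ((f ^^ n) w) \<le> \<rho> ^ n * cmod w" for n
  proof (induction n)
    case (Suc n)
    have "\<rho> ^ n * cmod w \<le> 1 * cmod w" using \<rho> by (intro mult_right_mono power_le_one) auto
    then have le: "cmod ((f ^^ n) w) \<le> cmod w" using Suc by simp
    have "cmod ((f ^^ Suc n) w) = cmod ((f ^^ n) w) * cmod (q ((f ^^ n) w))"
      using q(2)[of "(f ^^ n) w"] le w by (simp add: norm_mult)
    also have "\<dots> \<le> (\<rho> ^ n * cmod w) * \<rho>"
      using Suc x(2)[of "(f ^^ n) w"] le \<rho> by (intro mult_mono) (auto simp: \<rho>_def)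
    finally show ?case by (simp add: mult_ac)
  qed simp
  have lim: "(\<lambda>n. \<rho> ^ n * cmod w) \<longlonglongrightarrow> 0"
    by (intro tendsto_mult_left_zero LIMSEQ_realpow_zero \<rho>)
  show ?thesis by (rule Lim_null_comparison[OF _ lim]) (use b in simp)
qed

text \<open>Since g has a zero at the origin, g^j has one of order at least j.\<close>

lemma bd_coeff_vanish:
  assumes g: "disc_inner g" "g 0 = 0" and "k < j"
  shows "(\<integral>z. bd g z ^ j * cnj z ^ k \<partial>circ) = 0"
proof -
  obtain q C where q: "bounded_disc q C" "\<And>z. cmod z < 1 \<Longrightarrow> g z = g 0 + z * q z"
    using bounded_disc_divide[OF disc_inner_bounded[OF g(1)]] by blast
  have q': "\<And>z. cmod z < 1 \<Longrightarrow> g z = 0 + z * q z" using q(2) g(2) by simp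
  note qj = bounded_disc_power[OF q(1), of j]
  have "(\<integral>z. bd g z ^ j * cnj z ^ k \<partial>circ) = (\<integral>z. bdry (\<lambda>z. q z ^ j) z * z ^ (j - k) \<partial>circ)"
  proof (rule integral_cong_AE)
    have "AE z in circ. bdry g z = 0 + z * bdry q z" by (rule bdry_divide_AE[OF q(1) q'])
    then show "AE z in circ. bd g z ^ j * cnj z ^ k = bdry (\<lambda>z. q z ^ j) z * z ^ (j - k)"
      using bd_AE[OF g(1)] bdry_power_AE[OF q(1), of j] AE_space
    proof eventually_elim
      case (elim z)
      have "z ^ j * cnj z ^ k = z ^ (j - k)" using monomial_unimodular[of z j k] elim assms(3) by simp
      then show ?case using elim by (simp add: power_mult_distrib mult_ac)
    qed
  qed (use bd_borel[OF g(1)] bdry_measurable[OF qj] in measurable)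
  then show ?thesis using bdry_integral_power[OF qj, of "j - k"] assms(3) by simp
qed

lemma integrable_sphere_bounded_mult:
  fixes p h :: "complex \<Rightarrow> complex"
  assumes "p \<in> borel_measurable circ" "h \<in> borel_measurable circ"
    and "\<And>z. cmod z = 1 \<Longrightarrow> cmod (p z) \<le> B" "\<And>z. cmod z = 1 \<Longrightarrow> cmod (h z) \<le> C"
  shows "integrable circ (\<lambda>z. p z * h z)"
proof (rule circ_integrable_bounded[where B = "B * C"])
  show "norm (p z * h z) \<le> B * C" if "cmod z = 1" for z
    using assms(3,4)[OF that] order_trans[OF norm_ge_zero assms(3)[OF that]]
    by (auto simp: norm_mult intro!: mult_mono)
qed (use assms in measurable)

text \<open>The conditional expectation of z^k given \<open>bd g\<close> is a polynomial of degree
  at most k in \<open>bd g\<close> without constant term. Against powers of \<open>bd g\<close> both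
  sides integrate to 0, being analytic and zero at the origin; against conjugate powers the
  coefficients agree by definition, those of index 0 or above k being zero.\<close>

lemma power_projection:
  assumes g: "disc_inner g" "g 0 = 0" and k: "1 \<le> k"
    and h: "h \<in> borel_measurable circ" "\<And>z. cmod z = 1 \<Longrightarrow> cmod (h z) \<le> C"
  shows "(\<integral>z. z ^ k * h (bd g z) \<partial>circ) =
    (\<Sum>j=1..k. cnj (\<integral>z. bd g z ^ j * cnj z ^ k \<partial>circ) * (\<integral>z. z ^ j * h z \<partial>circ))"
proof -
  define \<gamma> where "\<gamma> j = (\<integral>z. bd g z ^ j * cnj z ^ k \<partial>circ)" for j
  define S where "S z = (\<Sum>j=1..k. cnj (\<gamma> j) * bd g z ^ j)" for z
  note gm = bd_measurable[OF g(1)]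
  have gb[measurable]: "bd g \<in> borel_measurable circ" by (rule bd_borel[OF g(1)])
  have gp[measurable]: "(\<lambda>z. bd g z ^ j) \<in> borel_measurable circ" "(\<lambda>z. cnj (bd g z) ^ j) \<in> borel_measurable circ" for j
    by (rule measurable_compose[OF gm circ_cnj_power_measurable(2)])
      (rule measurable_compose[OF gm circ_cnj_power_measurable(1)])
  have Sm[measurable]: "S \<in> borel_measurable circ" unfolding S_def by measurable
  have Sb: "cmod (S z) \<le> (\<Sum>j=1..k. cmod (\<gamma> j))" for z
    unfolding S_def by (rule sum_norm_le) (simp add: norm_mult norm_power)
  have split: "(\<integral>z. (z ^ k - S z) * p (bd g z) \<partial>circ) =
      (\<integral>z. z ^ k * p (bd g z) \<partial>circ) - (\<Sum>j=1..k. cnj (\<gamma> j) * (\<integral>z. z ^ j * p z \<partial>circ))"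
    if p[measurable]: "p \<in> borel_measurable circ" and pb: "\<And>z. cmod z = 1 \<Longrightarrow> cmod (p z) \<le> C'" for p C'
  proof -
    have pg: "(\<lambda>z. p (bd g z)) \<in> borel_measurable circ" by (rule measurable_compose[OF gm p])
    have i1: "integrable circ (\<lambda>z. z ^ k * p (bd g z))"
      by (rule integrable_sphere_bounded_mult[OF _ pg, where B = 1 and C = C']) (auto simp: norm_power pb)
    have i2: "integrable circ (\<lambda>z. bd g z ^ j * p (bd g z))" for j
      by (rule integrable_sphere_bounded_mult[OF _ pg, where B = 1 and C = C']) (auto simp: norm_power pb)
    have e: "(\<integral>z. bd g z ^ j * p (bd g z) \<partial>circ) = (\<integral>z. z ^ j * p z \<partial>circ)" for j
      by (rule bd_integral[OF g, of "\<lambda>z. z ^ j * p z"]) measurable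
    have "(\<integral>z. (z ^ k - S z) * p (bd g z) \<partial>circ) =
      (\<integral>z. z ^ k * p (bd g z) - (\<Sum>j=1..k. cnj (\<gamma> j) * (bd g z ^ j * p (bd g z))) \<partial>circ)"
      by (simp add: S_def left_diff_distrib sum_distrib_right mult.assoc)
    also have "\<dots> = (\<integral>z. z ^ k * p (bd g z) \<partial>circ) - (\<Sum>j=1..k. cnj (\<gamma> j) * (\<integral>z. z ^ j * p z \<partial>circ))"
      using i1 i2 by (subst Bochner_Integration.integral_diff) (auto simp: e Bochner_Integration.integral_sum)
    finally show ?thesis .
  qed
  have "(\<integral>z. (z ^ k - S z) * h (bd g z) \<partial>circ) = 0"
  proof (rule circ.orthogonal_moments[where G = "bd g" and h = h and B = "1 + (\<Sum>j=1..k. cmod (\<gamma> j))" and C = C])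
    show "cmod (z ^ k - S z) \<le> 1 + (\<Sum>j=1..k. cmod (\<gamma> j))" if "z \<in> space circ" for z
      using norm_triangle_ineq4[of "z ^ k" "S z"] Sb[of z] that by (simp add: norm_power)
    fix i
    have mom: "(\<integral>z. z ^ a * z ^ i \<partial>circ) = of_bool (a = 0 \<and> i = 0)" for a
      using circ_cnj_moment(2)[of "a + i"] by (simp add: power_add)
    have "(\<integral>z. z ^ k * bd g z ^ i \<partial>circ) = (\<integral>z. bdry (\<lambda>z. g z ^ i) z * z ^ k \<partial>circ)"
    proof (rule integral_cong_AE)
      show "AE z in circ. z ^ k * bd g z ^ i = bdry (\<lambda>z. g z ^ i) z * z ^ k"
        using bd_AE[OF g(1)] bdry_power_AE[OF disc_inner_bounded[OF g(1)], of i] by eventually_elim simp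
    qed (use bdry_measurable[OF bounded_disc_power[OF disc_inner_bounded[OF g(1)], of i]] in measurable)
    also have "\<dots> = 0"
      using bdry_integral_power[OF bounded_disc_power[OF disc_inner_bounded[OF g(1)], of i], of k] k by simp
    finally show "(\<integral>z. (z ^ k - S z) * bd g z ^ i \<partial>circ) = 0"
      using split[of "\<lambda>z. z ^ i" 1] by (simp add: norm_power mom)
    have "(\<integral>z. z ^ k * cnj (bd g z) ^ i \<partial>circ) = (\<integral>z. cnj (bd g z ^ i * cnj z ^ k) \<partial>circ)"
      by (simp add: mult.commute)
    also have "\<dots> = cnj (\<gamma> i)" unfolding \<gamma>_def by (rule Bochner_Integration.integral_cnj)
    finally have neg: "(\<integral>z. z ^ k * cnj (bd g z) ^ i \<partial>circ) = cnj (\<gamma> i)" .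
    have "(\<Sum>j=1..k. cnj (\<gamma> j) * (\<integral>z. z ^ j * cnj z ^ i \<partial>circ)) = (\<Sum>j=1..k. if j = i then cnj (\<gamma> j) else 0)"
      by (intro sum.cong) (auto simp: circ_moment)
    also have "\<dots> = cnj (\<gamma> i)"
    proof (cases "i \<in> {1..k}")
      case False
      then consider "i = 0" | "k < i" by fastforce
      then have "\<gamma> i = 0"
      proof cases
        case 1
        then show ?thesis using circ_cnj_moment(1)[of k] k by (simp add: \<gamma>_def)
      qed (simp add: \<gamma>_def bd_coeff_vanish[OF g])
      then show ?thesis using False by (auto simp: sum.delta)
    qed (simp add: sum.delta)
    finally show "(\<integral>z. (z ^ k - S z) * cnj (bd g z) ^ i \<partial>circ) = 0"
      using split[of "\<lambda>z. cnj z ^ i" 1] neg by (simp add: norm_power)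
  qed (use h gm in auto)
  then show ?thesis using split[OF h] by (simp add: \<gamma>_def)
qed

text \<open>On the circle of radius 1/2 the iterates tend to 0 pointwise and boundedly. The
  coefficients there are 2^(-k) times the boundary coefficients, a factor that does not depend on
  n.\<close>

lemma coeff_iterates_tendsto_zero:
  assumes f: "disc_inner f" "f 0 = 0" "\<not> disc_rotation f" and j: "1 \<le> j"
  shows "(\<lambda>n. \<integral>z. bd (f ^^ n) z ^ j * cnj z ^ k \<partial>circ) \<longlonglongrightarrow> 0"
proof -
  have fn: "disc_inner (f ^^ n)" for n using disc_inner_funpow[OF f(1,2)] by blast
  note b = bounded_disc_power[OF disc_inner_bounded[OF fn], of _ j]
  have "(\<lambda>n. \<integral>z. (f ^^ n) (of_real (1/2) * z) ^ j * cnj z ^ k \<partial>circ) \<longlonglongrightarrow> (\<integral>z. 0 \<partial>circ)"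
  proof (rule integral_dominated_convergence[where w = "\<lambda>_. 1"])
    show "AE z in circ. (\<lambda>n. (f ^^ n) (of_real (1/2) * z) ^ j * cnj z ^ k) \<longlonglongrightarrow> 0"
    proof (rule AE_I2)
      fix z assume "z \<in> space circ"
      then have "cmod (of_real (1/2) * z) < 1" by (intro in_ball_dilate) auto
      then have "(\<lambda>n. (f ^^ n) (of_real (1/2) * z) ^ j * cnj z ^ k) \<longlonglongrightarrow> 0 ^ j * cnj z ^ k"
        by (intro tendsto_intros iterates_tendsto_zero f)
      then show "(\<lambda>n. (f ^^ n) (of_real (1/2) * z) ^ j * cnj z ^ k) \<longlonglongrightarrow> 0" using j by (simp add: zero_power)
    qed
    show "(\<lambda>z. (f ^^ n) (of_real (1/2) * z) ^ j * cnj z ^ k) \<in> borel_measurable circ" for n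
      using bounded_disc_dilate(3)[OF b, of "1/2" n] by measurable
    show "AE z in circ. norm ((f ^^ n) (of_real (1/2) * z) ^ j * cnj z ^ k) \<le> 1" for n
      using bounded_disc_dilate(4)[OF b, of "1/2" _ n] by (intro AE_I2) (auto simp: norm_mult norm_power)
  qed auto
  moreover have "(\<integral>z. (f ^^ n) (of_real (1/2) * z) ^ j * cnj z ^ k \<partial>circ) =
      of_real (1/2) ^ k * (\<integral>z. bd (f ^^ n) z ^ j * cnj z ^ k \<partial>circ)" for n
  proof -
    have "(\<integral>z. (f ^^ n) (of_real (1/2) * z) ^ j * cnj z ^ k \<partial>circ) =
      of_real (1/2) ^ k * (\<integral>z. bdry (\<lambda>z. (f ^^ n) z ^ j) z * cnj z ^ k \<partial>circ)"
      by (rule bdry_coeff_interior[OF b]) auto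
    also have "(\<integral>z. bdry (\<lambda>z. (f ^^ n) z ^ j) z * cnj z ^ k \<partial>circ) = (\<integral>z. bd (f ^^ n) z ^ j * cnj z ^ k \<partial>circ)"
    proof (rule integral_cong_AE)
      show "AE z in circ. bdry (\<lambda>z. (f ^^ n) z ^ j) z * cnj z ^ k = bd (f ^^ n) z ^ j * cnj z ^ k"
        using bd_AE[OF fn, of n] bdry_power_AE[OF disc_inner_bounded[OF fn], of n j] by eventually_elim simp
    qed (use bdry_measurable[OF b, of n] bd_borel[OF fn, of n] in measurable)
    finally show ?thesis .
  qed
  ultimately have "(\<lambda>n. 2 ^ k * (of_real (1/2) ^ k * (\<integral>z. bd (f ^^ n) z ^ j * cnj z ^ k \<partial>circ))) \<longlonglongrightarrow> 2 ^ k * 0"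
    by (intro tendsto_intros) simp
  then show ?thesis by (simp add: power_divide)
qed

lemma funpow_bd_measurable: "disc_inner f \<Longrightarrow> (bd f ^^ n) \<in> measurable circ circ"
proof (induction n)
  case (Suc n)
  then show ?case using measurable_comp[OF Suc.IH bd_measurable] by (simp add: o_def)
qed (simp add: id_def)

text \<open>For a tail set A the k-th coefficient of its indicator is, for each n, a sum of at most
  k terms bounded by coefficients of powers of f^n, so it vanishes for k \<ge> 1. An indicator with
  only a constant coefficient is almost everywhere constant.\<close>

lemma zero_one_law:
  assumes f: "disc_inner f" "f 0 = 0" "\<not> disc_rotation f"
    and A: "A \<in> sets circ" "\<And>n. \<exists>A'\<in>sets circ. \<forall>z\<in>sphere 0 1. z \<in> A \<longleftrightarrow> (bd f ^^ n) z \<in> A'"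
  shows "measure circ A = 0 \<or> measure circ A = 1"
proof -
  define p where "p = measure circ A"
  have ind[measurable]: "(\<lambda>z. indicator A z :: complex) \<in> borel_measurable circ" using A(1) by measurable
  have ib: "cmod (indicator A z) \<le> 1" for A :: "complex set" and z by (simp add: indicator_def)
  have pos: "(\<integral>z. z ^ k * indicator A z \<partial>circ) = 0" if k: "1 \<le> k" for k
  proof -
    define \<gamma> where "\<gamma> n j = (\<integral>z. bd (f ^^ n) z ^ j * cnj z ^ k \<partial>circ)" for n j
    have "cmod (\<integral>z. z ^ k * indicator A z \<partial>circ) \<le> (\<Sum>j=1..k. cmod (\<gamma> n j))" for n
    proof -
      obtain A' where A': "A' \<in> sets circ" "\<forall>z\<in>sphere 0 1. z \<in> A \<longleftrightarrow> (bd f ^^ n) z \<in> A'" using A(2) by blast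
      note fn = disc_inner_funpow[OF f(1,2), of n]
      have m[measurable]: "(\<lambda>z. indicator A' z :: complex) \<in> borel_measurable circ" using A'(1) by measurable
      have "(\<lambda>z. indicator A' (bd (f ^^ n) z) :: complex) \<in> borel_measurable circ"
        by (rule measurable_compose[OF bd_measurable m]) (use fn in simp)
      note [measurable] = this
      have "(\<integral>z. z ^ k * indicator A z \<partial>circ) = (\<integral>z. z ^ k * indicator A' (bd (f ^^ n) z) \<partial>circ)"
      proof (rule integral_cong_AE)
        have "AE z in circ. bd (f ^^ n) z = (bd f ^^ n) z" using fn by blast
        then show "AE z in circ. z ^ k * indicator A z = z ^ k * indicator A' (bd (f ^^ n) z)"
          using AE_space by eventually_elim (use A'(2) in \<open>auto simp: indicator_def\<close>)
      qed measurable
      also have "\<dots> = (\<Sum>j=1..k. cnj (\<gamma> n j) * (\<integral>z. z ^ j * indicator A' z \<partial>circ))"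
        unfolding \<gamma>_def by (rule power_projection[OF _ _ k m ib]) (use fn in auto)
      also have "cmod \<dots> \<le> (\<Sum>j=1..k. cmod (\<gamma> n j))"
      proof (rule sum_norm_le)
        fix j
        have "cmod (\<integral>z. z ^ j * indicator A' z \<partial>circ) \<le> (\<integral>z. 1 \<partial>circ)"
          by (intro Bochner_Integration.integral_norm_bound[THEN order_trans] integral_mono
              integrable_norm integrable_sphere_bounded_mult[where B = 1 and C = 1] m)
            (auto simp: norm_mult norm_power indicator_def)
        then show "cmod (cnj (\<gamma> n j) * (\<integral>z. z ^ j * indicator A' z \<partial>circ)) \<le> cmod (\<gamma> n j)"
          by (simp add: norm_mult mult_left_le)
      qed
      finally show ?thesis .
    qed
    moreover have "(\<lambda>n. \<Sum>j=1..k. cmod (\<gamma> n j)) \<longlonglongrightarrow> (\<Sum>j=1..k. 0)"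
      unfolding \<gamma>_def by (intro tendsto_sum tendsto_norm_zero coeff_iterates_tendsto_zero f) simp
    ultimately have "cmod (\<integral>z. z ^ k * indicator A z \<partial>circ) \<le> (\<Sum>j=1..k. 0)"
      by (intro LIMSEQ_le_const) auto
    then show ?thesis by simp
  qed
  have neg: "(\<integral>z. cnj z ^ k * indicator A z \<partial>circ) = 0" if k: "1 \<le> k" for k
  proof -
    have "(\<integral>z. cnj z ^ k * indicator A z \<partial>circ) = (\<integral>z. cnj (z ^ k * indicator A z) \<partial>circ)"
      by (rule Bochner_Integration.integral_cong) (auto simp: indicator_def)
    also have "\<dots> = cnj (\<integral>z. z ^ k * indicator A z \<partial>circ)" by (rule Bochner_Integration.integral_cnj)
    finally show ?thesis using pos[OF k] by simp
  qed
  have p: "(\<integral>z. indicator A z \<partial>circ) = complex_of_real p"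
  proof -
    have "(\<lambda>z. indicator A z :: complex) = (\<lambda>z. complex_of_real (indicator A z))"
      by (auto simp: indicator_def)
    then have "(\<integral>z. indicator A z \<partial>circ) = complex_of_real (\<integral>z. indicator A z \<partial>circ)"
      by (simp only: integral_complex_of_real)
    also have "(\<integral>z. indicator A z \<partial>circ) = p"
      using sets.sets_into_space[OF A(1)] by (simp add: p_def Int_absorb2)
    finally show ?thesis .
  qed
  have K: "(\<integral>z. (indicator A z - complex_of_real p) * h z \<partial>circ) = (\<integral>z. h z * indicator A z \<partial>circ) - of_real p * (\<integral>z. h z \<partial>circ)"
    if "h \<in> borel_measurable circ" "\<And>z. cmod z = 1 \<Longrightarrow> cmod (h z) \<le> 1" for h
  proof -
    have "integrable circ (\<lambda>z. h z * indicator A z)" "integrable circ h"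
      using that by (intro integrable_sphere_bounded_mult[where B = 1 and C = 1] ind ib circ_integrable_bounded[where B = 1]; simp)+
    moreover have "(\<integral>z. (indicator A z - complex_of_real p) * h z \<partial>circ) = (\<integral>z. h z * indicator A z - of_real p * h z \<partial>circ)"
      by (simp add: algebra_simps)
    ultimately show ?thesis by simp
  qed
  \<comment> \<open>All moments of the indicator minus p vanish, so it is orthogonal to the
    indicator itself, that is p = p^2.\<close>
  have "(\<integral>z. (indicator A z - complex_of_real p) * indicator A z \<partial>circ) = 0"
  proof (rule circ.orthogonal_moments[where G = "\<lambda>z. z" and B = "1 + \<bar>p\<bar>" and C = 1])
    show "cmod (indicator A z - complex_of_real p) \<le> 1 + \<bar>p\<bar>" for z
      using norm_triangle_ineq4[of "indicator A z" "complex_of_real p"] ib[of A z] by simp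
    show "(\<integral>z. (indicator A z - complex_of_real p) * z ^ j \<partial>circ) = 0" for j
      using K[of "\<lambda>z. z ^ j"] pos[of j] circ_cnj_moment(2)[of j] p by (cases "j = 0") (auto simp: norm_power)
    show "(\<integral>z. (indicator A z - complex_of_real p) * cnj z ^ j \<partial>circ) = 0" for j
      using K[of "\<lambda>z. cnj z ^ j"] neg[of j] circ_cnj_moment(1)[of j] p by (cases "j = 0") (auto simp: norm_power)
  qed (use ind ib in auto)
  also have "(\<integral>z. (indicator A z - complex_of_real p) * indicator A z \<partial>circ) = of_real (p - p * p)"
    using K[OF ind ib] p by (simp add: indicator_inter_arith[symmetric])
  finally have "complex_of_real (p - p * p) = 0" .
  then have "p * (1 - p) = 0" by (simp only: of_real_eq_0_iff) (simp add: algebra_simps)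
  then show ?thesis by (auto simp: p_def)
qed

section \<open>Reverse martingale differences\<close>

text \<open>Expand the square of |A|^2 + 2t + |B|^2 with t = Re(A cnj B). The term |A|^2 t is kept
  exactly because it integrates to 0 for martingale differences; t^2 is bounded by |A|^2 |B|^2, and
  |B|^2 t through 2|A||B| \<le> |A|^2 + |B|^2.\<close>

lemma norm_add_fourth_power:
  fixes A B :: complex
  shows "cmod (A + B) ^ 4 \<le> cmod A ^ 4 + 8 * ((cmod A)\<^sup>2 * (cmod B)\<^sup>2) + 3 * cmod B ^ 4 + 4 * Re ((cmod A)\<^sup>2 * A * cnj B)"
proof -
  define a b t where "a = cmod A" and "b = cmod B" and "t = Re (A * cnj B)"
  have sq: "(cmod (A + B))\<^sup>2 = a\<^sup>2 + 2 * t + b\<^sup>2"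
    unfolding a_def b_def t_def cmod_power2 by (simp add: power2_eq_square algebra_simps)
  have t: "\<bar>t\<bar> \<le> a * b"
    using abs_Re_le_cmod[of "A * cnj B"] by (simp add: a_def b_def t_def norm_mult)
  have a: "0 \<le> a" "0 \<le> b" by (auto simp: a_def b_def)
  have t2: "t\<^sup>2 \<le> a\<^sup>2 * b\<^sup>2" using power_mono[OF t, of 2] by (simp add: power_mult_distrib)
  have "b\<^sup>2 * t \<le> b\<^sup>2 * (a * b)" using t by (intro mult_left_mono) auto
  moreover have "2 * (b\<^sup>2 * (a * b)) \<le> b\<^sup>2 * (a\<^sup>2 + b\<^sup>2)"
    using mult_left_mono[OF sum_squares_bound[of a b], of "b\<^sup>2"] by (simp add: mult_ac)
  ultimately have bt: "4 * (b\<^sup>2 * t) \<le> 2 * (a\<^sup>2 * b\<^sup>2) + 2 * (b\<^sup>2 * b\<^sup>2)" by (simp add: algebra_simps)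
  have "cmod (A + B) ^ 4 = (a\<^sup>2 + 2 * t + b\<^sup>2)\<^sup>2" unfolding sq[symmetric] by simp
  also have "\<dots> = a\<^sup>2 * a\<^sup>2 + 4 * t\<^sup>2 + b\<^sup>2 * b\<^sup>2 + 4 * (a\<^sup>2 * t) + 2 * (a\<^sup>2 * b\<^sup>2) + 4 * (b\<^sup>2 * t)"
    by (simp add: power2_eq_square algebra_simps)
  also have "\<dots> \<le> a\<^sup>2 * a\<^sup>2 + 8 * (a\<^sup>2 * b\<^sup>2) + 3 * (b\<^sup>2 * b\<^sup>2) + 4 * (a\<^sup>2 * t)" using t2 bt by linarith
  also have "a\<^sup>2 * t = Re ((cmod A)\<^sup>2 * A * cnj B)"
    by (simp add: t_def a_def algebra_simps)
  finally show ?thesis by (simp add: a_def b_def power2_eq_square power4_eq_xxxx mult_ac)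
qed

text \<open>The properties of the boundary map that the probabilistic part needs.
  \<open>orth\<close> expresses that the conditional expectation of x given T is \<beta> times x
  after T, again tested against bounded functions.\<close>

locale reverse_martingale_shift = prob_space M for M :: "'a measure" +
  fixes T :: "'a \<Rightarrow> 'a" and x :: "'a \<Rightarrow> complex" and \<beta> :: complex
  assumes T[measurable]: "T \<in> measurable M M" and T_distr: "distr M M T = M"
    and x[measurable]: "x \<in> borel_measurable M" and norm_x: "\<And>z. z \<in> space M \<Longrightarrow> cmod (x z) = 1"
    and \<beta>: "cmod \<beta> < 1"
    and orth: "\<And>h C. h \<in> borel_measurable M \<Longrightarrow> (\<And>z. z \<in> space M \<Longrightarrow> cmod (h z) \<le> C) \<Longrightarrow>
      (\<integral>z. (x z - \<beta> * x (T z)) * h (T z) \<partial>M) = 0"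
begin

definition D :: "'a \<Rightarrow> complex" where "D z = x z - \<beta> * x (T z)"

lemma T_space: "z \<in> space M \<Longrightarrow> T z \<in> space M"
  by (rule measurable_space[OF T])

lemma xT[measurable]: "(\<lambda>z. x (T z)) \<in> borel_measurable M"
  by (rule measurable_compose[OF T x])

lemma D_measurable[measurable]: "D \<in> borel_measurable M"
  unfolding D_def by measurable

lemma D_bound: "z \<in> space M \<Longrightarrow> cmod (D z) \<le> 2"
  using norm_triangle_ineq4[of "x z" "\<beta> * x (T z)"] \<beta> norm_x T_space
  by (auto simp: D_def norm_mult)

text \<open>All functions met below are bounded and measurable; this class is closed under the
  operations in use and makes integrability automatic.\<close>

definition bm :: "('a \<Rightarrow> complex) \<Rightarrow> bool" where
  "bm h \<longleftrightarrow> h \<in> borel_measurable M \<and> (\<exists>C. \<forall>z\<in>space M. cmod (h z) \<le> C)"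

lemma bmI: "h \<in> borel_measurable M \<Longrightarrow> (\<And>z. z \<in> space M \<Longrightarrow> cmod (h z) \<le> C) \<Longrightarrow> bm h"
  by (auto simp: bm_def)

lemma bm_measurable: "bm h \<Longrightarrow> h \<in> borel_measurable M"
  by (simp add: bm_def)

lemma bm_integrable: "bm h \<Longrightarrow> integrable M h"
  unfolding bm_def by (auto intro: integrable_const_bound AE_I2)

lemma bm_mult: assumes "bm g" "bm h" shows "bm (\<lambda>z. g z * h z)"
proof -
  obtain B C where BC: "\<And>z. z \<in> space M \<Longrightarrow> cmod (g z) \<le> B" "\<And>z. z \<in> space M \<Longrightarrow> cmod (h z) \<le> C"
    using assms by (auto simp: bm_def)
  have "cmod (g z * h z) \<le> \<bar>B\<bar> * \<bar>C\<bar>" if "z \<in> space M" for z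
    unfolding norm_mult
    by (intro mult_mono order_trans[OF BC(1)[OF that]] order_trans[OF BC(2)[OF that]]) auto
  then show ?thesis using assms by (intro bmI[where C = "\<bar>B\<bar> * \<bar>C\<bar>"]) (auto simp: bm_def)
qed

lemma bm_add: assumes "bm g" "bm h" shows "bm (\<lambda>z. g z + h z)"
proof -
  obtain B C where "\<And>z. z \<in> space M \<Longrightarrow> cmod (g z) \<le> B" "\<And>z. z \<in> space M \<Longrightarrow> cmod (h z) \<le> C"
    using assms by (auto simp: bm_def)
  then have "cmod (g z + h z) \<le> B + C" if "z \<in> space M" for z
    using that norm_triangle_le add_mono by blast
  then show ?thesis using assms by (intro bmI[where C = "B + C"]) (auto simp: bm_def)
qed

lemma bm_const: "bm (\<lambda>z. c)" by (rule bmI[where C = "cmod c"]) auto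

lemma bm_cnj: "bm h \<Longrightarrow> bm (\<lambda>z. cnj (h z))"
proof -
  assume h: "bm h"
  then have [measurable]: "h \<in> borel_measurable M" by (simp add: bm_def)
  have "(\<lambda>z. cnj (h z)) \<in> borel_measurable M"
    by (intro measurable_compose[of h M borel cnj] borel_measurable_continuous_onI continuous_intros) measurable
  with h show ?thesis by (auto simp: bm_def)
qed

lemma bm_norm: "bm h \<Longrightarrow> bm (\<lambda>z. of_real (cmod (h z)))"
  by (auto simp: bm_def)

lemma bm_T: "bm h \<Longrightarrow> bm (\<lambda>z. h (T z))"
  unfolding bm_def using T_space measurable_compose[OF T, of h borel] by blast

lemma bm_D: "bm D" by (rule bmI[where C = 2]) (auto intro: D_bound)

lemma bm_x: "bm x" by (rule bmI[where C = 1]) (auto simp: norm_x)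

lemma integral_T:
  fixes h :: "'a \<Rightarrow> 'b::{banach, second_countable_topology}"
  shows "h \<in> borel_measurable M \<Longrightarrow> (\<integral>z. h (T z) \<partial>M) = (\<integral>z. h z \<partial>M)"
  using integral_distr[OF T, of h] by (simp add: T_distr)

lemma orth_D: "bm h \<Longrightarrow> (\<integral>z. D z * h (T z) \<partial>M) = 0"
  unfolding D_def bm_def using orth by blast

lemma bm_real_integrable: "bm h \<Longrightarrow> integrable M (\<lambda>z. cmod (h z) ^ n)"
proof -
  assume h: "bm h"
  then obtain C where C: "\<And>z. z \<in> space M \<Longrightarrow> cmod (h z) \<le> C" by (auto simp: bm_def)
  have [measurable]: "h \<in> borel_measurable M" using h by (rule bm_measurable)
  show ?thesis
    by (rule integrable_const_bound[where B = "C ^ n"]) (auto intro!: AE_I2 power_mono C)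
qed

lemma integral_norm2_cnj:
  assumes "bm h"
  shows "complex_of_real (\<integral>z. (cmod (h z))\<^sup>2 \<partial>M) = (\<integral>z. h z * cnj (h z) \<partial>M)"
  by (simp only: integral_complex_of_real[symmetric] complex_norm_square)

section \<open>Second and fourth moments of martingale sums\<close>

definition \<theta> :: real where "\<theta> = 1 - (cmod \<beta>)\<^sup>2"

lemma \<theta>: "0 < \<theta>" "\<theta> \<le> 1"
  using \<beta> by (auto simp: \<theta>_def abs_square_less_1)

text \<open>Testing \<open>orth\<close> with cnj x gives \<beta> as the integral of x against the
  conjugate of x after T. As D is orthogonal to functions of T, its square norm is its inner product
  with x alone, 1 - |\<beta>|^2.\<close>

lemma integral_norm_D: "(\<integral>z. (cmod (D z))\<^sup>2 \<partial>M) = \<theta>"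
proof -
  have i: "integrable M (\<lambda>z. x z * cnj (x (T z)))" "integrable M (\<lambda>z. x (T z) * cnj (x z))"
    "integrable M (\<lambda>z. D z * cnj (x (T z)))"  "integrable M (\<lambda>z. D z * cnj (x z))"
    by (intro bm_integrable bm_mult bm_cnj bm_x bm_D bm_T[of x])+
  have one: "x z * cnj (x z) = 1" if "z \<in> space M" for z
    using norm_x[OF that] by (simp add: complex_norm_square[symmetric])
  have "(\<integral>z. x z * cnj (x (T z)) - \<beta> \<partial>M) = (\<integral>z. D z * cnj (x (T z)) \<partial>M)"
    using one T_space by (intro Bochner_Integration.integral_cong) (auto simp: D_def algebra_simps)
  then have xx: "(\<integral>z. x z * cnj (x (T z)) \<partial>M) = \<beta>"
    using orth_D[OF bm_cnj[OF bm_x]] i(1) by (simp add: prob_space)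
  have "(\<integral>z. x (T z) * cnj (x z) \<partial>M) = (\<integral>z. cnj (x z * cnj (x (T z))) \<partial>M)"
    by (simp add: mult.commute)
  also have "\<dots> = cnj \<beta>" by (simp only: Bochner_Integration.integral_cnj xx)
  finally have xx': "(\<integral>z. x (T z) * cnj (x z) \<partial>M) = cnj \<beta>" .
  have "complex_of_real (\<integral>z. (cmod (D z))\<^sup>2 \<partial>M) = (\<integral>z. D z * cnj (D z) \<partial>M)"
    by (rule integral_norm2_cnj[OF bm_D])
  also have "\<dots> = (\<integral>z. D z * cnj (x z) - cnj \<beta> * (D z * cnj (x (T z))) \<partial>M)"
    by (rule Bochner_Integration.integral_cong) (auto simp: D_def algebra_simps)
  also have "\<dots> = (\<integral>z. D z * cnj (x z) \<partial>M)"
    using i orth_D[OF bm_cnj[OF bm_x]] by simp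
  also have "\<dots> = (\<integral>z. 1 - \<beta> * (x (T z) * cnj (x z)) \<partial>M)"
    using one by (intro Bochner_Integration.integral_cong) (auto simp: D_def algebra_simps)
  also have "\<dots> = 1 - \<beta> * cnj \<beta>" using i xx' by (simp add: prob_space)
  also have "\<dots> = complex_of_real \<theta>" by (simp add: \<theta>_def complex_norm_square[symmetric])
  finally show ?thesis by (simp only: of_real_eq_iff)
qed

text \<open>Pythagoras: the cross term is D times a function of T. The multiplier h may itself
  depend on T, which is what stopped sums require.\<close>

lemma integral_norm2_add:
  assumes w: "bm w" and h: "bm h"
  shows "(\<integral>z. (cmod (w (T z) + h (T z) * D z))\<^sup>2 \<partial>M) = (\<integral>z. (cmod (w z))\<^sup>2 \<partial>M) + (\<integral>z. (cmod (h (T z) * D z))\<^sup>2 \<partial>M)"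
proof -
  have i: "integrable M (\<lambda>z. (cmod (w (T z)))\<^sup>2)" "integrable M (\<lambda>z. (cmod (h (T z) * D z))\<^sup>2)"
    by (intro bm_real_integrable bm_T[OF w] bm_mult bm_T[OF h] bm_D)+
  have j: "integrable M (\<lambda>z. D z * (h (T z) * cnj (w (T z))))"
    by (intro bm_integrable bm_mult bm_D bm_T[OF h] bm_cnj bm_T[OF w])
  have "(\<integral>z. (cmod (w (T z) + h (T z) * D z))\<^sup>2 \<partial>M) =
    (\<integral>z. (cmod (w (T z)))\<^sup>2 + (cmod (h (T z) * D z))\<^sup>2 + 2 * Re (D z * (h (T z) * cnj (w (T z)))) \<partial>M)"
  proof (rule Bochner_Integration.integral_cong)
    fix z
    have *: "(cmod (a + b))\<^sup>2 = (cmod a)\<^sup>2 + (cmod b)\<^sup>2 + 2 * Re (b * cnj a)" for a b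
      unfolding cmod_power2 by (simp add: power2_eq_square algebra_simps)
    show "(cmod (w (T z) + h (T z) * D z))\<^sup>2 = (cmod (w (T z)))\<^sup>2 + (cmod (h (T z) * D z))\<^sup>2 + 2 * Re (D z * (h (T z) * cnj (w (T z))))"
      unfolding * by (simp only: mult_ac)
  qed simp
  also have "\<dots> = (\<integral>z. (cmod (w (T z)))\<^sup>2 \<partial>M) + (\<integral>z. (cmod (h (T z) * D z))\<^sup>2 \<partial>M) + 2 * Re (\<integral>z. D z * (h (T z) * cnj (w (T z))) \<partial>M)"
    using i integrable_Re[OF j] by (simp only: Bochner_Integration.integral_add Bochner_Integration.integrable_add
        integrable_mult_right integral_mult_right_zero integral_Re[OF j])
  also have "(\<integral>z. D z * (h (T z) * cnj (w (T z))) \<partial>M) = 0"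
    by (rule orth_D[of "\<lambda>z. h z * cnj (w z)"]) (intro bm_mult bm_cnj w h)
  also have "(\<integral>z. (cmod (w (T z)))\<^sup>2 \<partial>M) = (\<integral>z. (cmod (w z))\<^sup>2 \<partial>M)"
    by (rule integral_T[of "\<lambda>z. (cmod (w z))\<^sup>2"]) (use bm_measurable[OF w] in measurable)
  finally show ?thesis by simp
qed

text \<open>A martingale sum with an end term, set up by prepending D to a sum already composed with
  T. That order makes every new summand orthogonal to what precedes it. The end term with
  coefficient e accommodates the remainder of the summation by parts.\<close>

primrec U :: "nat \<Rightarrow> complex \<Rightarrow> (nat \<Rightarrow> complex) \<Rightarrow> 'a \<Rightarrow> complex" where
  "U 0 e c = (\<lambda>z. e * x z)"
| "U (Suc k) e c = (\<lambda>z. U k e (\<lambda>n. c (Suc n)) (T z) + c 0 * D z)"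

lemma U_eq: "U k e c z = (\<Sum>i<k. c i * D ((T ^^ i) z)) + e * x ((T ^^ k) z)"
proof (induction k arbitrary: c z)
  case (Suc k)
  then show ?case by (simp add: sum.lessThan_Suc_shift funpow_swap1 del: sum.lessThan_Suc)
qed simp

lemma U_bm: "bm (U k e c)"
  by (induction k arbitrary: c) (auto intro!: bm_mult bm_add bm_const bm_x bm_D intro: bm_T)

lemma U_norm2: "(\<integral>z. (cmod (U k e c z))\<^sup>2 \<partial>M) = (cmod e)\<^sup>2 + \<theta> * (\<Sum>i<k. (cmod (c i))\<^sup>2)"
proof (induction k arbitrary: c)
  case 0
  have "(\<integral>z. (cmod (e * x z))\<^sup>2 \<partial>M) = (\<integral>z. (cmod e)\<^sup>2 \<partial>M)"
    by (rule Bochner_Integration.integral_cong) (auto simp: norm_mult norm_x)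
  then show ?case by (simp add: prob_space)
next
  case (Suc k)
  have "(\<integral>z. (cmod (U (Suc k) e c z))\<^sup>2 \<partial>M) = (\<integral>z. (cmod (U k e (\<lambda>n. c (Suc n)) z))\<^sup>2 \<partial>M) + (\<integral>z. (cmod (c 0 * D z))\<^sup>2 \<partial>M)"
    using integral_norm2_add[OF U_bm bm_const, of k e "\<lambda>n. c (Suc n)" "c 0"] by simp
  also have "(\<integral>z. (cmod (c 0 * D z))\<^sup>2 \<partial>M) = \<theta> * (cmod (c 0))\<^sup>2"
    by (simp add: norm_mult power_mult_distrib integral_norm_D)
  finally show ?case unfolding Suc.IH by (simp add: sum.lessThan_Suc_shift algebra_simps del: sum.lessThan_Suc)
qed

text \<open>Induction with increment B = c_0 D, where |B|^2 \<le> 4y and y = |c_0|^2. The fourth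
  power inequality adds 32 y V + 48 y^2, the cubic cross term integrating to 0, and 48 V^2 + 32 y V
  + 48 y^2 \<le> 48 (V + y)^2 closes the induction.\<close>

lemma U_norm4: "(\<integral>z. cmod (U k e c z) ^ 4 \<partial>M) \<le> 48 * ((cmod e)\<^sup>2 + (\<Sum>i<k. (cmod (c i))\<^sup>2))\<^sup>2"
proof (induction k arbitrary: c)
  case 0
  have "(\<integral>z. cmod (e * x z) ^ 4 \<partial>M) = (\<integral>z. cmod e ^ 4 \<partial>M)"
    by (rule Bochner_Integration.integral_cong) (auto simp: norm_mult norm_x)
  then show ?case by (simp add: prob_space power2_eq_square power4_eq_xxxx)
next
  case (Suc k)
  define w where "w = U k e (\<lambda>n. c (Suc n))"
  have w: "bm w" unfolding w_def by (rule U_bm)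
  have [measurable]: "w \<in> borel_measurable M" by (rule bm_measurable[OF w])
  define V where "V = (cmod e)\<^sup>2 + (\<Sum>i<k. (cmod (c (Suc i)))\<^sup>2)"
  define y where "y = (cmod (c 0))\<^sup>2"
  define H where "H z = (cmod (w z))\<^sup>2 * w z * cnj (c 0)" for z
  have H: "bm H"
  proof -
    have "bm (\<lambda>z. of_real (cmod (w z)) * of_real (cmod (w z)) * w z * cnj (c 0))"
      by (intro bm_mult bm_norm w bm_const)
    then show ?thesis unfolding H_def by (simp add: power2_eq_square)
  qed
  have j: "integrable M (\<lambda>z. H (T z) * cnj (D z))" by (intro bm_integrable bm_mult bm_T[OF H] bm_cnj bm_D)
  have i4: "integrable M (\<lambda>z. cmod (w (T z)) ^ 4)" and i2: "integrable M (\<lambda>z. (cmod (w (T z)))\<^sup>2)"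
    by (intro bm_real_integrable bm_T[OF w])+
  have "(\<integral>z. cmod (U (Suc k) e c z) ^ 4 \<partial>M) \<le>
    (\<integral>z. cmod (w (T z)) ^ 4 + 32 * y * (cmod (w (T z)))\<^sup>2 + 48 * y\<^sup>2 + 4 * Re (H (T z) * cnj (D z)) \<partial>M)"
  proof (rule integral_mono)
    show "integrable M (\<lambda>z. cmod (U (Suc k) e c z) ^ 4)" by (rule bm_real_integrable[OF U_bm])
    show "integrable M (\<lambda>z. cmod (w (T z)) ^ 4 + 32 * y * (cmod (w (T z)))\<^sup>2 + 48 * y\<^sup>2 + 4 * Re (H (T z) * cnj (D z)))"
      using i4 i2 integrable_Re[OF j] by (intro Bochner_Integration.integrable_add integrable_mult_right) auto
    fix z assume z: "z \<in> space M"
    let ?A = "w (T z)" and ?B = "c 0 * D z"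
    have B2: "(cmod ?B)\<^sup>2 \<le> 4 * y"
      using power_mono[OF D_bound[OF z], of 2] mult_left_mono[of "(cmod (D z))\<^sup>2" 4 y]
      by (simp add: norm_mult power_mult_distrib y_def mult_ac)
    have "cmod ?B ^ 4 = ((cmod ?B)\<^sup>2)\<^sup>2" by simp
    also have "\<dots> \<le> (4 * y)\<^sup>2" by (rule power_mono[OF B2]) simp
    finally have B4: "cmod ?B ^ 4 \<le> 16 * y\<^sup>2" by simp
    have "cmod (U (Suc k) e c z) ^ 4 = cmod (?A + ?B) ^ 4" by (simp add: w_def)
    also have "\<dots> \<le> cmod ?A ^ 4 + 8 * ((cmod ?A)\<^sup>2 * (cmod ?B)\<^sup>2) + 3 * cmod ?B ^ 4 + 4 * Re ((cmod ?A)\<^sup>2 * ?A * cnj ?B)"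
      by (rule norm_add_fourth_power)
    also have "(cmod ?A)\<^sup>2 * ?A * cnj ?B = H (T z) * cnj (D z)" by (simp add: H_def)
    also have "(cmod ?A)\<^sup>2 * (cmod ?B)\<^sup>2 \<le> (cmod ?A)\<^sup>2 * (4 * y)" by (intro mult_left_mono B2) simp
    finally show "cmod (U (Suc k) e c z) ^ 4 \<le>
      cmod ?A ^ 4 + 32 * y * (cmod ?A)\<^sup>2 + 48 * y\<^sup>2 + 4 * Re (H (T z) * cnj (D z))"
      using B4 by (simp add: mult_ac)
  qed
  also have "\<dots> = (\<integral>z. cmod (w (T z)) ^ 4 \<partial>M) + 32 * y * (\<integral>z. (cmod (w (T z)))\<^sup>2 \<partial>M) + 48 * y\<^sup>2 + 4 * Re (\<integral>z. H (T z) * cnj (D z) \<partial>M)"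
  proof -
    have "integrable M (\<lambda>z. 4 * Re (H (T z) * cnj (D z)))" using integrable_Re[OF j] by (rule integrable_mult_right)
    then show ?thesis using i4 i2
      by (simp only: Bochner_Integration.integral_add Bochner_Integration.integrable_add integrable_mult_right
        integrable_const integral_mult_right_zero integral_Re[OF j] lebesgue_integral_const prob_space scaleR_one)
  qed
  also have "(\<integral>z. H (T z) * cnj (D z) \<partial>M) = cnj (\<integral>z. D z * cnj (H (T z)) \<partial>M)"
    unfolding Bochner_Integration.integral_cnj[symmetric] by (simp add: mult.commute)
  also have "(\<integral>z. D z * cnj (H (T z)) \<partial>M) = 0"
    by (rule orth_D[of "\<lambda>z. cnj (H z)"]) (intro bm_cnj H)
  also have "(\<integral>z. cmod (w (T z)) ^ 4 \<partial>M) = (\<integral>z. cmod (w z) ^ 4 \<partial>M)"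
    by (rule integral_T[of "\<lambda>z. cmod (w z) ^ 4"]) measurable
  also have "(\<integral>z. (cmod (w (T z)))\<^sup>2 \<partial>M) = (\<integral>z. (cmod (w z))\<^sup>2 \<partial>M)"
    by (rule integral_T[of "\<lambda>z. (cmod (w z))\<^sup>2"]) measurable
  finally have main: "(\<integral>z. cmod (U (Suc k) e c z) ^ 4 \<partial>M) \<le>
     (\<integral>z. cmod (w z) ^ 4 \<partial>M) + 32 * y * (\<integral>z. (cmod (w z))\<^sup>2 \<partial>M) + 48 * y\<^sup>2" by simp
  have y0: "0 \<le> y" by (simp add: y_def)
  have V0: "0 \<le> V" by (auto simp: V_def intro!: add_nonneg_nonneg sum_nonneg)
  have "(\<integral>z. (cmod (w z))\<^sup>2 \<partial>M) \<le> V"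
    unfolding w_def U_norm2 V_def using \<theta> mult_right_mono[of \<theta> 1 "\<Sum>i<k. (cmod (c (Suc i)))\<^sup>2"]
    by (simp add: sum_nonneg)
  then have "32 * y * (\<integral>z. (cmod (w z))\<^sup>2 \<partial>M) \<le> 32 * y * V" using y0 by (intro mult_left_mono) auto
  with main have "(\<integral>z. cmod (U (Suc k) e c z) ^ 4 \<partial>M) \<le> 48 * V\<^sup>2 + 32 * y * V + 48 * y\<^sup>2"
    using Suc.IH[of "\<lambda>n. c (Suc n)"] by (simp add: w_def V_def)
  also have "\<dots> \<le> 48 * (V + y)\<^sup>2" using y0 V0 by (simp add: power2_sum)
  also have "V + y = (cmod e)\<^sup>2 + (\<Sum>i<Suc k. (cmod (c i))\<^sup>2)"
    unfolding V_def y_def by (simp add: sum.lessThan_Suc_shift del: sum.lessThan_Suc)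
  finally show ?case .
qed

end

section \<open>Kolmogorov's maximal inequality and almost everywhere convergence\<close>

context reverse_martingale_shift
begin

definition S :: "nat \<Rightarrow> (nat \<Rightarrow> complex) \<Rightarrow> 'a \<Rightarrow> complex" where
  "S k c z = (\<Sum>i<k. c i * D ((T ^^ i) z))"

lemma S_Suc: "S (Suc k) c z = S k (\<lambda>n. c (Suc n)) (T z) + c 0 * D z"
  by (simp add: S_def sum.lessThan_Suc_shift funpow_swap1 del: sum.lessThan_Suc)

lemma S_split: "n \<le> k \<Longrightarrow> S k c z = S n c z + S (k - n) (\<lambda>i. c (n + i)) ((T ^^ n) z)"
proof -
  assume "n \<le> k"
  then have "{..<k} = {..<n} \<union> {n..<k}" "{..<n} \<inter> {n..<k} = {}" by auto
  then have "S k c z = S n c z + (\<Sum>i=n..<k. c i * D ((T ^^ i) z))"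
    unfolding S_def by (simp add: sum.union_disjoint)
  also have "(\<Sum>i=n..<k. c i * D ((T ^^ i) z)) = (\<Sum>i<k-n. c (i + n) * D ((T ^^ (i + n)) z))"
    using \<open>n \<le> k\<close> sum.shift_bounds_nat_ivl[of "\<lambda>i. c i * D ((T ^^ i) z)" 0 n "k - n"] by (simp add: lessThan_atLeast0)
  finally show ?thesis by (simp add: S_def funpow_add add.commute)
qed

lemma T_funpow[measurable]: "(T ^^ n) \<in> measurable M M"
proof (induction n)
  case (Suc n)
  then show ?case using measurable_comp[OF Suc.IH T] by (simp add: o_def)
qed (simp add: id_def)

lemma T_funpow_distr: "distr M M (T ^^ n) = M"
proof (induction n)
  case 0
  then show ?case by (simp add: id_def distr_id)
next
  case (Suc n)
  have "distr M M (T ^^ Suc n) = distr (distr M M (T ^^ n)) M T"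
    by (simp only: funpow.simps distr_distr[OF T T_funpow])
  also have "\<dots> = M" unfolding Suc.IH by (rule T_distr)
  finally show ?case .
qed

lemma prob_T_funpow:
  assumes "A \<in> sets M"
  shows "prob {z \<in> space M. (T ^^ n) z \<in> A} = prob A"
proof -
  have "prob A = measure (distr M M (T ^^ n)) A" by (simp add: T_funpow_distr)
  also have "\<dots> = prob ((T ^^ n) -` A \<inter> space M)" by (rule measure_distr) (use assms in auto)
  also have "(T ^^ n) -` A \<inter> space M = {z \<in> space M. (T ^^ n) z \<in> A}" by auto
  finally show ?thesis by simp
qed

lemma S_measurable[measurable]: "S k c \<in> borel_measurable M"
  unfolding S_def using measurable_compose[OF T_funpow D_measurable] by measurable

text \<open>The sum \<open>S\<close>, built from its last term downwards and stopped once its modulus reaches \<open>L\<close>.\<close>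

primrec W :: "real \<Rightarrow> nat \<Rightarrow> (nat \<Rightarrow> complex) \<Rightarrow> 'a \<Rightarrow> complex" where
  "W L 0 c = (\<lambda>z. 0)"
| "W L (Suc k) c = (\<lambda>z. W L k (\<lambda>n. c (Suc n)) (T z) +
     (if L \<le> cmod (W L k (\<lambda>n. c (Suc n)) (T z)) then 0 else c 0) * D z)"

lemma W_bm: "bm (W L k c)"
proof (induction k arbitrary: c)
  case (Suc k)
  let ?w = "W L k (\<lambda>n. c (Suc n))"
  have [measurable]: "?w \<in> borel_measurable M" by (rule bm_measurable[OF Suc.IH])
  have h: "bm (\<lambda>z. if L \<le> cmod (?w z) then 0 else c 0)"
    by (rule bmI[where C = "cmod (c 0)"]) auto
  show ?case by (simp, intro bm_add bm_mult bm_T[OF Suc.IH] bm_T[OF h] bm_D)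
qed (simp add: bm_const)

text \<open>The stopping factor is a function of T, so Pythagoras still applies; |D| \<le> 2
  accounts for the factor 4.\<close>

lemma W_norm2: "(\<integral>z. (cmod (W L k c z))\<^sup>2 \<partial>M) \<le> 4 * (\<Sum>i<k. (cmod (c i))\<^sup>2)"
proof (induction k arbitrary: c)
  case (Suc k)
  define w where "w = W L k (\<lambda>n. c (Suc n))"
  define h where "h z = (if L \<le> cmod (w z) then 0 else c 0)" for z
  have w: "bm w" unfolding w_def by (rule W_bm)
  have [measurable]: "w \<in> borel_measurable M" by (rule bm_measurable[OF w])
  have h: "bm h" unfolding h_def by (rule bmI[where C = "cmod (c 0)"]) auto
  have "(\<integral>z. (cmod (W L (Suc k) c z))\<^sup>2 \<partial>M) = (\<integral>z. (cmod (w z))\<^sup>2 \<partial>M) + (\<integral>z. (cmod (h (T z) * D z))\<^sup>2 \<partial>M)"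
    using integral_norm2_add[OF w h] by (simp add: w_def h_def)
  also have "(\<integral>z. (cmod (h (T z) * D z))\<^sup>2 \<partial>M) \<le> (\<integral>z. (2 * cmod (c 0))\<^sup>2 \<partial>M)"
  proof (rule integral_mono)
    show "integrable M (\<lambda>z. (cmod (h (T z) * D z))\<^sup>2)"
      by (intro bm_real_integrable bm_mult bm_T[OF h] bm_D)
    fix z assume z: "z \<in> space M"
    have "cmod (h (T z)) \<le> cmod (c 0)" by (simp add: h_def)
    then have "cmod (h (T z) * D z) \<le> cmod (c 0) * 2"
      unfolding norm_mult by (intro mult_mono D_bound z) auto
    then show "(cmod (h (T z) * D z))\<^sup>2 \<le> (2 * cmod (c 0))\<^sup>2" by (intro power_mono) auto
  qed simp
  finally show ?case using Suc.IH[of "\<lambda>n. c (Suc n)"]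
    by (simp add: w_def power_mult_distrib prob_space sum.lessThan_Suc_shift del: sum.lessThan_Suc)
qed simp

text \<open>Once the modulus reaches L the stopped sum is frozen and stays there. Ending below L
  thus means that it was never stopped, so that it equals the full sum and every tail was below
  L.\<close>

lemma W_eq_S:
  assumes "0 < L" "cmod (W L k c z) < L"
  shows "W L k c z = S k c z \<and> (\<forall>i\<le>k. cmod (S (k - i) (\<lambda>n. c (i + n)) ((T ^^ i) z)) < L)"
  using assms(2)
proof (induction k arbitrary: c z)
  case 0
  then show ?case using assms(1) by (simp add: S_def)
next
  case (Suc k)
  let ?w = "W L k (\<lambda>n. c (Suc n)) (T z)"
  have lt: "cmod ?w < L" using Suc.prems by (auto split: if_splits)
  note IH = Suc.IH[OF lt]
  have eq: "W L (Suc k) c z = S (Suc k) c z" using IH lt by (simp add: S_Suc)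
  moreover have "cmod (S (Suc k - i) (\<lambda>n. c (i + n)) ((T ^^ i) z)) < L" if "i \<le> Suc k" for i
  proof (cases i)
    case 0
    then show ?thesis using Suc.prems eq by (simp del: W.simps)
  next
    case (Suc j)
    have "cmod (S (k - j) (\<lambda>n. c (Suc (j + n))) ((T ^^ j) (T z))) < L" using IH that Suc by auto
    then show ?thesis using Suc by (simp add: funpow_swap1)
  qed
  ultimately show ?case by blast
qed

text \<open>If the stopped sum ends below L, the full sum and all tails are below L, and each
  initial sum, as their difference, is below 2L. What remains is Chebyshev's inequality for the
  stopped sum.\<close>

lemma kolmogorov_finite:
  assumes "0 < L"
  shows "prob {z \<in> space M. \<exists>i\<le>k. 2 * L \<le> cmod (S i c z)} \<le> 4 / L\<^sup>2 * (\<Sum>i<k. (cmod (c i))\<^sup>2)"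
proof -
  have [measurable]: "W L k c \<in> borel_measurable M" by (rule bm_measurable[OF W_bm])
  have "{z \<in> space M. \<exists>i\<le>k. 2 * L \<le> cmod (S i c z)} \<subseteq> {z \<in> space M. L\<^sup>2 \<le> (cmod (W L k c z))\<^sup>2}"
  proof safe
    fix z i assume z: "z \<in> space M" "i \<le> k" "2 * L \<le> cmod (S i c z)"
    show "L\<^sup>2 \<le> (cmod (W L k c z))\<^sup>2"
    proof (rule ccontr)
      assume "\<not> ?thesis"
      then have lt: "cmod (W L k c z) < L" using assms by (meson linorder_not_le power_mono less_imp_le)
      have 1: "cmod (S k c z) < L" using W_eq_S[OF assms lt] lt by simp
      have 2: "cmod (S (k - i) (\<lambda>n. c (i + n)) ((T ^^ i) z)) < L" using W_eq_S[OF assms lt] z(2) by simp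
      have "S i c z = S k c z - S (k - i) (\<lambda>n. c (i + n)) ((T ^^ i) z)" using S_split[OF z(2)] by simp
      then have "cmod (S i c z) \<le> cmod (S k c z) + cmod (S (k - i) (\<lambda>n. c (i + n)) ((T ^^ i) z))"
        using norm_triangle_ineq4 by metis
      then show False using 1 2 z(3) by simp
    qed
  qed
  then have "prob {z \<in> space M. \<exists>i\<le>k. 2 * L \<le> cmod (S i c z)} \<le> prob {z \<in> space M. L\<^sup>2 \<le> (cmod (W L k c z))\<^sup>2}"
    by (intro finite_measure_mono) measurable
  also have "\<dots> \<le> (\<integral>z. (cmod (W L k c z))\<^sup>2 \<partial>M) / L\<^sup>2"
    by (rule integral_Markov_inequality_measure[where A = "{}"])
      (use assms bm_real_integrable[OF W_bm, of L k c 2] in auto)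
  also have "\<dots> \<le> 4 * (\<Sum>i<k. (cmod (c i))\<^sup>2) / L\<^sup>2"
    by (intro divide_right_mono W_norm2) simp
  finally show ?thesis by simp
qed

lemma kolmogorov:
  assumes L: "0 < L" and c: "summable (\<lambda>i. (cmod (c i))\<^sup>2)"
  shows "prob {z \<in> space M. \<exists>i. 2 * L \<le> cmod (S i c z)} \<le> 4 / L\<^sup>2 * (\<Sum>i. (cmod (c i))\<^sup>2)"
proof -
  define B where "B k = {z \<in> space M. \<exists>i\<le>k. 2 * L \<le> cmod (S i c z)}" for k
  have "B k \<in> sets M" for k unfolding B_def by measurable
  then have "(\<lambda>k. prob (B k)) \<longlonglongrightarrow> prob (\<Union>k. B k)"
    by (intro finite_Lim_measure_incseq) (auto simp: incseq_def B_def intro: order_trans)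
  moreover have "prob (B k) \<le> 4 / L\<^sup>2 * (\<Sum>i. (cmod (c i))\<^sup>2)" for k
    by (rule order_trans[OF kolmogorov_finite[OF L, of k c, folded B_def]])
      (intro mult_left_mono sum_le_suminf c; simp)
  ultimately have "prob (\<Union>k. B k) \<le> 4 / L\<^sup>2 * (\<Sum>i. (cmod (c i))\<^sup>2)"
    by (intro LIMSEQ_le_const2) auto
  also have "(\<Union>k. B k) = {z \<in> space M. \<exists>i. 2 * L \<le> cmod (S i c z)}" by (auto simp: B_def)
  finally show ?thesis .
qed

text \<open>A tail from n on is a sum with shifted coefficients evaluated at T^n z. Since T^n
  preserves the measure, the maximal inequality bounds its oscillation by the tail of the series of
  |c_i|^2, which tends to 0.\<close>

lemma martingale_convergence:
  assumes c: "summable (\<lambda>i. (cmod (c i))\<^sup>2)"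
  shows "AE z in M. summable (\<lambda>i. c i * D ((T ^^ i) z))"
proof -
  define Z where "Z m n = {z \<in> space M. (T ^^ n) z \<in> {z \<in> space M. \<exists>i. 2 * (1 / real (Suc m)) \<le> cmod (S i (\<lambda>i. c (i + n)) z)}}" for m n
  have meas: "{z \<in> space M. \<exists>i. 2 * (1 / real (Suc m)) \<le> cmod (S i (\<lambda>i. c (i + n)) z)} \<in> sets M" for m n
    by measurable
  have Zm: "Z m n \<in> sets M" for m n
    using measurable_sets[OF T_funpow meas, of n m n] by (simp add: Z_def vimage_def Int_def conj_commute)
  define \<tau> where "\<tau> n = (\<Sum>i. (cmod (c (i + n)))\<^sup>2)" for n
  have \<tau>: "\<tau> \<longlonglongrightarrow> 0" unfolding \<tau>_def by (rule suminf_exist_split2[OF c])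
  have Zb: "prob (Z m n) \<le> 4 / (1 / real (Suc m))\<^sup>2 * \<tau> n" for m n
    unfolding Z_def prob_T_funpow[OF meas] \<tau>_def
    by (rule kolmogorov) (simp_all add: summable_ignore_initial_segment[OF c, of n])
  have null: "(\<Inter>n. Z m n) \<in> null_sets M" for m
    by (rule null_sets_INT_tendsto[OF Zm Zb \<tau>])
  have "AE z in M. \<forall>m. z \<notin> (\<Inter>n. Z m n)"
    unfolding AE_all_countable by (intro allI AE_not_in null)
  then show ?thesis
  proof (rule AE_mp, intro AE_I2 impI)
    fix z assume z: "z \<in> space M" "\<forall>m. z \<notin> (\<Inter>n. Z m n)"
    have "Cauchy (\<lambda>k. S k c z)"
    proof (rule metric_CauchyI)
      fix e :: real assume "0 < e"
      \<comment> \<open>Two partial sums beyond n each differ from the n-th by less than 2/(m+1),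
        hence from each other by less than 4/(m+1).\<close>
      then obtain m where m: "1 / real (Suc m) < e / 4" using nat_approx_posE[of "e/4"] by auto
      from z(2) obtain n where n: "z \<notin> Z m n" by blast
      have *: "cmod (S k c z - S n c z) < 2 * (1 / real (Suc m))" if "n \<le> k" for k
      proof -
        have "(T ^^ n) z \<in> space M" by (rule measurable_space[OF T_funpow z(1)])
        then have "cmod (S (k - n) (\<lambda>i. c (i + n)) ((T ^^ n) z)) < 2 * (1 / real (Suc m))"
          using n z(1) by (auto simp: Z_def not_le)
        then show ?thesis using S_split[OF that, of c z] by (simp add: add.commute)
      qed
      have "dist (S k c z) (S l c z) < e" if "n \<le> k" "n \<le> l" for k l
      proof -
        have "cmod (S k c z - S l c z) \<le> cmod (S k c z - S n c z) + cmod (S l c z - S n c z)"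
          by (metis norm_triangle_ineq4 diff_diff_eq2 diff_add_cancel add_diff_eq)
        then show ?thesis using *[OF that(1)] *[OF that(2)] m by (simp add: dist_norm)
      qed
      then show "\<exists>n. \<forall>k\<ge>n. \<forall>l\<ge>n. dist (S k c z) (S l c z) < e" by blast
    qed
    then show "summable (\<lambda>i. c i * D ((T ^^ i) z))"
      by (simp add: summable_iff_convergent Cauchy_convergent_iff S_def)
  qed
qed

section \<open>Summation by parts and square summability\<close>

primrec mcoeff :: "(nat \<Rightarrow> complex) \<Rightarrow> nat \<Rightarrow> complex" where
  "mcoeff a 0 = a 0"
| "mcoeff a (Suc n) = \<beta> * mcoeff a n + a (Suc n)"

lemma sum_by_parts:
  "(\<Sum>i<Suc n. a i * x ((T ^^ i) z)) = (\<Sum>i<Suc n. mcoeff a i * D ((T ^^ i) z)) + \<beta> * mcoeff a n * x ((T ^^ Suc n) z)"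
proof (induction n)
  case (Suc n)
  have "(\<Sum>i<Suc (Suc n). a i * x ((T ^^ i) z)) = (\<Sum>i<Suc n. mcoeff a i * D ((T ^^ i) z)) + \<beta> * mcoeff a n * x ((T ^^ Suc n) z) + a (Suc n) * x ((T ^^ Suc n) z)"
    unfolding sum.lessThan_Suc[of _ "Suc n"] Suc.IH ..
  also have "\<dots> = (\<Sum>i<Suc n. mcoeff a i * D ((T ^^ i) z)) + mcoeff a (Suc n) * x ((T ^^ Suc n) z)"
    by (simp add: algebra_simps)
  also have "x ((T ^^ Suc n) z) = D ((T ^^ Suc n) z) + \<beta> * x ((T ^^ Suc (Suc n)) z)" by (simp add: D_def)
  finally show ?case by (simp add: algebra_simps del: mcoeff.simps)
qed (simp add: D_def algebra_simps)

text \<open>Convolution with the geometric sequence \<beta>^n is bounded on square summable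
  sequences. Convexity with weights \<rho> and 1 - \<rho> gives a recursion for the squares, which
  sums to at most A / (1 - \<rho>)^2.\<close>

lemma mcoeff_square_summable:
  assumes a: "summable (\<lambda>i. (cmod (a i))\<^sup>2)"
  shows "summable (\<lambda>i. (cmod (mcoeff a i))\<^sup>2)"
proof -
  define \<rho> where "\<rho> = cmod \<beta>"
  have \<rho>: "0 \<le> \<rho>" "\<rho> < 1" using \<beta> by (auto simp: \<rho>_def)
  define A where "A = (\<Sum>i. (cmod (a i))\<^sup>2)"
  have A0: "0 \<le> A" unfolding A_def by (intro suminf_nonneg a) simp
  have step: "(cmod (mcoeff a (Suc n)))\<^sup>2 \<le> \<rho> * (cmod (mcoeff a n))\<^sup>2 + (cmod (a (Suc n)))\<^sup>2 / (1 - \<rho>)" for n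
  proof -
    define u v where "u = cmod (mcoeff a n)" and "v = cmod (a (Suc n))"
    have "cmod (mcoeff a (Suc n)) \<le> \<rho> * u + v"
      using norm_triangle_ineq[of "\<beta> * mcoeff a n" "a (Suc n)"] by (simp add: norm_mult u_def v_def \<rho>_def)
    then have "(cmod (mcoeff a (Suc n)))\<^sup>2 \<le> (\<rho> * u + v)\<^sup>2" by (intro power_mono) auto
    also have "\<dots> \<le> \<rho> * u\<^sup>2 + v\<^sup>2 / (1 - \<rho>)"
    proof -
      \<comment> \<open>The gap in the convexity inequality is exactly this square.\<close>
      have "0 \<le> \<rho> * (((1 - \<rho>) * u - v)\<^sup>2 / (1 - \<rho>))" using \<rho> by auto
      also have "\<dots> = \<rho> * u\<^sup>2 + v\<^sup>2 / (1 - \<rho>) - (\<rho> * u + v)\<^sup>2"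
        using \<rho> by (simp add: field_simps power2_eq_square)
      finally show ?thesis by simp
    qed
    finally show ?thesis unfolding u_def v_def .
  qed
  have bound: "(\<Sum>i\<le>n. (cmod (mcoeff a i))\<^sup>2) \<le> A / (1 - \<rho>)\<^sup>2" for n
  proof (induction n)
    case 0
    have "(cmod (a 0))\<^sup>2 \<le> A"
      using sum_le_suminf[OF a, of "{0}"] by (simp add: A_def)
    also have "A \<le> A / (1 - \<rho>)\<^sup>2"
    proof -
      have "A * (1 - \<rho>)\<^sup>2 \<le> A * 1" using \<rho> A0 by (intro mult_left_mono power_le_one) auto
      then show ?thesis using \<rho> by (simp add: pos_le_divide_eq)
    qed
    finally show ?case by simp
  next
    case (Suc n)
    have "(\<Sum>i\<le>Suc n. (cmod (mcoeff a i))\<^sup>2) = (cmod (a 0))\<^sup>2 + (\<Sum>i\<le>n. (cmod (mcoeff a (Suc i)))\<^sup>2)"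
      by (subst sum.atMost_Suc_shift) simp
    also have "\<dots> \<le> (cmod (a 0))\<^sup>2 / (1 - \<rho>) + (\<Sum>i\<le>n. \<rho> * (cmod (mcoeff a i))\<^sup>2 + (cmod (a (Suc i)))\<^sup>2 / (1 - \<rho>))"
    proof (intro add_mono sum_mono step)
      have "(cmod (a 0))\<^sup>2 * (1 - \<rho>) \<le> (cmod (a 0))\<^sup>2 * 1" using \<rho> by (intro mult_left_mono) auto
      then show "(cmod (a 0))\<^sup>2 \<le> (cmod (a 0))\<^sup>2 / (1 - \<rho>)" using \<rho> by (simp add: pos_le_divide_eq)
    qed
    also have "\<dots> = \<rho> * (\<Sum>i\<le>n. (cmod (mcoeff a i))\<^sup>2) + (\<Sum>i\<le>Suc n. (cmod (a i))\<^sup>2) / (1 - \<rho>)"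
      by (subst sum.atMost_Suc_shift) (simp add: sum.distrib sum_distrib_left sum_divide_distrib add_divide_distrib)
    also have "\<dots> \<le> \<rho> * (A / (1 - \<rho>)\<^sup>2) + A / (1 - \<rho>)"
      unfolding A_def using \<rho>
      by (intro add_mono mult_left_mono divide_right_mono sum_le_suminf a Suc.IH[unfolded A_def]) auto
    also have "A / (1 - \<rho>) = (1 - \<rho>) * (A / (1 - \<rho>)\<^sup>2)"
      using \<rho> by (simp add: power2_eq_square)
    also have "\<rho> * (A / (1 - \<rho>)\<^sup>2) + (1 - \<rho>) * (A / (1 - \<rho>)\<^sup>2) = A / (1 - \<rho>)\<^sup>2"
      unfolding distrib_right[symmetric] by simp
    finally show ?case .
  qed
  show ?thesis
    by (rule bounded_imp_summable[OF _ bound]) simp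
qed

text \<open>The martingale part converges almost everywhere, and the remainder of the summation by
  parts tends to 0 because the new coefficients do and x is unimodular.\<close>

theorem square_summable_imp_AE_summable:
  assumes a: "summable (\<lambda>i. (cmod (a i))\<^sup>2)"
  shows "AE z in M. summable (\<lambda>i. a i * x ((T ^^ i) z))"
proof -
  note c = mcoeff_square_summable[OF a]
  have "(\<lambda>i. sqrt ((cmod (mcoeff a i))\<^sup>2)) \<longlonglongrightarrow> sqrt 0"
    by (intro tendsto_real_sqrt summable_LIMSEQ_zero[OF c])
  then have c0: "mcoeff a \<longlonglongrightarrow> 0" by (simp add: tendsto_norm_zero_iff)
  show ?thesis
    using martingale_convergence[OF c] AE_space
  proof eventually_elim
    case (elim z)
    have n1: "cmod (x ((T ^^ Suc n) z)) = 1" for n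
      by (rule norm_x) (rule measurable_space[OF T_funpow elim(2)])
    have "(\<lambda>n. \<beta> * mcoeff a n * x ((T ^^ Suc n) z)) \<longlonglongrightarrow> 0"
    proof (rule Lim_null_comparison)
      show "\<forall>\<^sub>F n in sequentially. norm (\<beta> * mcoeff a n * x ((T ^^ Suc n) z)) \<le> cmod (\<beta> * mcoeff a n)"
        by (intro always_eventually allI) (simp only: norm_mult n1 mult_1_right order_refl)
      show "(\<lambda>n. cmod (\<beta> * mcoeff a n)) \<longlonglongrightarrow> 0"
        by (intro tendsto_norm_zero tendsto_mult_right_zero c0)
    qed
    moreover have "(\<lambda>n. \<Sum>i<Suc n. mcoeff a i * D ((T ^^ i) z)) \<longlonglongrightarrow> (\<Sum>i. mcoeff a i * D ((T ^^ i) z))"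
      using LIMSEQ_Suc[OF summable_LIMSEQ[OF elim(1)]] .
    ultimately have "(\<lambda>n. \<Sum>i<Suc n. a i * x ((T ^^ i) z)) \<longlonglongrightarrow> (\<Sum>i. mcoeff a i * D ((T ^^ i) z)) + 0"
      unfolding sum_by_parts by (rule tendsto_add[rotated])
    then have "(\<lambda>n. \<Sum>i<n. a i * x ((T ^^ i) z)) \<longlonglongrightarrow> (\<Sum>i. mcoeff a i * D ((T ^^ i) z)) + 0"
      by (rule LIMSEQ_imp_Suc)
    then show ?case unfolding summable_iff_convergent by (rule convergentI)
  qed
qed

text \<open>On a set E of probability close to 1 all partial sums are bounded by K. Off E their
  square is controlled by the fourth moment, of order V^2, and by the small probability; with V the
  sum of |c_i|^2 this part absorbs only half of the lower bound \<theta> V, which leaves \<theta> V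
  \<le> 2 K^2.\<close>

theorem AE_bounded_imp_square_summable:
  assumes bd: "AE z in M. \<exists>K. \<forall>n. cmod (\<Sum>i<n. a i * x ((T ^^ i) z)) \<le> K"
  shows "summable (\<lambda>i. (cmod (a i))\<^sup>2)"
proof -
  define s where "s n z = (\<Sum>i<n. a i * x ((T ^^ i) z))" for n z
  have sm[measurable]: "s n \<in> borel_measurable M" for n
    unfolding s_def using measurable_compose[OF T_funpow x] by measurable
  define E where "E K = {z \<in> space M. \<forall>n. cmod (s n z) \<le> real K}" for K
  have Em[measurable]: "E K \<in> sets M" for K unfolding E_def by measurable
  have "(\<lambda>K. prob (E K)) \<longlonglongrightarrow> prob (\<Union>K. E K)"
    by (rule finite_Lim_measure_incseq) (auto simp: incseq_def E_def intro: order_trans)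
  also have "prob (\<Union>K. E K) = 1"
  proof -
    have "AE z in M. z \<in> (\<Union>K. E K)"
      using bd AE_space
    proof eventually_elim
      case (elim z)
      then obtain K where "\<forall>n. cmod (s n z) \<le> K" by (auto simp: s_def)
      then have "\<forall>n. cmod (s n z) \<le> real (nat \<lceil>K\<rceil>)" using real_nat_ceiling_ge order_trans by blast
      then show ?case using elim by (auto simp: E_def)
    qed
    then show ?thesis by (subst prob_eq_1) auto
  qed
  finally have E1: "(\<lambda>K. prob (E K)) \<longlonglongrightarrow> 1" .
  \<comment> \<open>Fixed before n is chosen and independent of V: the constant 192 of the fourth
    moment bound enters so that \<epsilon>/\<delta> = \<theta> V / 2 below.\<close>
  define \<epsilon> where "\<epsilon> = \<theta>\<^sup>2 / (4 * 192)"
  have \<epsilon>: "0 < \<epsilon>" using \<theta> by (simp add: \<epsilon>_def)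
  obtain K where K: "1 - \<epsilon> < prob (E K)"
    using order_tendstoD(1)[OF E1, of "1 - \<epsilon>"] \<epsilon> by (auto simp: eventually_sequentially)
  define V where "V n = (\<Sum>i<n. (cmod (mcoeff a i))\<^sup>2)" for n
  have V0: "0 \<le> V n" for n by (auto simp: V_def intro: sum_nonneg)
  have Vb: "V n \<le> 2 * (real K)\<^sup>2 / \<theta>" for n
  proof (cases "V n = 0")
    case True
    then show ?thesis using \<theta> by simp
  next
    case False
    then have Vpos: "0 < V n" using V0[of n] by simp
    then obtain m where n: "n = Suc m" by (cases n) (auto simp: V_def)
    \<comment> \<open>The remainder of the summation by parts becomes the end term of
      \<open>U\<close>. Since |e|^2 \<le> V, the bound 48 (|e|^2 + V)^2 is at most 192 V^2.\<close>
    define e where "e = \<beta> * mcoeff a m"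
    have sU: "s n z = U n e (mcoeff a) z" for z
      unfolding s_def n U_eq e_def sum_by_parts ..
    have eV: "(cmod e)\<^sup>2 \<le> V n"
    proof -
      have "(cmod e)\<^sup>2 \<le> (cmod (mcoeff a m))\<^sup>2"
        using \<beta> by (intro power_mono) (auto simp: e_def norm_mult intro: mult_left_le_one_le)
      also have "\<dots> \<le> V n" unfolding V_def n by (intro member_le_sum) auto
      finally show ?thesis .
    qed
    have L2: "\<theta> * V n \<le> (\<integral>z. (cmod (s n z))\<^sup>2 \<partial>M)"
      unfolding sU U_norm2 V_def[symmetric] by simp
    have "(\<integral>z. cmod (s n z) ^ 4 \<partial>M) \<le> 48 * ((cmod e)\<^sup>2 + V n)\<^sup>2"
      unfolding sU V_def by (rule U_norm4)
    also have "\<dots> \<le> 48 * (2 * V n)\<^sup>2"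
      using eV V0[of n] by (intro mult_left_mono power_mono) auto
    finally have L4: "(\<integral>z. cmod (s n z) ^ 4 \<partial>M) \<le> 192 * (V n)\<^sup>2" by simp
    \<comment> \<open>Weight in 2t \<le> \<delta> t^2 + 1/\<delta> for t = |s_n|^2 off E, chosen so
      that \<delta> times 192 V^2 is also \<theta> V / 2.\<close>
    define \<delta> where "\<delta> = \<theta> / (2 * 192) / V n"
    have \<delta>: "0 < \<delta>" using \<theta> Vpos by (simp add: \<delta>_def)
    have i2: "integrable M (\<lambda>z. (cmod (s n z))\<^sup>2)" and i4: "integrable M (\<lambda>z. cmod (s n z) ^ 4)"
      unfolding sU by (intro bm_real_integrable U_bm)+
    have "(\<integral>z. (cmod (s n z))\<^sup>2 \<partial>M) \<le>
      (\<integral>z. (real K)\<^sup>2 + (\<delta> * cmod (s n z) ^ 4 + indicator (space M - E K) z / \<delta>) / 2 \<partial>M)"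
    proof (rule integral_mono[OF i2])
      show "integrable M (\<lambda>z. (real K)\<^sup>2 + (\<delta> * cmod (s n z) ^ 4 + indicator (space M - E K) z / \<delta>) / 2)"
        using i4 by (intro Bochner_Integration.integrable_add integrable_divide integrable_mult_right) (auto simp: finite_measure.emeasure_finite less_top[symmetric])
      fix z assume z: "z \<in> space M"
      let ?t = "(cmod (s n z))\<^sup>2"
      have t4: "cmod (s n z) ^ 4 = ?t * ?t" by (simp add: power2_eq_square power4_eq_xxxx)
      show "?t \<le> (real K)\<^sup>2 + (\<delta> * cmod (s n z) ^ 4 + indicator (space M - E K) z / \<delta>) / 2"
      proof (cases "z \<in> E K")
        case True
        then have "?t \<le> (real K)\<^sup>2" by (intro power_mono) (auto simp: E_def)
        moreover have "0 \<le> (\<delta> * cmod (s n z) ^ 4 + indicator (space M - E K) z / \<delta>) / 2"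
          using \<delta> by simp
        ultimately have "?t + 0 \<le> (real K)\<^sup>2 + (\<delta> * cmod (s n z) ^ 4 + indicator (space M - E K) z / \<delta>) / 2"
          by (rule add_mono)
        then show ?thesis by (simp only: add_0_right)
      next
        case False
        have "0 \<le> (\<delta> * ?t - 1)\<^sup>2 / \<delta>" using \<delta> by simp
        also have "\<dots> = \<delta> * (?t * ?t) + 1 / \<delta> - 2 * ?t" using \<delta> by (simp add: field_simps power2_eq_square)
        finally have "?t \<le> (\<delta> * cmod (s n z) ^ 4 + 1 / \<delta>) / 2" unfolding t4 by simp
        then show ?thesis using False z by (simp add: add_increasing)
      qed
    qed
    also have "\<dots> = (real K)\<^sup>2 + (\<delta> * (\<integral>z. cmod (s n z) ^ 4 \<partial>M) + prob (space M - E K) / \<delta>) / 2"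
    proof -
      have "integrable M (\<lambda>z. indicator (space M - E K) z / \<delta>)" by (intro integrable_divide) (auto simp: less_top[symmetric])
      then show ?thesis using i4 by (simp add: prob_space)
    qed
    also have "\<dots> \<le> (real K)\<^sup>2 + (\<delta> * (192 * (V n)\<^sup>2) + \<epsilon> / \<delta>) / 2"
      using L4 \<delta> K by (intro add_left_mono divide_right_mono add_mono mult_left_mono) (auto simp: prob_compl)
    also have "\<delta> * (192 * (V n)\<^sup>2) = \<theta> * V n / 2" using Vpos by (simp add: \<delta>_def power2_eq_square)
    also have "\<epsilon> / \<delta> = \<theta> * V n / 2" using Vpos \<theta> by (simp add: \<delta>_def \<epsilon>_def power2_eq_square)
    finally have "\<theta> * V n \<le> 2 * (real K)\<^sup>2" using L2 by simp
    then show ?thesis using \<theta> by (simp add: pos_le_divide_eq mult.commute)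
  qed
  \<comment> \<open>The original coefficients are recovered as a_(i+1) = c_(i+1) - \<beta>
    c_i.\<close>
  have step: "(cmod (a (Suc i)))\<^sup>2 \<le> 2 * (cmod (mcoeff a (Suc i)))\<^sup>2 + 2 * (cmod (mcoeff a i))\<^sup>2" for i
  proof -
    have "cmod (\<beta> * mcoeff a i) \<le> cmod (mcoeff a i)" using \<beta> by (auto simp: norm_mult intro: mult_left_le_one_le)
    moreover have "cmod (a (Suc i)) \<le> cmod (mcoeff a (Suc i)) + cmod (\<beta> * mcoeff a i)"
      using norm_triangle_ineq4[of "mcoeff a (Suc i)" "\<beta> * mcoeff a i"] by simp
    ultimately have "(cmod (a (Suc i)))\<^sup>2 \<le> (cmod (mcoeff a (Suc i)) + cmod (mcoeff a i))\<^sup>2"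
      by (intro power_mono) auto
    also have "\<dots> \<le> 2 * (cmod (mcoeff a (Suc i)))\<^sup>2 + 2 * (cmod (mcoeff a i))\<^sup>2"
      using sum_squares_bound[of "cmod (mcoeff a (Suc i))" "cmod (mcoeff a i)"] by (simp add: power2_sum)
    finally show ?thesis .
  qed
  have "(\<Sum>i\<le>n. (cmod (mcoeff a i))\<^sup>2) \<le> 2 * (real K)\<^sup>2 / \<theta>" for n
    using Vb[of "Suc n"] unfolding V_def lessThan_Suc_atMost .
  then have "summable (\<lambda>i. (cmod (mcoeff a i))\<^sup>2)"
    by (intro bounded_imp_summable) auto
  then have "summable (\<lambda>i. 2 * (cmod (mcoeff a (Suc i)))\<^sup>2 + 2 * (cmod (mcoeff a i))\<^sup>2)"
    using summable_Suc_iff[of "\<lambda>i. (cmod (mcoeff a i))\<^sup>2"]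
    by (intro summable_add summable_mult) (simp_all del: mcoeff.simps)
  then have "summable (\<lambda>i. (cmod (a (Suc i)))\<^sup>2)"
    by (rule summable_comparison_test'[where N = 0]) (use step in auto)
  then show ?thesis by (simp add: summable_Suc_iff[of "\<lambda>i. (cmod (a i))\<^sup>2"])
qed

end

section \<open>Series of iterates\<close>

text \<open>The moment is q(0), where f(z) = z q(z), and |q| < 1 by the strict Schwarz
  lemma.\<close>

lemma first_moment_less_one:
  assumes f: "disc_inner f" "f 0 = 0" "\<not> disc_rotation f"
  shows "cmod (\<integral>z. bd f z * cnj z \<partial>circ) < 1"
proof -
  obtain q where q: "q holomorphic_on ball 0 1" "\<And>z. cmod z < 1 \<Longrightarrow> f z = z * q z"
    and q1: "\<And>z. cmod z < 1 \<Longrightarrow> cmod (q z) < 1"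
    using schwarz_factor[OF f] by blast
  have bq: "bounded_disc q 1" using q(1) q1 by (auto simp: bounded_disc_def less_imp_le)
  note bf = disc_inner_bounded[OF f(1)]
  have [measurable]: "(\<lambda>z. cnj z) \<in> borel_measurable circ"
    by (intro continuous_on_measurable_circ continuous_intros)
  have "(\<integral>z. bd f z * cnj z \<partial>circ) = (\<integral>z. bdry f z * cnj z \<partial>circ)"
    by (rule integral_cong_AE)
      (use bd_AE[OF f(1)] bd_borel[OF f(1)] bdry_measurable[OF bf] in \<open>auto elim!: AE_mp\<close>)
  also have "\<dots> = q 0"
    using bdry_coeff_shift[OF bf bq, of 0 0] q(2) bdry_integral[OF bq] by simp
  finally show ?thesis using q1[of 0] by simp
qed

text \<open>The projection of z onto functions of \<open>bd f\<close> is the case k = 1 of the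
  projection formula, whose single coefficient is the conjugated first moment; this gives
  \<open>orth\<close>.\<close>

lemma reverse_martingale_shift_inner:
  assumes f: "disc_inner f" "f 0 = 0" "\<not> disc_rotation f"
  shows "reverse_martingale_shift circ (bd f) (\<lambda>z. z) (cnj (\<integral>z. bd f z * cnj z \<partial>circ))"
proof unfold_locales
  let ?\<beta> = "cnj (\<integral>z. bd f z * cnj z \<partial>circ)"
  show "bd f \<in> measurable circ circ" by (rule bd_measurable[OF f(1)])
  show "distr circ circ (bd f) = circ" by (rule bd_distr[OF f(1,2)])
  show "cmod ?\<beta> < 1" using first_moment_less_one[OF f] by simp
  fix h :: "complex \<Rightarrow> complex" and C
  assume h: "h \<in> borel_measurable circ" "\<And>z. z \<in> space circ \<Longrightarrow> cmod (h z) \<le> C"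
  have hf: "(\<lambda>z. h (bd f z)) \<in> borel_measurable circ" by (rule measurable_compose[OF bd_measurable[OF f(1)] h(1)])
  have i: "integrable circ (\<lambda>z. z * h (bd f z))" "integrable circ (\<lambda>z. bd f z * h (bd f z))"
    by (rule integrable_sphere_bounded_mult[OF _ hf, where B = 1 and C = C]; use h(2) bd_borel[OF f(1)] in simp)+
  have zh: "(\<lambda>z. z * h z) \<in> borel_measurable circ" using h(1) by measurable
  have "(\<integral>z. z * h (bd f z) \<partial>circ) = ?\<beta> * (\<integral>z. z * h z \<partial>circ)"
    using power_projection[OF f(1,2) _ h(1), of 1 C] h(2) by simp
  also have "(\<integral>z. z * h z \<partial>circ) = (\<integral>z. bd f z * h (bd f z) \<partial>circ)"
    using bd_integral[OF f(1,2) zh] by simp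
  finally show "(\<integral>z. (z - ?\<beta> * bd f z) * h (bd f z) \<partial>circ) = 0"
    using i by (simp add: left_diff_distrib mult.assoc)
qed auto

lemma inner_function_disc_inner:
  assumes "inner_function f"
  shows "disc_inner f"
proof -
  have "AE z in circ. \<exists>l. has_radial_limit f z l \<and> cmod l = 1"
    using assms by (simp add: inner_function_def AE_circle_measure_iff)
  then have "AE z in circ. cmod (bdry f z) = 1"
    by eventually_elim (auto simp: bdry_radial_limit)
  then show ?thesis
    using assms analytic_imp_holomorphic unfolding inner_function_def disc_inner_def by blast
qed

text \<open>Links the radial limits of the statement to the pointwise iterates of
  \<open>bd f\<close>. Countably many exceptional null sets are merged into one.\<close>

lemma AE_radial_limit_iterates:
  assumes f: "disc_inner f" "f 0 = 0"
  shows "AE z in circ. \<forall>n. (\<exists>l. has_radial_limit (f ^^ n) z l) \<and> radial_limit (f ^^ n) z = (bd f ^^ n) z"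
  unfolding AE_all_countable
proof
  fix n
  note fn = disc_inner_funpow[OF f, of n]
  have "AE z in circ. \<exists>l. has_radial_limit (f ^^ n) z l"
  proof (rule fatou)
    show "(f ^^ n) holomorphic_on ball 0 1" using fn by (simp add: disc_inner_def)
    show "cmod ((f ^^ n) w) \<le> 1" if "cmod w < 1" for w
      using disc_inner_norm_less[of "f ^^ n" w] fn that by simp
  qed
  moreover have "AE z in circ. bd (f ^^ n) z = bdry (f ^^ n) z" by (rule bd_AE) (use fn in simp)
  moreover have "AE z in circ. bd (f ^^ n) z = (bd f ^^ n) z" using fn by simp
  ultimately show "AE z in circ. (\<exists>l. has_radial_limit (f ^^ n) z l) \<and> radial_limit (f ^^ n) z = (bd f ^^ n) z"
    by eventually_elim (metis radial_limit_eq bdry_radial_limit(2))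
qed

lemma bounded_partial_sums_shift:
  fixes y :: "nat \<Rightarrow> complex"
  shows "(\<exists>K::nat. \<forall>m. cmod (\<Sum>i<m. y (i + n)) \<le> real K) \<longleftrightarrow> (\<exists>K::nat. \<forall>m. cmod (\<Sum>i<m. y i) \<le> real K)"
proof -
  have split: "(\<Sum>i<m + n. y i) = (\<Sum>i<n. y i) + (\<Sum>i<m. y (i + n))" for m
    using sum.nat_group[of y] sum.shift_bounds_nat_ivl[of y 0 n m] sum.atLeastLessThan_concat[of 0 n "m + n" y]
    by (simp add: lessThan_atLeast0)
  show ?thesis
  proof
    assume "\<exists>K::nat. \<forall>m. cmod (\<Sum>i<m. y (i + n)) \<le> real K"
    then obtain K :: nat where K: "\<And>m. cmod (\<Sum>i<m. y (i + n)) \<le> real K" by blast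
    have "cmod (\<Sum>i<m. y i) \<le> (\<Sum>i<n. cmod (y i)) + real K" for m
    proof (cases "n \<le> m")
      case True
      then have "(\<Sum>i<m. y i) = (\<Sum>i<n. y i) + (\<Sum>i<m - n. y (i + n))" using split[of "m - n"] by simp
      then show ?thesis using norm_triangle_le[OF add_mono[OF norm_sum[of y "{..<n}"] K[of "m - n"]]] by simp
    next
      case False
      have "cmod (\<Sum>i<m. y i) \<le> (\<Sum>i<m. cmod (y i))" by (rule norm_sum)
      also have "\<dots> \<le> (\<Sum>i<n. cmod (y i))" using False by (intro sum_mono2) auto
      finally show ?thesis by simp
    qed
    then show "\<exists>K::nat. \<forall>m. cmod (\<Sum>i<m. y i) \<le> real K" using real_nat_ceiling_ge order_trans by meson
  next
    assume "\<exists>K::nat. \<forall>m. cmod (\<Sum>i<m. y i) \<le> real K"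
    then obtain K :: nat where K: "\<And>m. cmod (\<Sum>i<m. y i) \<le> real K" by blast
    have "cmod (\<Sum>i<m. y (i + n)) \<le> real (2 * K)" for m
    proof -
      have "(\<Sum>i<m. y (i + n)) = (\<Sum>i<m + n. y i) - (\<Sum>i<n. y i)" using split[of m] by simp
      then show ?thesis using norm_triangle_ineq4[of "\<Sum>i<m + n. y i" "\<Sum>i<n. y i"] K[of "m + n"] K[of n] by simp
    qed
    then show "\<exists>K::nat. \<forall>m. cmod (\<Sum>i<m. y (i + n)) \<le> real K" by blast
  qed
qed

text \<open>Bounds are taken among the natural numbers, which leaves only countable
  quantifiers.\<close>

lemma bounded_iterate_series_set:
  assumes f: "disc_inner f"
  shows "{z \<in> sphere 0 1. \<exists>K::nat. \<forall>m. cmod (\<Sum>i<m. a i * (bd f ^^ i) z) \<le> real K} \<in> sets circ"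
proof -
  have "(\<lambda>z. (bd f ^^ i) z) \<in> borel_measurable circ" for i
    by (rule measurable_compose[OF funpow_bd_measurable[OF f] measurable_circ_id])
  then have "(\<lambda>z. cmod (\<Sum>i<m. a i * (bd f ^^ i) z)) \<in> borel_measurable circ" for m by measurable
  note [measurable] = this
  have "{z \<in> space circ. \<exists>K::nat. \<forall>m. cmod (\<Sum>i<m. a i * (bd f ^^ i) z) \<le> real K} \<in> sets circ" by measurable
  then show ?thesis by simp
qed

text \<open>Discarding the first n terms does not affect boundedness, so membership of z depends
  only on its n-th image, through the series with shifted coefficients: a tail set.\<close>

lemma bounded_iterate_series_zero_one:
  fixes a :: "nat \<Rightarrow> complex"
  assumes f: "disc_inner f" "f 0 = 0" "\<not> disc_rotation f"
  defines "A \<equiv> {z \<in> sphere 0 1. \<exists>K::nat. \<forall>m. cmod (\<Sum>i<m. a i * (bd f ^^ i) z) \<le> real K}"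
  shows "measure circ A = 0 \<or> measure circ A = 1"
proof (rule zero_one_law[OF f])
  show "A \<in> sets circ" unfolding A_def by (rule bounded_iterate_series_set[OF f(1)])
  fix n
  define A' where "A' = {z \<in> sphere 0 1. \<exists>K::nat. \<forall>m. cmod (\<Sum>i<m. a (i + n) * (bd f ^^ i) z) \<le> real K}"
  have "z \<in> A \<longleftrightarrow> (bd f ^^ n) z \<in> A'" if z: "z \<in> sphere 0 1" for z
  proof -
    have s: "(bd f ^^ n) z \<in> sphere 0 1"
      using measurable_space[OF funpow_bd_measurable[OF f(1)], of z n] z by simp
    have "(bd f ^^ i) ((bd f ^^ n) z) = (bd f ^^ (i + n)) z" for i by (simp add: funpow_add)
    then show ?thesis
      using bounded_partial_sums_shift[of "\<lambda>i. a i * (bd f ^^ i) z" n] z s by (simp add: A_def A'_def)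
  qed
  moreover have "A' \<in> sets circ" unfolding A'_def by (rule bounded_iterate_series_set[OF f(1)])
  ultimately show "\<exists>A'\<in>sets circ. \<forall>z\<in>sphere 0 1. z \<in> A \<longleftrightarrow> (bd f ^^ n) z \<in> A'" by blast
qed

section \<open>Transfer to arc length measure and the equivalences\<close>

lemma SUP_partial_sums_finite_iff:
  fixes s :: "nat \<Rightarrow> real"
  shows "(SUP N\<in>{1..}. ereal (s N)) < \<infinity> \<longleftrightarrow> (\<exists>K::nat. \<forall>N\<ge>1. s N \<le> real K)"
proof
  assume "(SUP N\<in>{1..}. ereal (s N)) < \<infinity>"
  then obtain K :: nat where K: "(SUP N\<in>{1..}. ereal (s N)) < ereal (real K)"
    using less_PInf_Ex_of_nat less_irrefl by metis
  have "s N \<le> real K" if "N \<ge> 1" for N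
  proof -
    have "ereal (s N) \<le> (SUP N\<in>{1..}. ereal (s N))" by (rule SUP_upper) (use that in simp)
    also note K
    finally show ?thesis by simp
  qed
  then show "\<exists>K::nat. \<forall>N\<ge>1. s N \<le> real K" by auto
next
  assume "\<exists>K::nat. \<forall>N\<ge>1. s N \<le> real K"
  then obtain K :: nat where "\<forall>N\<ge>1. s N \<le> real K" by blast
  then have "(SUP N\<in>{1..}. ereal (s N)) \<le> ereal (real K)" by (intro SUP_least) auto
  also have "\<dots> < \<infinity>" by simp
  finally show "(SUP N\<in>{1..}. ereal (s N)) < \<infinity>" .
qed

text \<open>The exceptional set lies in a null set, hence is itself measurable by completeness; the
  complement then has full measure 2 pi.\<close>

lemma AE_circle_measure_positive:
  assumes "AE z in circle_measure. P z"
  shows "emeasure circle_measure {z \<in> sphere 0 1. P z} > 0"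
proof -
  obtain N where N: "{z \<in> space circle_measure. \<not> P z} \<subseteq> N" "N \<in> null_sets circle_measure"
    using assms unfolding eventually_ae_filter by blast
  have "{z \<in> space circle_measure. \<not> P z} \<in> null_sets circle_measure"
    using null_sets_completion_subset[OF N(1)] N(2) unfolding circle_measure_def by blast
  then have "emeasure circle_measure (space circle_measure - {z \<in> space circle_measure. \<not> P z}) = emeasure circle_measure (space circle_measure)"
    by (rule emeasure_Diff_null_set) simp
  also have "space circle_measure - {z \<in> space circle_measure. \<not> P z} = {z \<in> sphere 0 1. P z}"
    by (auto simp: space_circle_measure)
  finally show ?thesis by (simp add: space_circle_measure emeasure_circle_measure_sphere)
qed

text \<open>A non-measurable set has \<open>emeasure\<close> 0 by convention, so positivity already
  forces B to be measurable.\<close>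

lemma positive_circle_measure_not_AE:
  assumes "emeasure circle_measure B > 0"
  shows "\<not> (AE z in circle_measure. z \<notin> B)"
proof
  assume AE: "AE z in circle_measure. z \<notin> B"
  have "B \<in> sets circle_measure" using assms emeasure_notin_sets by fastforce
  then have "{z \<in> space circle_measure. z \<in> B} = B" using sets.sets_into_space by blast
  then have "emeasure circle_measure B = 0"
    using emeasure_eq_0_AE[OF AE] by simp
  then show False using assms by simp
qed

theorem theorem1p1:
  fixes f :: "complex \<Rightarrow> complex" and a :: "nat \<Rightarrow> complex"
  assumes "inner_function f"
    and "f 0 = 0"
    and "\<not> disc_rotation f"
  shows
    "((AE \<xi> in circle_measure.
          (\<forall>n\<ge>1. \<exists>l. has_radial_limit (f ^^ n) \<xi> l) \<and>
          summable (\<lambda>n. a (Suc n) * radial_limit (f ^^ Suc n) \<xi>))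
        \<longleftrightarrow> summable (\<lambda>n. (cmod (a (Suc n)))\<^sup>2))
     \<and>
     (emeasure circle_measure
          {\<xi> \<in> sphere 0 1.
             (\<forall>n\<ge>1. \<exists>l. has_radial_limit (f ^^ n) \<xi> l) \<and>
             (SUP N\<in>{1..}. ereal (cmod (\<Sum>n=1..N. a n * radial_limit (f ^^ n) \<xi>))) < \<infinity>} > 0
        \<longleftrightarrow> summable (\<lambda>n. (cmod (a (Suc n)))\<^sup>2))"
proof -
  note f = inner_function_disc_inner[OF assms(1)] assms(2,3)
  interpret reverse_martingale_shift circ "bd f" "\<lambda>z. z" "cnj (\<integral>z. bd f z * cnj z \<partial>circ)"
    by (rule reverse_martingale_shift_inner[OF f])
  let ?good = "\<lambda>\<xi>. \<forall>n\<ge>1. \<exists>l. has_radial_limit (f ^^ n) \<xi> l"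
  let ?conv = "\<lambda>\<xi>. summable (\<lambda>n. a (Suc n) * radial_limit (f ^^ Suc n) \<xi>)"
  let ?bdd = "\<lambda>\<xi>. (SUP N\<in>{1..}. ereal (cmod (\<Sum>n=1..N. a n * radial_limit (f ^^ n) \<xi>))) < \<infinity>"
  have sum_Suc: "(\<Sum>n=1..N. a n * radial_limit (f ^^ n) \<xi>) = (\<Sum>i<N. a (Suc i) * radial_limit (f ^^ Suc i) \<xi>)" for N \<xi>
    by (rule sum.reindex_bij_witness[of _ Suc "\<lambda>n. n - 1"]) auto
  have conv_bdd: "?bdd \<xi>" if "?conv \<xi>" for \<xi>
  proof -
    have "Bseq (\<lambda>N. \<Sum>i<N. a (Suc i) * radial_limit (f ^^ Suc i) \<xi>)"
      using that by (intro convergent_imp_Bseq) (simp add: summable_iff_convergent)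
    then obtain K where "\<And>N. cmod (\<Sum>i<N. a (Suc i) * radial_limit (f ^^ Suc i) \<xi>) \<le> K" by (auto simp: Bseq_def)
    then have "\<forall>N\<ge>1. cmod (\<Sum>n=1..N. a n * radial_limit (f ^^ n) \<xi>) \<le> real (nat \<lceil>K\<rceil>)"
      unfolding sum_Suc using real_nat_ceiling_ge order_trans by blast
    then show ?thesis unfolding SUP_partial_sums_finite_iff by blast
  qed
  \<comment> \<open>The n-th term of the stated series at \<xi> is the n-th term of the abstract
    series, which starts with the identity, at the point \<open>bd f \<xi>\<close>.\<close>
  have fs: "(bd f ^^ Suc i) z = (bd f ^^ i) (bd f z)" for i z
    by (simp only: funpow_Suc_right o_apply)
  note lim = AE_radial_limit_iterates[OF f(1,2)]
  have ca: "AE \<xi> in circle_measure. ?good \<xi> \<and> ?conv \<xi>" if c: "summable (\<lambda>n. (cmod (a (Suc n)))\<^sup>2)"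
    unfolding AE_circle_measure_iff
    using lim bd_AE_compose[OF f(1,2) square_summable_imp_AE_summable[OF c]]
  proof eventually_elim
    case (elim \<xi>)
    have "(\<lambda>n. a (Suc n) * radial_limit (f ^^ Suc n) \<xi>) = (\<lambda>n. a (Suc n) * (bd f ^^ n) (bd f \<xi>))"
      using elim(1) fs by (simp del: funpow.simps)
    then show ?case using elim by (simp del: funpow.simps)
  qed
  have ab: "emeasure circle_measure {\<xi> \<in> sphere 0 1. ?good \<xi> \<and> ?bdd \<xi>} > 0"
    if "AE \<xi> in circle_measure. ?good \<xi> \<and> ?conv \<xi>"
  proof (rule AE_circle_measure_positive)
    show "AE \<xi> in circle_measure. ?good \<xi> \<and> ?bdd \<xi>" using that by eventually_elim (use conv_bdd in blast)
  qed
  have bc: "summable (\<lambda>n. (cmod (a (Suc n)))\<^sup>2)"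
    if b: "emeasure circle_measure {\<xi> \<in> sphere 0 1. ?good \<xi> \<and> ?bdd \<xi>} > 0"
  proof -
    \<comment> \<open>Boundedness set of the abstract series; the set in (b) is, up to a null set,
      contained in its preimage under \<open>bd f\<close>, so A cannot be null.\<close>
    define A where "A = {z \<in> sphere 0 1. \<exists>K::nat. \<forall>m. cmod (\<Sum>i<m. a (Suc i) * (bd f ^^ i) z) \<le> real K}"
    have A: "A \<in> sets circ" unfolding A_def by (rule bounded_iterate_series_set[OF f(1)])
    have "measure circ A \<noteq> 0"
    proof
      assume "measure circ A = 0"
      then have "A \<in> null_sets circ" using A by (simp add: circ.emeasure_eq_measure null_setsI)
      then have "AE z in circ. bd f z \<notin> A" by (intro bd_AE_compose[OF f(1,2)] AE_not_in)
      then have "AE z in circ. z \<notin> {\<xi> \<in> sphere 0 1. ?good \<xi> \<and> ?bdd \<xi>}"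
        using lim AE_space
      proof eventually_elim
        case (elim z)
        have e: "(\<Sum>i<N. a (Suc i) * radial_limit (f ^^ Suc i) z) = (\<Sum>i<N. a (Suc i) * (bd f ^^ i) (bd f z))" for N
          using elim(2) fs by (intro sum.cong) (simp_all del: funpow.simps)
        have "\<not> ?bdd z"
        proof
          assume "?bdd z"
          then obtain K :: nat where K: "\<forall>N\<ge>1. cmod (\<Sum>i<N. a (Suc i) * (bd f ^^ i) (bd f z)) \<le> real K"
            unfolding SUP_partial_sums_finite_iff sum_Suc e by blast
          \<comment> \<open>The supremum starts at N = 1; the empty sum N = 0 is trivially
            bounded.\<close>
          have "cmod (\<Sum>i<N. a (Suc i) * (bd f ^^ i) (bd f z)) \<le> real K" for N
            using K by (cases N) auto
          then show False using elim(1) by (auto simp: A_def)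
        qed
        then show ?case by blast
      qed
      then show False using positive_circle_measure_not_AE[OF b] unfolding AE_circle_measure_iff by blast
    qed
    then have "measure circ A = 1"
      using bounded_iterate_series_zero_one[OF f, of "\<lambda>i. a (Suc i)"] by (simp add: A_def)
    then have "AE z in circ. z \<in> A" using A by (simp add: circ.prob_eq_1)
    then have "AE z in circ. \<exists>K. \<forall>n. cmod (\<Sum>i<n. a (Suc i) * (bd f ^^ i) z) \<le> K"
      by eventually_elim (auto simp: A_def)
    then show ?thesis by (rule AE_bounded_imp_square_summable)
  qed
  from ca ab bc show ?thesis by blast
qed

end
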